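(* Let $F$ be a field of characteristic zero, $k\ge2$, $L=\mathrm{sl}_k(F)$. Let $\operatorname{Ad}_k$ denote the adjoint representation of $L$ and $\phi_k$ the representation of $L$ on $M_k(F)$ given by $c\mapsto\operatorname{ad}_c$, both extended to the universal enveloping algebra $U(L)$. Let $z_{p,k}:=c_{p,k}-\lambda_{p,k}$ for $2\le p\le k$ and $z'_{p,k}:=\lambda_{2,k}c_{p,k}-\lambda_{p,k}c_{2,k}$ for $3\le p\le k$, where $c_{p,k}$ are the Casimir elements and $\lambda_{p,k}$ their eigenvalues for $\operatorname{Ad}_k$. Then, as two-sided ideals of $U(L)$: (1) $\ker\operatorname{Ad}_k=\langle e_{12}^3,z_{2,k},\dots,z_{k,k}\rangle$. (2) $\ker\phi_k=\langle e_{12}^3,e_{12}z_{2,k},z'_{3,k},\dots,z'_{k,k}\rangle$. (3) $\ker\phi_k=\langle e_{12}^3+e_{12}z_{2,k}+e_{13}z_{3,k}+\cdots+e_{1k}z_{k,k}\rangle$.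
   Context: $\operatorname{ad}_c(x)=cx-xc$. $e_{ij}$ are the matrix units and $h_i:=e_{ii}-e_{i+1,i+1}$, $1\le i<k$. $\langle\cdots\rangle$ denotes the two-sided ideal generated. Casimir elements: put $x^i_j:=e_{ij}$ for $i\ne j$, and $x^i_i:=\frac1k\sum_{j=1}^{k-1}\alpha_{ij}h_j$ with $\alpha_{ij}:=k-j$ if $j\ge i$ and $\alpha_{ij}:=-j$ if $j<i$. For $2\le p\le k$, $c_{p,k}:=\sum_{i_1,\dots,i_p=1}^k x^{i_1}_{i_2}x^{i_2}_{i_3}\cdots x^{i_p}_{i_1}\in Z(U(L))$ (product in $U(L)$), and $\lambda_{p,k}\in F$ is the scalar by which $c_{p,k}$ acts in the adjoint representation of $L$. *)

theory Defs
  imports "Jordan_Normal_Form.Matrix" "HOL-Library.Poly_Mapping" "HOL-Algebra.QuotRing"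
begin

subsection \<open>Free associative algebras\<close>

datatype 'x free_monoid = Word (letters: "'x list")

instantiation free_monoid :: (type) monoid_add
begin

definition "0 = Word []"

definition "u + v = Word (letters u @ letters v)"

instance
  by standard (simp_all add: zero_free_monoid_def plus_free_monoid_def)

end

text \<open>The free unital associative algebra on the set \<open>L\<close> of letters is the monoid algebra of the
  words over \<open>L\<close>; the product of \<open>poly_mapping\<close> is the convolution product.\<close>

definition free_algebra :: "'x set \<Rightarrow> ('x free_monoid \<Rightarrow>\<^sub>0 'a::ring_1) ring" where
  "free_algebra L = \<lparr>carrier = {f. \<forall>w \<in> Poly_Mapping.keys f. set (letters w) \<subseteq> L},
     mult = (*), one = 1, zero = 0, add = (+)\<rparr>"

definition letter :: "'x \<Rightarrow> ('x free_monoid \<Rightarrow>\<^sub>0 'a::ring_1)" where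
  "letter X = Poly_Mapping.single (Word [X]) 1"

definition scalar :: "'a \<Rightarrow> ('x free_monoid \<Rightarrow>\<^sub>0 'a::ring_1)" where
  "scalar c = Poly_Mapping.single 0 c"

subsection \<open>Universal enveloping algebra of a Lie algebra of matrices\<close>

text \<open>\<open>L\<close> is a linear space of square matrices closed under the commutator. The first two families
  of relations make the letters linear in \<open>L\<close>, so that the quotient by them is the tensor
  algebra of \<open>L\<close>.\<close>

definition enveloping_relations :: "'a::field mat set \<Rightarrow> ('a mat free_monoid \<Rightarrow>\<^sub>0 'a) set" where
  "enveloping_relations L =
     {letter (X + Y) - (letter X + letter Y) | X Y. X \<in> L \<and> Y \<in> L} \<union>
     {letter (c \<cdot>\<^sub>m X) - scalar c * letter X | c X. X \<in> L} \<union>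
     {letter X * letter Y - letter Y * letter X - letter (X * Y - Y * X) | X Y. X \<in> L \<and> Y \<in> L}"

definition enveloping_ideal :: "'a::field mat set \<Rightarrow> ('a mat free_monoid \<Rightarrow>\<^sub>0 'a) set" where
  "enveloping_ideal L = Idl\<^bsub>free_algebra L\<^esub> (enveloping_relations L)"

definition enveloping :: "'a::field mat set \<Rightarrow> ('a mat free_monoid \<Rightarrow>\<^sub>0 'a) set ring" where
  "enveloping L = free_algebra L Quot enveloping_ideal L"

definition env_gen :: "'a::field mat set \<Rightarrow> 'a mat \<Rightarrow> ('a mat free_monoid \<Rightarrow>\<^sub>0 'a) set" where
  "env_gen L X = enveloping_ideal L +>\<^bsub>free_algebra L\<^esub> letter X"

definition env_scalar :: "'a::field mat set \<Rightarrow> 'a \<Rightarrow> ('a mat free_monoid \<Rightarrow>\<^sub>0 'a) set" where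
  "env_scalar L c = enveloping_ideal L +>\<^bsub>free_algebra L\<^esub> scalar c"

subsection \<open>Extension of a representation to the enveloping algebra\<close>

text \<open>\<open>\<rho>\<close> is a representation on a linear space \<open>V\<close> of \<open>k \<times> k\<close> matrices. A word
  \<open>X\<^sub>1 \<dots> X\<^sub>n\<close> acts by \<open>\<rho> X\<^sub>1 \<circ> \<dots> \<circ> \<rho> X\<^sub>n\<close>, and linear combinations of words act
  by the corresponding linear combinations, here computed entrywise. This action is the same for
  all elements of a coset of the enveloping ideal.\<close>

definition free_action ::
    "nat \<Rightarrow> ('a mat \<Rightarrow> 'a mat \<Rightarrow> 'a mat) \<Rightarrow> ('a mat free_monoid \<Rightarrow>\<^sub>0 'a::field) \<Rightarrow> 'a mat \<Rightarrow> 'a mat" where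
  "free_action k \<rho> f v =
     mat k k (\<lambda>ij. \<Sum>w \<in> Poly_Mapping.keys f. Poly_Mapping.lookup f w * foldr \<rho> (letters w) v $$ ij)"

definition env_rep ::
    "nat \<Rightarrow> 'a mat set \<Rightarrow> ('a mat \<Rightarrow> 'a mat \<Rightarrow> 'a mat) \<Rightarrow> ('a mat free_monoid \<Rightarrow>\<^sub>0 'a::field) set
      \<Rightarrow> 'a mat \<Rightarrow> 'a mat" where
  "env_rep k V \<rho> u = the_elem ((\<lambda>f. \<lambda>v\<in>V. free_action k \<rho> f v) ` u)"

subsection \<open>The Lie algebra sl and its representations\<close>

definition sl :: "nat \<Rightarrow> 'a::field mat set" where
  "sl k = {A \<in> carrier_mat k k. (\<Sum>i<k. A $$ (i, i)) = 0}"

definition ad :: "'a::field mat \<Rightarrow> 'a mat \<Rightarrow> 'a mat" where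
  "ad C X = C * X - X * C"

abbreviation U_sl :: "nat \<Rightarrow> ('a::field mat free_monoid \<Rightarrow>\<^sub>0 'a) set ring" where
  "U_sl k \<equiv> enveloping (sl k)"

definition Ad_rep :: "nat \<Rightarrow> ('a::field mat free_monoid \<Rightarrow>\<^sub>0 'a) set \<Rightarrow> 'a mat \<Rightarrow> 'a mat" where
  "Ad_rep k = env_rep k (sl k) ad"

definition phi_rep :: "nat \<Rightarrow> ('a::field mat free_monoid \<Rightarrow>\<^sub>0 'a) set \<Rightarrow> 'a mat \<Rightarrow> 'a mat" where
  "phi_rep k = env_rep k (carrier_mat k k) ad"

definition ker_Ad :: "nat \<Rightarrow> ('a::field mat free_monoid \<Rightarrow>\<^sub>0 'a) set set" where
  "ker_Ad k = {u \<in> carrier (U_sl k). \<forall>v \<in> sl k. Ad_rep k u v = 0\<^sub>m k k}"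

definition ker_phi :: "nat \<Rightarrow> ('a::field mat free_monoid \<Rightarrow>\<^sub>0 'a) set set" where
  "ker_phi k = {u \<in> carrier (U_sl k). \<forall>v \<in> carrier_mat k k. phi_rep k u v = 0\<^sub>m k k}"

subsection \<open>Casimir elements\<close>

text \<open>Matrix units are indexed from 1, whereas entries of the type \<open>mat\<close> are indexed from 0.\<close>

definition mat_unit :: "nat \<Rightarrow> nat \<Rightarrow> nat \<Rightarrow> 'a::field mat" where
  "mat_unit k i j = mat k k (\<lambda>(r, s). if Suc r = i \<and> Suc s = j then 1 else 0)"

definition cartan :: "nat \<Rightarrow> nat \<Rightarrow> 'a::field mat" where
  "cartan k i = mat_unit k i i - mat_unit k (i + 1) (i + 1)"

text \<open>The diagonal elements \<open>casimir_entry k i i\<close> are \<open>e\<^sub>i\<^sub>i - 1 / k\<close>, written in the basis of the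
  diagonal matrices of trace 0 given by \<open>cartan k l\<close> for \<open>1 \<le> l < k\<close>.\<close>

definition casimir_coeff :: "nat \<Rightarrow> nat \<Rightarrow> nat \<Rightarrow> 'a::field" where
  "casimir_coeff k i j = (if i \<le> j then of_nat k - of_nat j else - of_nat j)"

definition casimir_entry :: "nat \<Rightarrow> nat \<Rightarrow> nat \<Rightarrow> 'a::field mat" where
  "casimir_entry k i j =
     (if i \<noteq> j then mat_unit k i j
      else (1 / of_nat k) \<cdot>\<^sub>m
        (\<Oplus>\<^bsub>module_mat TYPE('a) k k\<^esub>l\<in>{1..k-1}. casimir_coeff k i l \<cdot>\<^sub>m cartan k l))"

definition casimir :: "nat \<Rightarrow> nat \<Rightarrow> ('a::field mat free_monoid \<Rightarrow>\<^sub>0 'a) set" where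
  "casimir k p =
     (\<Oplus>\<^bsub>U_sl k\<^esub>ind \<in> {ind. set ind \<subseteq> {1..k} \<and> length ind = p}.
        foldr (\<lambda>t y. env_gen (sl k) (casimir_entry k (ind ! t) (ind ! ((t + 1) mod p))) \<otimes>\<^bsub>U_sl k\<^esub> y)
          [0..<p] \<one>\<^bsub>U_sl k\<^esub>)"

definition casimir_eigenvalue :: "nat \<Rightarrow> nat \<Rightarrow> 'a::field" where
  "casimir_eigenvalue k p = (THE l. \<forall>v \<in> sl k. Ad_rep k (casimir k p) v = l \<cdot>\<^sub>m v)"

abbreviation env_unit :: "nat \<Rightarrow> nat \<Rightarrow> nat \<Rightarrow> ('a::field mat free_monoid \<Rightarrow>\<^sub>0 'a) set" where
  "env_unit k i j \<equiv> env_gen (sl k) (mat_unit k i j)"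

definition casimir_z :: "nat \<Rightarrow> nat \<Rightarrow> ('a::field mat free_monoid \<Rightarrow>\<^sub>0 'a) set" where
  "casimir_z k p = casimir k p \<ominus>\<^bsub>U_sl k\<^esub> env_scalar (sl k) (casimir_eigenvalue k p)"

definition casimir_z' :: "nat \<Rightarrow> nat \<Rightarrow> ('a::field mat free_monoid \<Rightarrow>\<^sub>0 'a) set" where
  "casimir_z' k p =
     env_scalar (sl k) (casimir_eigenvalue k 2) \<otimes>\<^bsub>U_sl k\<^esub> casimir k p
     \<ominus>\<^bsub>U_sl k\<^esub> env_scalar (sl k) (casimir_eigenvalue k p) \<otimes>\<^bsub>U_sl k\<^esub> casimir k 2"

end

theory Submission
  imports Defs
begin

text \<open>Let \<open>L = sl k\<close>. Both kernels are compared with the ideals generated by \<open>e\<^sub>1\<^sub>2\<^sup>3\<close> together with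
\<open>z\<^sub>2\<close> or \<open>e\<^sub>1\<^sub>2 z\<^sub>2\<close>, where \<open>z\<^sub>2 = c\<^sub>2 - 2 k\<close>.

Let \<open>I\<close> be an ideal of \<open>U(L)\<close> that contains \<open>e\<^sub>1\<^sub>2\<^sup>3\<close> and \<open>z\<^sub>2\<close> and is contained in the kernel \<open>P\<close> of the
adjoint representation. Commutators turn \<open>e\<^sub>1\<^sub>2\<^sup>3\<close> into the cubes of all raising operators, so a vector
killed by the raising operators in a module killed by \<open>I\<close> has a weight whose values on the positive
coroots are 0, 1 or 2. Such a dominant weight is a sum of at most two fundamental weights, and among
these weights \<open>c\<^sub>2\<close> takes the value \<open>2 k\<close> only on the highest root (\<open>casimir_value_determines_adjoint_weight\<close>).
Hence every nonzero submodule of every quotient of \<open>U(L) / I\<close> contains a highest weight vector whose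
weight is the highest root (\<open>exists_highest\<close>).

This gives \<open>P \<subseteq> I\<close> in two steps, without complete reducibility. First, \<open>P\<close> kills every such
vector \<open>w\<close> of \<open>U(L) / I\<close> (\<open>P_highest\<close>): otherwise \<open>P w\<close> contains another one, \<open>u w\<close> with \<open>u \<in> P\<close>.
By the triangular decomposition \<open>u = c + l + r\<close>, where \<open>c\<close> is a scalar, \<open>l\<close> a sum of products of
lowering operators and \<open>r\<close> kills all highest weight vectors of that weight. Applying \<open>u\<close> to
\<open>e\<^sub>1\<^sub>k \<in> L\<close> shows \<open>c = 0\<close>, so \<open>u w = l w\<close> has only lower weights, which is impossible. Secondly,
let \<open>N\<close> be the largest submodule of \<open>U(L) / I\<close> killed by \<open>P\<close> (\<open>annihilator_subset_relations\<close>). If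
\<open>N\<close> is proper, take a highest weight vector \<open>w\<close> modulo \<open>N\<close>. A suitable polynomial in the grading
element moves \<open>w\<close> inside its class, up to a nonzero factor, to a vector that is highest in
\<open>U(L) / I\<close> itself. By the first step this vector lies in \<open>N\<close>, a contradiction. So \<open>1 \<in> N\<close>.

The matrices split as \<open>L\<close> plus the scalar matrices, so the kernel of \<open>\<phi>\<close> consists of the elements
of \<open>P\<close> that kill the identity matrix. If an ideal \<open>J\<close> contains \<open>e\<^sub>1\<^sub>2\<^sup>3\<close> and \<open>e\<^sub>1\<^sub>2 z\<^sub>2\<close>, then \<open>L z\<^sub>2 \<subseteq> J\<close>, as
\<open>z\<^sub>2\<close> is central and \<open>L\<close> is simple. Therefore \<open>J + F z\<^sub>2\<close> is an ideal, which contains \<open>P\<close>; and since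
\<open>z\<^sub>2\<close> acts on the identity matrix by \<open>- 2 k \<noteq> 0\<close>, the kernel of \<open>\<phi>\<close> is contained in \<open>J\<close>
(\<open>ker_phi_subset_ideal\<close>). For the single generator, \<open>e\<^sub>1\<^sub>2\<^sup>3\<close>, \<open>e\<^sub>1\<^sub>2 z\<^sub>2\<close> and the remaining summands have
the eigenvalues 6, 2 and 1 under the commutator with \<open>e\<^sub>1\<^sub>1 - e\<^sub>2\<^sub>2\<close>, so the first two lie in every
ideal that contains the sum (\<open>single_generator_components\<close>).

All computations take place in the free algebra, which is a ring in the sense of type classes, modulo
ideals of it. There the letters \<open>x i j\<close> of the matrices \<open>e\<^sub>i\<^sub>j - \<delta>\<^sub>i\<^sub>j / k\<close> satisfy the commutation
relations of the matrix units and have trace 0, and these relations are the interface between the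
part on highest weight vectors and the part on matrices.\<close>

section \<open>The quadratic Casimir value of a weight\<close>

lemma antitone_threshold:
  fixes Q :: "nat \<Rightarrow> bool"
  assumes "\<And>a b. 1 \<le> a \<Longrightarrow> a \<le> b \<Longrightarrow> b \<le> k \<Longrightarrow> Q b \<Longrightarrow> Q a"
  shows "\<exists>p\<le>k. \<forall>a\<in>{1..k}. Q a \<longleftrightarrow> a \<le> p"
  using assms
proof (induction k)
  case 0
  then show ?case by auto
next
  case (Suc k)
  show ?case
  proof (cases "Q (Suc k)")
    case True
    then show ?thesis using Suc.prems[of _ "Suc k"] by (intro exI[of _ "Suc k"]) auto
  next
    case False
    obtain p where p: "p \<le> k" "\<forall>a\<in>{1..k}. Q a \<longleftrightarrow> a \<le> p"
      using Suc.IH Suc.prems by (meson le_Suc_eq)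
    have "Q a \<longleftrightarrow> a \<le> p" if "a \<in> {1..Suc k}" for a
      using that p False by (cases "a = Suc k") auto
    then show ?thesis using p(1) by (intro exI[of _ p]) auto
  qed
qed

text \<open>This equation says that \<open>c\<^sub>2\<close> has the value \<open>2 k\<close> on the sum of the fundamental weights number \<open>p\<close>
and \<open>q\<close>. For \<open>p = 0\<close> it makes \<open>k + 1\<close> a divisor of 2. Otherwise \<open>p (k - p)\<close> and \<open>q (k - q)\<close> are at
least \<open>k - 1\<close>, which leaves at most 1 for \<open>p (k - q)\<close>.\<close>

lemma casimir_diophantine:
  fixes p q k :: int
  assumes "0 \<le> p" "p \<le> q" "q < k" "2 \<le> k"
    and eq: "(k + 1) * (p * (k - p) + q * (k - q)) + 2 * p * (k - q) = 2 * k\<^sup>2"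
  shows "p = 1 \<and> q = k - 1"
proof (cases "p = 0")
  case True
  have "2 = 2 * k\<^sup>2 - (k + 1) * (2 * (k - 1))"
    by (simp add: algebra_simps power2_eq_square)
  also have "\<dots> = (k + 1) * (q * (k - q) - 2 * (k - 1))"
    using eq True by (simp add: algebra_simps)
  finally have "k + 1 dvd 2" by (metis dvd_triv_left)
  then show ?thesis using assms(4) zdvd_imp_le by fastforce
next
  case False
  have p: "p * (k - p) = (k - 1) + (p - 1) * (k - p - 1)"
    by (simp add: algebra_simps)
  have q: "q * (k - q) = (k - 1) + (q - 1) * (k - q - 1)"
    by (simp add: algebra_simps)
  have "0 \<le> (p - 1) * (k - p - 1)" "0 \<le> (q - 1) * (k - q - 1)"
    using False assms by (auto intro!: mult_nonneg_nonneg)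
  then have "(k + 1) * (2 * (k - 1)) \<le> (k + 1) * (p * (k - p) + q * (k - q))"
    using assms by (intro mult_left_mono) (auto simp: p q)
  moreover have "(k + 1) * (2 * (k - 1)) = 2 * k\<^sup>2 - 2"
    by (simp add: algebra_simps power2_eq_square)
  ultimately have le: "p * (k - q) \<le> 1" using eq by linarith
  have "p = 1" "k - q = 1"
  proof -
    have "p * 1 \<le> p * (k - q)" using assms False by (intro mult_left_mono) auto
    then show "p = 1" using le False assms(1) by linarith
    then show "k - q = 1" using le assms by auto
  qed
  then show ?thesis by simp
qed

lemma sum_of_bool_le:
  assumes "p \<le> k"
  shows "(\<Sum>i=1..k. of_bool (i \<le> p)) = (of_nat p :: 'a::semiring_1)"
proof -
  have "(\<Sum>i=1..k. of_bool (i \<le> p)) = (\<Sum>i=1..p. (1::'a))"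
    using assms by (intro sum.mono_neutral_cong_right) auto
  then show ?thesis by simp
qed

lemma sum_of_bool_gt:
  assumes "p \<le> k"
  shows "(\<Sum>i=1..k. of_bool (p < i)) = (of_nat k - of_nat p :: 'a::ring_1)"
proof -
  have "of_bool (p < i) = 1 - (of_bool (i \<le> p) :: 'a)" for i by auto
  then show ?thesis using sum_of_bool_le[OF assms, where 'a='a] by (simp add: sum_subtractf)
qed

lemma sum_pairs_threshold:
  assumes "p \<le> k"
  shows "(\<Sum>i=1..k. \<Sum>j=1..k. if i < j then of_bool (i \<le> p) - of_bool (j \<le> p) else 0) =
    (of_nat p * (of_nat k - of_nat p) :: 'a::ring_1)"
proof -
  have "(\<Sum>i=1..k. \<Sum>j=1..k. if i < j then of_bool (i \<le> p) - of_bool (j \<le> p) else 0) =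
      (\<Sum>i=1..k. \<Sum>j=1..k. of_bool (i \<le> p) * (of_bool (p < j) :: 'a))"
    by (intro sum.cong refl) auto
  also have "\<dots> = (\<Sum>i=1..k. of_bool (i \<le> p)) * (\<Sum>j=1..k. of_bool (p < j))"
    by (simp only: sum_product)
  finally show ?thesis by (simp only: sum_of_bool_le[OF assms] sum_of_bool_gt[OF assms])
qed

text \<open>The scalar by which \<open>\<Sum> x\<^sub>i\<^sub>j x\<^sub>j\<^sub>i\<close> acts on a highest weight vector on which \<open>x\<^sub>i\<^sub>i\<close> acts by \<open>m i\<close>.\<close>

definition casimir_value :: "nat \<Rightarrow> (nat \<Rightarrow> 'a::field) \<Rightarrow> 'a" where
  "casimir_value k m =
     (\<Sum>i=1..k. \<Sum>j=1..k. if i < j then m i - m j else if i = j then m i * m i else 0)"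

lemma casimir_value_threshold:
  fixes m :: "nat \<Rightarrow> 'a::field_char_0"
  assumes pq: "p \<le> q" "q < k"
    and m: "\<And>i. i \<in> {1..k} \<Longrightarrow> m i = of_bool (i \<le> p) + of_bool (i \<le> q) - of_nat (p + q) / of_nat k"
  shows "of_nat k * casimir_value k m =
    (of_nat k + 1) * (of_nat p * (of_nat k - of_nat p) + of_nat q * (of_nat k - of_nat q))
      + 2 * of_nat p * (of_nat k - of_nat q)"
proof -
  define c :: 'a where "c = of_nat (p + q) / of_nat k"
  have mc: "m i = of_bool (i \<le> p) + of_bool (i \<le> q) - c" if "i \<in> {1..k}" for i
    using m[OF that] by (simp only: c_def)
  have k0: "(of_nat k :: 'a) \<noteq> 0" using pq by simp
  have ck: "of_nat k * c = of_nat p + of_nat q" using k0 by (simp add: c_def)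
  have "casimir_value k m =
      (\<Sum>i=1..k. \<Sum>j=1..k. (if i < j then of_bool (i \<le> p) - of_bool (j \<le> p) else 0)
         + (if i < j then of_bool (i \<le> q) - of_bool (j \<le> q) else 0)
         + (if i = j then m i * m i else 0))"
    unfolding casimir_value_def
    by (intro sum.cong refl) (simp add: mc algebra_simps)
  also have "\<dots> = of_nat p * (of_nat k - of_nat p) + of_nat q * (of_nat k - of_nat q)
      + (\<Sum>i=1..k. \<Sum>j=1..k. if i = j then m i * m i else 0)"
    using pq sum_pairs_threshold[of p k, where 'a='a] sum_pairs_threshold[of q k, where 'a='a]
    by (simp add: sum.distrib)
  also have "(\<Sum>i=1..k. \<Sum>j=1..k. if i = j then m i * m i else 0) = (\<Sum>i=1..k. m i * m i)"
    by (intro sum.cong refl) simp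
  also have "\<dots> = (\<Sum>i=1..k. (3 - 2 * c) * of_bool (i \<le> p) + (1 - 2 * c) * of_bool (i \<le> q) + c * c)"
    using pq(1) by (intro sum.cong refl) (auto simp: mc algebra_simps)
  also have "\<dots> = (3 - 2 * c) * of_nat p + (1 - 2 * c) * of_nat q + of_nat k * (c * c)"
    using pq sum_of_bool_le[of p k, where 'a='a] sum_of_bool_le[of q k, where 'a='a]
    by (simp add: sum.distrib sum_distrib_left[symmetric])
  finally have cv: "casimir_value k m = of_nat p * (of_nat k - of_nat p) + of_nat q * (of_nat k - of_nat q)
      + ((3 - 2 * c) * of_nat p + (1 - 2 * c) * of_nat q + of_nat k * (c * c))" .
  have "of_nat k * casimir_value k m =
     of_nat k * (of_nat p * (of_nat k - of_nat p) + of_nat q * (of_nat k - of_nat q))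
      + of_nat k * (3 * of_nat p + of_nat q) - 2 * (of_nat k * c) * (of_nat p + of_nat q) + (of_nat k * c) * (of_nat k * c)"
    unfolding cv by (simp add: algebra_simps)
  then show ?thesis unfolding ck by (simp add: algebra_simps)
qed

text \<open>The weight of \<open>e\<^sub>1\<^sub>k\<close>, which is the highest root.\<close>

definition adjoint_weight :: "nat \<Rightarrow> nat \<Rightarrow> 'a::field" where
  "adjoint_weight k i = of_bool (i = 1) - of_bool (i = k)"

lemma adjoint_weight_threshold:
  assumes "2 \<le> k" "i \<in> {1..k}"
  shows "adjoint_weight k i =
    of_bool (i \<le> 1) + of_bool (i \<le> k - 1) - (of_nat (1 + (k - 1)) / of_nat k :: 'a::field_char_0)"
  using assms by (auto simp: adjoint_weight_def)

lemma casimir_value_adjoint_weight: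
  assumes "2 \<le> k"
  shows "casimir_value k (adjoint_weight k) = (2 * of_nat k :: 'a::field_char_0)"
proof -
  have le: "1 \<le> k - 1" "k - 1 < k" using assms by auto
  have "of_nat k * casimir_value k (adjoint_weight k) = (of_nat k + 1) * (of_nat 1 * (of_nat k - of_nat 1)
      + of_nat (k - 1) * (of_nat k - of_nat (k - 1))) + 2 * of_nat 1 * (of_nat k - (of_nat (k - 1) :: 'a))"
    by (rule casimir_value_threshold[OF le adjoint_weight_threshold[OF assms]])
  also have "of_nat (k - 1) = (of_nat k - 1 :: 'a)"
    using assms by (simp add: of_nat_diff)
  finally have "of_nat k * casimir_value k (adjoint_weight k) = (of_nat k * (2 * of_nat k) :: 'a)"
    by (simp add: algebra_simps)
  then show ?thesis using assms by simp
qed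

text \<open>A weight whose differences \<open>d\<close> to the last entry decrease within \<open>{0, 1, 2}\<close> is given by the two
places \<open>p \<le> q\<close> where \<open>d\<close> drops, up to the constant that makes the trace vanish. The value \<open>2 k\<close>
then turns into the Diophantine equation above.\<close>

lemma casimir_value_determines_adjoint_weight:
  fixes m :: "nat \<Rightarrow> 'a::field_char_0"
  assumes k: "2 \<le> k"
    and d: "\<And>i. i \<in> {1..k} \<Longrightarrow> d i \<le> (2::nat)" "\<And>i j. 1 \<le> i \<Longrightarrow> i \<le> j \<Longrightarrow> j \<le> k \<Longrightarrow> d j \<le> d i" "d k = 0"
    and m: "\<And>i. i \<in> {1..k} \<Longrightarrow> m i = of_nat (d i) + m k" and m0: "(\<Sum>i=1..k. m i) = 0"
    and val: "casimir_value k m = 2 * of_nat k"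
    and i: "i \<in> {1..k}"
  shows "m i = adjoint_weight k i"
proof -
  obtain p where p: "\<forall>a\<in>{1..k}. 2 \<le> d a \<longleftrightarrow> a \<le> p" "p \<le> k"
    using antitone_threshold[of k "\<lambda>a. 2 \<le> d a"] order_trans[OF _ d(2)] by blast
  obtain q where q: "\<forall>a\<in>{1..k}. 1 \<le> d a \<longleftrightarrow> a \<le> q" "q \<le> k"
    using antitone_threshold[of k "\<lambda>a. 1 \<le> d a"] order_trans[OF _ d(2)] by blast
  have "\<not> k \<le> q" using q k d(3) bspec[OF q(1), of k] by auto
  then have qk: "q < k" by simp
  have pq: "p \<le> q"
  proof (cases "p = 0")
    case False
    then have "p \<in> {1..k}" using p(2) by simp
    moreover from this have "2 \<le> d p" using p(1) by blast
    ultimately show ?thesis using q(1) by auto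
  qed simp
  have dv: "d a = of_bool (a \<le> p) + of_bool (a \<le> q)" if a: "a \<in> {1..k}" for a
  proof -
    have "2 \<le> d a \<longleftrightarrow> a \<le> p" "1 \<le> d a \<longleftrightarrow> a \<le> q" "d a \<le> 2"
      using p(1) q(1) d(1)[OF a] a by blast+
    then show ?thesis by (cases "a \<le> p"; cases "a \<le> q") auto
  qed
  have "(\<Sum>i=1..k. m i) = (\<Sum>i=1..k. of_bool (i \<le> p) + of_bool (i \<le> q) + m k)"
    by (intro sum.cong refl) (subst m, simp_all add: dv)
  then have "of_nat p + of_nat q + of_nat k * m k = 0"
    using m0 pq qk sum_of_bool_le[of p k, where 'a='a] sum_of_bool_le[of q k, where 'a='a]
    by (simp add: sum.distrib)
  then have mk: "m k = - (of_nat (p + q) / of_nat k)"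
    using k by (simp add: eq_neg_iff_add_eq_0 field_simps)
  have mi: "m a = of_bool (a \<le> p) + of_bool (a \<le> q) - of_nat (p + q) / of_nat k" if "a \<in> {1..k}" for a
    using m[OF that] mk by (simp add: dv[OF that])
  have "(of_int ((int k + 1) * (int p * (int k - int p) + int q * (int k - int q)) + 2 * int p * (int k - int q)) :: 'a)
      = (of_nat k + 1) * (of_nat p * (of_nat k - of_nat p) + of_nat q * (of_nat k - of_nat q))
        + 2 * of_nat p * (of_nat k - of_nat q)"
    by simp
  also have "\<dots> = of_nat k * (2 * of_nat k)"
    by (rule casimir_value_threshold[OF pq qk mi, unfolded val, symmetric])
  also have "\<dots> = of_int (2 * (int k)\<^sup>2)"
    by (simp add: power2_eq_square)
  finally have "(of_int ((int k + 1) * (int p * (int k - int p) + int q * (int k - int q)) + 2 * int p * (int k - int q)) :: 'a)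
      = of_int (2 * (int k)\<^sup>2)" .
  then have "(int k + 1) * (int p * (int k - int p) + int q * (int k - int q)) + 2 * int p * (int k - int q)
      = 2 * (int k)\<^sup>2"
    by (simp only: of_int_eq_iff)
  then have "int p = 1 \<and> int q = int k - 1"
    using casimir_diophantine[of "int p" "int q" "int k"] pq qk k by simp
  then have "p = 1" "q = k - 1" using k by auto
  then show ?thesis unfolding mi[OF i] adjoint_weight_threshold[OF k i] by (simp only:)
qed

section \<open>Left ideals modulo the relations of the matrix units\<close>

text \<open>\<open>x i j\<close> stands for \<open>e\<^sub>i\<^sub>j - \<delta>\<^sub>i\<^sub>j / k\<close> in a ring whose elements are taken modulo the ideal \<open>I\<close>. The
induction rule \<open>gen\<close> says that scalars and the \<open>x i j\<close> generate the ring modulo \<open>I\<close>.\<close>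

locale gl_relations =
  fixes k :: nat and sc :: "'a::field_char_0 \<Rightarrow> 't::ring_1" and x :: "nat \<Rightarrow> nat \<Rightarrow> 't" and I :: "'t set"
  assumes k: "2 \<le> k"
    and sc_add: "sc (c + d) = sc c + sc d" and sc_mult: "sc (c * d) = sc c * sc d"
    and sc_1: "sc 1 = 1" and sc_comm: "t * sc c = sc c * t"
    and I_add: "r \<in> I \<Longrightarrow> s \<in> I \<Longrightarrow> r + s \<in> I"
    and I_left: "r \<in> I \<Longrightarrow> t * r \<in> I" and I_right: "r \<in> I \<Longrightarrow> r * t \<in> I"
    and comm: "a \<in> {1..k} \<Longrightarrow> b \<in> {1..k} \<Longrightarrow> i \<in> {1..k} \<Longrightarrow> j \<in> {1..k} \<Longrightarrow>
      x a b * x i j - x i j * x a b - ((if b = i then x a j else 0) - (if a = j then x i b else 0)) \<in> I"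
    and trace: "(\<Sum>i=1..k. x i i) \<in> I"
    and gen [consumes 0, case_names rel sc mult add]: "(\<And>r. r \<in> I \<Longrightarrow> Q r) \<Longrightarrow> (\<And>d. Q (sc d)) \<Longrightarrow>
      (\<And>u a b. Q u \<Longrightarrow> a \<in> {1..k} \<Longrightarrow> b \<in> {1..k} \<Longrightarrow> Q (u * x a b)) \<Longrightarrow>
      (\<And>u v. Q u \<Longrightarrow> Q v \<Longrightarrow> Q (u + v)) \<Longrightarrow> Q t"
begin

lemma sc_0: "sc 0 = 0" using sc_add[of 0 0] by simp
lemma sc_minus: "sc (- a) = - sc a" using sc_add[of a "- a"] by (simp add: sc_0 eq_neg_iff_add_eq_0 add.commute)
lemma sc_diff: "sc (a - b) = sc a - sc b" using sc_add[of a "- b"] by (simp add: sc_minus)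
lemma sc_of_nat: "sc (of_nat n) = of_nat n" by (induction n) (simp_all add: sc_0 sc_add sc_1)
lemma sc_numeral: "sc (numeral n) = numeral n" using sc_of_nat[of "numeral n"] by simp
lemma sc_sum: "sc (\<Sum>i\<in>S. f i) = (\<Sum>i\<in>S. sc (f i))"
  by (induction S rule: infinite_finite_induct) (simp_all add: sc_0 sc_add)
lemma sc_left: "t * (sc a * u) = sc a * (t * u)"
  by (metis mult.assoc sc_comm)
lemma sc_inverse: "c \<noteq> 0 \<Longrightarrow> sc (inverse c) * (sc c * t) = t"
  by (simp add: mult.assoc[symmetric] sc_mult[symmetric] sc_1)

text \<open>Left ideals above \<open>I\<close> are the submodules of the left regular module modulo \<open>I\<close>, and a quotient of
such submodules is treated by computing modulo a left ideal. Closure under scalars is part of the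
closure under left multiplication.\<close>

definition left_ideal :: "'t set \<Rightarrow> bool" where
  "left_ideal N \<longleftrightarrow> I \<subseteq> N \<and> (\<forall>s\<in>N. \<forall>t\<in>N. s + t \<in> N) \<and> (\<forall>s\<in>N. \<forall>t. t * s \<in> N)"

lemma left_ideal_I: "left_ideal I"
  by (simp add: left_ideal_def I_add I_left)

lemma left_idealD:
  assumes "left_ideal N"
  shows "r \<in> I \<Longrightarrow> r \<in> N" "s \<in> N \<Longrightarrow> t \<in> N \<Longrightarrow> s + t \<in> N" "s \<in> N \<Longrightarrow> u * s \<in> N"
    "s \<in> N \<Longrightarrow> t \<in> N \<Longrightarrow> s - t \<in> N" "s \<in> N \<Longrightarrow> - s \<in> N" "0 \<in> N"
    "r \<in> I \<Longrightarrow> r * u \<in> N"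
proof -
  show neg: "- s \<in> N" if "s \<in> N" for s
    using assms that unfolding left_ideal_def by (metis mult_minus1)
  show "s - t \<in> N" if "s \<in> N" "t \<in> N"
    using assms that neg unfolding left_ideal_def by (metis uminus_add_conv_diff add.commute)
  show "0 \<in> N" using assms trace unfolding left_ideal_def by (metis mult_zero_left subsetD)
qed (use assms I_right in \<open>auto simp: left_ideal_def\<close>)

lemma left_ideal_sum:
  assumes "left_ideal N" "\<And>i. i \<in> S \<Longrightarrow> f i \<in> N"
  shows "(\<Sum>i\<in>S. f i) \<in> N"
  using assms(2) by (induction S rule: infinite_finite_induct) (auto intro: left_idealD[OF assms(1)])

lemma left_ideal_sc_cancel:
  assumes "left_ideal N" "sc c * t \<in> N" "c \<noteq> 0" shows "t \<in> N"
  using left_idealD(3)[OF assms(1,2), of "sc (inverse c)"] sc_inverse[OF assms(3)] by simp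

lemmas I_closed = left_idealD[OF left_ideal_I]

lemma left_ideal_add_iff:
  assumes "left_ideal N" "s - t \<in> N" shows "s \<in> N \<longleftrightarrow> t \<in> N"
  using left_idealD(2)[OF assms(1,2), of t] left_idealD(4)[OF assms(1), of s "s - t"] assms(2) by auto

text \<open>If \<open>e v = 0\<close> for an \<open>sl\<^sub>2\<close> triple \<open>e, h, f\<close>, then \<open>e f\<^sup>n\<^sup>+\<^sup>1 v = (n + 1) f\<^sup>n (h - n) v\<close>, and \<open>(h - n) v\<close> is again
killed by \<open>e\<close>. Three such steps give \<open>e\<^sup>3 f\<^sup>3 v = 6 h (h - 1) (h - 2) v\<close>. The claims \<open>A1\<close>, \<open>A2\<close>,
\<open>A3\<close> in the proof are the steps \<open>n = 0, 1, 2\<close>. Multiples are written as sums because numerals do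
not commute with other factors under the simplifier.\<close>

lemma highest_vector_cubic:
  assumes N: "left_ideal N"
    and ef: "e * f - f * e - h \<in> I" and he: "h * e - e * h - (e + e) \<in> I"
    and hf: "h * f - f * h + (f + f) \<in> I"
    and e3: "e * (e * e) \<in> I" and ev: "e * v \<in> N"
  shows "h * ((h - 1) * ((h - 1 - 1) * v)) \<in> N"
proof -
  note N_closed = left_idealD[OF N]
  have A1: "e * (f * u) - h * u \<in> N" if u: "e * u \<in> N" for u
  proof -
    have "e * (f * u) - h * u = (e * f - f * e - h) * u + f * (e * u)"
      by (simp add: algebra_simps)
    then show ?thesis using N_closed(7)[OF ef] N_closed(3)[OF u] N_closed(2) by metis
  qed
  have A2: "e * (f * (f * u)) - (f * ((h - 1) * u) + f * ((h - 1) * u)) \<in> N" if u: "e * u \<in> N" for u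
  proof -
    have "e * (f * (f * u)) - (f * ((h - 1) * u) + f * ((h - 1) * u)) =
        (e * f - f * e - h) * (f * u) + f * (e * (f * u) - h * u) + (h * f - f * h + (f + f)) * u"
      by (simp add: algebra_simps)
    then show ?thesis using N_closed(7)[OF ef] N_closed(3)[OF A1[OF u]] N_closed(7)[OF hf] N_closed(2) by metis
  qed
  have A3: "e * (f * (f * (f * u))) - (f * (f * ((h - 1 - 1) * u)) + f * (f * ((h - 1 - 1) * u)) + f * (f * ((h - 1 - 1) * u))) \<in> N"
    if u: "e * u \<in> N" for u
  proof -
    have "e * (f * (f * (f * u))) - (f * (f * ((h - 1 - 1) * u)) + f * (f * ((h - 1 - 1) * u)) + f * (f * ((h - 1 - 1) * u))) =
        (e * f - f * e - h) * (f * (f * u)) + f * (e * (f * (f * u)) - (f * ((h - 1) * u) + f * ((h - 1) * u)))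
        + (h * f - f * h + (f + f)) * (f * u) + f * ((h * f - f * h + (f + f)) * u)"
      by (simp add: algebra_simps mult_2)
    then show ?thesis using N_closed(7)[OF ef] N_closed(3)[OF A2[OF u]] N_closed(7)[OF hf] N_closed(3)[OF N_closed(7)[OF hf]] N_closed(2) by metis
  qed
  have H: "e * (h * u) \<in> N" if u: "e * u \<in> N" for u
  proof -
    have "e * (h * u) = h * (e * u) - (e * u + e * u) - (h * e - e * h - (e + e)) * u"
      by (simp add: algebra_simps)
    then show ?thesis using N_closed(3)[OF u] N_closed(2)[OF u u] N_closed(7)[OF he] N_closed(4) by metis
  qed
  define u1 where "u1 = (h - 1 - 1) * v"
  define u2 where "u2 = (h - 1) * u1"
  have u1: "e * u1 \<in> N" using N_closed(4)[OF N_closed(4)[OF H[OF ev] ev] ev]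
    by (simp only: u1_def left_diff_distrib right_diff_distrib mult_1_left)
  have u2: "e * u2 \<in> N" using N_closed(4)[OF H[OF u1] u1]
    by (simp add: u2_def algebra_simps)
  have B: "e * (e * (e * (f * (f * (f * v))))) \<in> N"
    using N_closed(7)[OF e3, of "f * (f * (f * v))"] by (simp add: mult.assoc)
  define w where "w = e * (f * (f * (f * v))) - (f * (f * u1) + f * (f * u1) + f * (f * u1))"
  have w: "w \<in> N" using A3[OF ev] by (simp add: w_def u1_def)
  define w' where "w' = e * (f * (f * u1)) - (f * u2 + f * u2)"
  have w': "w' \<in> N" using A2[OF u1] by (simp add: w'_def u2_def)
  define w'' where "w'' = e * (f * u2) - h * u2"
  have w'': "w'' \<in> N" using A1[OF u2] by (simp add: w''_def)
  have "sc 6 * (h * u2) = e * (e * (e * (f * (f * (f * v))))) - e * (e * w)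
      - (e * w' + e * w' + e * w') - (w'' + w'' + w'' + w'' + w'' + w'')"
  proof -
    have six: "(6::'t) = 1 + 1 + 1 + 1 + 1 + 1" by simp
    show ?thesis unfolding sc_numeral w_def w'_def w''_def six
      by (simp only: algebra_simps mult_1_left)
  qed
  also have "\<dots> \<in> N"
    by (intro N_closed(4) N_closed(2) B N_closed(3) w w' w'')
  finally have "h * u2 \<in> N" by (rule left_ideal_sc_cancel[OF N]) simp
  then show ?thesis by (simp add: u1_def u2_def)
qed

lemma comm_apply:
  assumes "left_ideal N" "a \<in> {1..k}" "b \<in> {1..k}" "i \<in> {1..k}" "j \<in> {1..k}"
  shows "x a b * (x i j * v) - x i j * (x a b * v) - ((if b = i then x a j else 0) - (if a = j then x i b else 0)) * v \<in> N"
  using left_idealD(7)[OF assms(1) comm[OF assms(2-5)], of v] by (simp add: left_diff_distrib mult.assoc)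

lemma comm_closed:
  assumes N: "left_ideal N" and ij: "a \<in> {1..k}" "b \<in> {1..k}" "i \<in> {1..k}" "j \<in> {1..k}"
    and "x i j * (x a b * v) \<in> N" "b = i \<Longrightarrow> x a j * v \<in> N" "a = j \<Longrightarrow> x i b * v \<in> N"
  shows "x a b * (x i j * v) \<in> N"
proof -
  define c where "c = (if b = i then x a j * v else 0) - (if a = j then x i b * v else 0)"
  have c: "c \<in> N" using assms(7,8) left_idealD[OF N] by (auto simp: c_def)
  have "x a b * (x i j * v) - x i j * (x a b * v) - c \<in> N"
    using comm_apply[OF N ij, of v] by (simp add: c_def left_diff_distrib if_distrib[of "\<lambda>t. t * v"] cong: if_cong)
  then have "(x a b * (x i j * v) - x i j * (x a b * v) - c) + c + x i j * (x a b * v) \<in> N"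
    using c assms(6) by (intro left_idealD(2)[OF N])
  then show ?thesis by simp
qed

section \<open>Highest weight vectors\<close>

definition raising_null :: "'t set \<Rightarrow> 't \<Rightarrow> bool" where
  "raising_null N v \<longleftrightarrow> (\<forall>a b. 1 \<le> a \<longrightarrow> a < b \<longrightarrow> b \<le> k \<longrightarrow> x a b * v \<in> N)"

lemma raising_nullD: "raising_null N v \<Longrightarrow> 1 \<le> a \<Longrightarrow> a < b \<Longrightarrow> b \<le> k \<Longrightarrow> x a b * v \<in> N"
  by (simp add: raising_null_def)

lemma raising_null_diagonal:
  assumes N: "left_ideal N" and v: "raising_null N v" and i: "i \<in> {1..k}"
  shows "raising_null N (x i i * v)"
  unfolding raising_null_def
proof (intro allI impI)
  fix a b assume ab: "1 \<le> a" "a < b" "b \<le> k"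
  then have xv: "x a b * v \<in> N" using v by (rule_tac raising_nullD)
  show "x a b * (x i i * v) \<in> N"
    using ab i xv left_idealD(3)[OF N xv] by - (rule comm_closed[OF N], auto)
qed

lemma raising_null_linear:
  assumes N: "left_ideal N" and "raising_null N v" "raising_null N w"
  shows "raising_null N (v - w)" "raising_null N (sc c * v)"
  using assms(2,3) by (auto simp: raising_null_def right_diff_distrib sc_left[of "x _ _"] intro: left_idealD[OF N])

definition diag_diff :: "nat \<Rightarrow> nat \<Rightarrow> 't" where
  "diag_diff i j = x i i - x j j"

text \<open>The value at \<open>y\<close> of the monic polynomial with the list of roots \<open>cs\<close>.\<close>

definition shifted_prod :: "'t \<Rightarrow> 'a list \<Rightarrow> 't" where
  "shifted_prod y cs = prod_list (map (\<lambda>c. y - sc c) cs)"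

lemma shifted_prod_simps [simp]:
  "shifted_prod y [] = 1" "shifted_prod y (c # cs) = (y - sc c) * shifted_prod y cs"
  by (simp_all add: shifted_prod_def)

lemma shifted_prod_append: "shifted_prod y (cs @ ds) = shifted_prod y cs * shifted_prod y ds"
  by (simp add: shifted_prod_def)

lemma shifted_prod_commute: "shifted_prod y cs * shifted_prod y ds = shifted_prod y ds * shifted_prod y cs"
proof -
  have one: "(y - sc c) * shifted_prod y ds = shifted_prod y ds * (y - sc c)" for c ds
  proof (induction ds)
    case (Cons d ds)
    have "(y - sc c) * (y - sc d) = (y - sc d) * (y - sc c)"
      using sc_comm[of y] sc_comm[of "sc c" d] by (simp add: algebra_simps)
    then have "(y - sc c) * ((y - sc d) * shifted_prod y ds) = (y - sc d) * ((y - sc c) * shifted_prod y ds)"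
      by (simp only: mult.assoc[symmetric])
    then show ?case by (simp only: Cons.IH shifted_prod_simps mult.assoc)
  qed simp
  show ?thesis
  proof (induction cs)
    case (Cons c cs)
    show ?case by (simp only: shifted_prod_simps mult.assoc Cons.IH) (simp only: mult.assoc[symmetric] one[of c ds])
  qed simp
qed

lemma shifted_prod_eigen:
  assumes N: "left_ideal N" and v: "(y - sc c) * v \<in> N"
  shows "shifted_prod y cs * v - sc (prod_list (map (\<lambda>d. c - d) cs)) * v \<in> N"
proof (induction cs)
  case Nil
  then show ?case by (simp add: sc_1 left_idealD[OF N])
next
  case (Cons d cs)
  let ?p = "prod_list (map (\<lambda>d. c - d) cs)"
  have "sc d * (sc ?p * v) = sc ?p * (sc d * v)" "y * (sc ?p * v) = sc ?p * (y * v)"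
    "sc c * (sc ?p * v) = sc ?p * (sc c * v)"
    by (rule sc_left)+
  then have "shifted_prod y (d # cs) * v - sc (prod_list (map (\<lambda>d. c - d) (d # cs))) * v =
      (y - sc d) * (shifted_prod y cs * v - sc ?p * v) + sc ?p * ((y - sc c) * v)"
    by (simp add: algebra_simps sc_diff sc_mult)
  then show ?case
    using left_idealD(2)[OF N left_idealD(3)[OF N Cons.IH] left_idealD(3)[OF N v], of "y - sc d" "sc ?p"] by (simp only:)
qed

text \<open>An eigenvector is killed by a polynomial in \<open>y\<close> only if its eigenvalue is a root. This separates
eigenvalues throughout, also for operators that are not known to be diagonalizable.\<close>

lemma shifted_prod_eigen_cancel:
  assumes N: "left_ideal N" and v: "(y - sc c) * v \<in> N" and "shifted_prod y cs * v \<in> N" and c: "c \<notin> set cs"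
  shows "v \<in> N"
proof -
  have "sc (prod_list (map (\<lambda>d. c - d) cs)) * v \<in> N"
    using left_ideal_add_iff[OF N shifted_prod_eigen[OF N v]] assms(3) by metis
  moreover have "prod_list (map (\<lambda>d. c - d) cs) \<noteq> 0" using c by (auto simp: prod_list_zero_iff)
  ultimately show ?thesis by (rule left_ideal_sc_cancel[OF N])
qed

definition weight_vector :: "'t set \<Rightarrow> (nat \<Rightarrow> 'a) \<Rightarrow> 't \<Rightarrow> bool" where
  "weight_vector N m v \<longleftrightarrow> (\<forall>i\<in>{1..k}. (x i i - sc (m i)) * v \<in> N)"

text \<open>Since \<open>\<Sum> x\<^sub>i\<^sub>i\<close> vanishes, the \<open>x\<^sub>i\<^sub>i\<close> are combinations of the differences \<open>x\<^sub>i\<^sub>i - x\<^sub>k\<^sub>k\<close>.\<close>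

lemma weight_vectorI:
  assumes N: "left_ideal N"
    and v: "\<And>i. i \<in> {1..k} \<Longrightarrow> (diag_diff i k - sc (m i - m k)) * v \<in> N" and m: "(\<Sum>i=1..k. m i) = 0"
  shows "weight_vector N m v"
proof -
  have "(\<Sum>i=1..k. diag_diff i k - sc (m i - m k)) =
      (\<Sum>i=1..k. x i i) - sc (of_nat k) * x k k - sc (\<Sum>i=1..k. m i) + sc (of_nat k) * sc (m k)"
  proof -
    have const: "(\<Sum>i=1..k. c) = sc (of_nat k) * c" for c by (simp add: sc_of_nat)
    show ?thesis
      by (simp only: diag_diff_def sc_diff sum_subtractf const sc_sum) (simp add: algebra_simps)
  qed
  note D = this
  have "sc (of_nat k) * ((x k k - sc (m k)) * v) =
      (\<Sum>i=1..k. x i i) * v - (\<Sum>i=1..k. (diag_diff i k - sc (m i - m k)) * v)"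
    unfolding sum_distrib_right[symmetric] D m sc_0 by (simp add: algebra_simps)
  also have "\<dots> \<in> N"
    by (rule left_idealD(4)[OF N left_idealD(7)[OF N trace] left_ideal_sum[OF N v]])
  finally have k_th: "(x k k - sc (m k)) * v \<in> N"
    by (rule left_ideal_sc_cancel[OF N]) (use k in simp)
  show ?thesis unfolding weight_vector_def
  proof
    fix i assume "i \<in> {1..k}"
    have "(x i i - sc (m i)) * v = (diag_diff i k - sc (m i - m k)) * v + (x k k - sc (m k)) * v"
      by (simp add: diag_diff_def sc_diff algebra_simps)
    then show "(x i i - sc (m i)) * v \<in> N"
      using left_idealD(2)[OF N v[OF \<open>i \<in> {1..k}\<close>] k_th] by simp
  qed
qed

lemma weight_vector_diag_diff:
  assumes N: "left_ideal N" and "weight_vector N m v" "i \<in> {1..k}" "j \<in> {1..k}"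
  shows "(diag_diff i j - sc (m i - m j)) * v \<in> N"
proof -
  have "(diag_diff i j - sc (m i - m j)) * v = (x i i - sc (m i)) * v - (x j j - sc (m j)) * v"
    by (simp add: diag_diff_def sc_diff algebra_simps)
  then show ?thesis using assms(2-4) left_idealD(4)[OF N] by (simp add: weight_vector_def)
qed

definition casimir2 :: 't where
  "casimir2 = (\<Sum>i=1..k. \<Sum>j=1..k. x i j * x j i)"

text \<open>For \<open>i < j\<close> the product \<open>x\<^sub>i\<^sub>j x\<^sub>j\<^sub>i\<close> acts as the commutator \<open>x\<^sub>i\<^sub>i - x\<^sub>j\<^sub>j\<close>, and for \<open>i > j\<close> it acts by 0.\<close>

lemma casimir2_highest_vector:
  assumes N: "left_ideal N" and v: "raising_null N v" and m: "weight_vector N m v"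
  shows "casimir2 * v - sc (casimir_value k m) * v \<in> N"
proof -
  note N_closed = left_idealD[OF N]
  let ?c = "\<lambda>i j. if i < j then m i - m j else if i = j then m i * m i else 0"
  have summand: "x i j * (x j i * v) - sc (?c i j) * v \<in> N" if ij: "i \<in> {1..k}" "j \<in> {1..k}" for i j
  proof (cases i j rule: linorder_cases)
    case less
    have "x i j * (x j i * v) - sc (?c i j) * v =
        (x i j * (x j i * v) - x j i * (x i j * v) - (x i i - x j j) * v) + x j i * (x i j * v)
        + (diag_diff i j - sc (m i - m j)) * v"
      using less by (simp add: diag_diff_def algebra_simps)
    also have "\<dots> \<in> N"
    proof (intro N_closed(2))
      show "x i j * (x j i * v) - x j i * (x i j * v) - (x i i - x j j) * v \<in> N"
        using comm_apply[OF N ij(1,2,2,1), of v] by simp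
      show "x j i * (x i j * v) \<in> N"
        using less ij raising_nullD[OF v, of i j] N_closed(3)[of "x i j * v"] by simp
      show "(diag_diff i j - sc (m i - m j)) * v \<in> N"
        by (rule weight_vector_diag_diff[OF N m ij])
    qed
    finally show ?thesis .
  next
    case equal
    have "x i j * (x j i * v) - sc (?c i j) * v = x i i * ((x i i - sc (m i)) * v) + sc (m i) * ((x i i - sc (m i)) * v)"
      using equal by (simp add: algebra_simps sc_mult sc_left[of "x _ _"])
    also have "\<dots> \<in> N"
    proof -
      have "(x i i - sc (m i)) * v \<in> N" using m ij(1) by (simp add: weight_vector_def)
      then show ?thesis by (intro N_closed(2) N_closed(3)[of "(x i i - sc (m i)) * v"])
    qed
    finally show ?thesis .
  next
    case greater
    then show ?thesis using raising_nullD[OF v, of j i] ij N_closed(3) by (simp add: sc_0)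
  qed
  have "casimir2 * v - sc (casimir_value k m) * v =
      (\<Sum>i=1..k. \<Sum>j=1..k. x i j * (x j i * v) - sc (?c i j) * v)"
    by (simp add: casimir2_def casimir_value_def sc_sum sum_distrib_right sum_subtractf mult.assoc cong: if_cong)
  also have "\<dots> \<in> N" by (intro left_ideal_sum[OF N] summand)
  finally show ?thesis .
qed

text \<open>Apply the derivation \<open>[y, _]\<close> three times to \<open>a\<^sup>3\<close>: as it maps \<open>a\<close> to \<open>b\<close> and \<open>b\<close> to 0, the result is
\<open>6 b\<^sup>3\<close>. Here \<open>s1\<close> is the first derivative and \<open>s2\<close> half of the second, up to terms in \<open>I\<close>.\<close>

lemma derivation_cube:
  assumes a: "y * a - a * y - b \<in> I" and b: "y * b - b * y \<in> I" and cube: "a * (a * a) \<in> I"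
  shows "b * (b * b) \<in> I"
proof -
  define \<delta> where "\<delta> = y * a - a * y - b"
  define \<epsilon> where "\<epsilon> = y * b - b * y"
  have \<delta>: "\<delta> \<in> I" "\<delta> * t \<in> I" "t * \<delta> \<in> I" "t * (\<delta> * s) \<in> I" "t * (s * \<delta>) \<in> I" for s t
    using a by (auto simp: \<delta>_def intro: I_left I_right)
  have \<epsilon>: "\<epsilon> \<in> I" "\<epsilon> * t \<in> I" "t * \<epsilon> \<in> I" "t * (\<epsilon> * s) \<in> I" "t * (s * \<epsilon>) \<in> I" for s t
    using b by (auto simp: \<epsilon>_def intro: I_left I_right)
  define s1 where "s1 = b * (a * a) + a * (b * a) + a * (a * b)"
  define s2 where "s2 = b * (b * a) + b * (a * b) + a * (b * b)"
  have "s1 = y * (a * (a * a)) - (a * (a * a)) * y - (\<delta> * (a * a) + a * (\<delta> * a) + a * (a * \<delta>))"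
    unfolding s1_def \<delta>_def by (simp add: algebra_simps)
  also have "\<dots> \<in> I"
    by (rule I_closed(4)[OF I_closed(4)[OF I_left[OF cube] I_right[OF cube]]]) (intro I_closed(2) \<delta>)
  finally have s1: "s1 \<in> I" .
  have two: "(2::'t) = 1 + 1" by simp
  have "sc 2 * s2 = y * s1 - s1 * y - (\<epsilon> * (a * a) + b * (\<delta> * a) + b * (a * \<delta>) + \<delta> * (b * a) + a * (\<epsilon> * a) + a * (b * \<delta>)
      + \<delta> * (a * b) + a * (\<delta> * b) + a * (a * \<epsilon>))"
    unfolding s1_def s2_def \<delta>_def \<epsilon>_def sc_numeral two by (simp only: algebra_simps mult_1_left)
  also have "\<dots> \<in> I"
    by (rule I_closed(4)[OF I_closed(4)[OF I_left[OF s1] I_right[OF s1]]]) (intro I_closed(2) \<delta> \<epsilon>)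
  finally have s2: "s2 \<in> I" by (rule left_ideal_sc_cancel[OF left_ideal_I]) simp
  have three: "(3::'t) = 1 + 1 + 1" by simp
  have "sc 3 * (b * (b * b)) = y * s2 - s2 * y - (\<epsilon> * (b * a) + b * (\<epsilon> * a) + b * (b * \<delta>) + \<epsilon> * (a * b) + b * (\<delta> * b)
      + b * (a * \<epsilon>) + \<delta> * (b * b) + a * (\<epsilon> * b) + a * (b * \<epsilon>))"
    unfolding s2_def \<delta>_def \<epsilon>_def sc_numeral three by (simp only: algebra_simps mult_1_left)
  also have "\<dots> \<in> I"
    by (rule I_closed(4)[OF I_closed(4)[OF I_left[OF s2] I_right[OF s2]]]) (intro I_closed(2) \<delta> \<epsilon>)
  finally show ?thesis by (rule left_ideal_sc_cancel[OF left_ideal_I]) simp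
qed

end

section \<open>Highest weight vectors modulo the cube and the Casimir relation\<close>

text \<open>The two relations force the adjoint representation: the cube bounds the weights, and \<open>2 k\<close> is the
eigenvalue of the quadratic Casimir element on the adjoint representation.\<close>

locale adjoint_relations = gl_relations k sc x I
  for k :: nat and sc :: "'a::field_char_0 \<Rightarrow> 't::ring_1" and x :: "nat \<Rightarrow> nat \<Rightarrow> 't" and I :: "'t set" +
  assumes cube12: "x 1 2 * (x 1 2 * x 1 2) \<in> I"
    and casimir2: "casimir2 - sc (2 * of_nat k) \<in> I"
begin

lemma cube:
  assumes "1 \<le> i" "i < j" "j \<le> k"
  shows "x i j * (x i j * x i j) \<in> I"
proof -
  have row1: "x 1 j * (x 1 j * x 1 j) \<in> I" if j: "2 \<le> j" "j \<le> k" for j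
  proof (cases "j = 2")
    case False
    have "x 2 j * x 1 2 - x 1 2 * x 2 j - (- x 1 j) \<in> I" "x 2 j * x 1 j - x 1 j * x 2 j \<in> I"
      using comm[of 2 j 1 2] comm[of 2 j 1 j] j False k by auto
    then have "x 2 j * x 1 2 - x 1 2 * x 2 j - (- x 1 j) \<in> I" "x 2 j * (- x 1 j) - (- x 1 j) * x 2 j \<in> I"
      using I_closed(5)[of "x 2 j * x 1 j - x 1 j * x 2 j"] by simp_all
    then have "(- x 1 j) * ((- x 1 j) * (- x 1 j)) \<in> I"
      by (rule derivation_cube[OF _ _ cube12])
    then show ?thesis using I_closed(5)[of "- (x 1 j * (x 1 j * x 1 j))"] by simp
  qed (use cube12 in simp)
  show ?thesis
  proof (cases "i = 1")
    case False
    have "x i 1 * x 1 j - x 1 j * x i 1 - x i j \<in> I" "x i 1 * x i j - x i j * x i 1 \<in> I"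
      using comm[of i 1 1 j] comm[of i 1 i j] assms False by auto
    then show ?thesis using assms False by (intro derivation_cube[OF _ _ row1]) auto
  qed (use row1 assms in auto)
qed

text \<open>Treat the raising operators \<open>x\<^sub>a\<^sub>b\<close> in lexicographic order of \<open>(a, b)\<close>, which is the order of
\<open>a (k + 1) + b\<close>. The last nonzero one of \<open>v\<close>, \<open>x\<^sub>a\<^sub>b v\<close>, \<open>x\<^sub>a\<^sub>b\<^sup>2 v\<close> is killed by \<open>x\<^sub>a\<^sub>b\<close>, and it is still
killed by the earlier operators: the commutator of \<open>x\<^sub>a\<^sub>b\<close> with an earlier \<open>x\<^sub>l\<^sub>m\<close> is 0 or the
operator \<open>x\<^sub>l\<^sub>b\<close>, which is also earlier.\<close>

lemma exists_raising_null:
  assumes N: "left_ideal N" and v: "v \<notin> N"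
  shows "\<exists>u. u * v \<notin> N \<and> raising_null N (u * v)"
proof -
  define null where "null n w \<longleftrightarrow> (\<forall>a b. 1 \<le> a \<longrightarrow> a < b \<longrightarrow> b \<le> k \<longrightarrow> a * (k + 1) + b < n \<longrightarrow> x a b * w \<in> N)" for n w
  have "\<exists>u. u * v \<notin> N \<and> null n (u * v)" for n
  proof (induction n)
    case 0
    then show ?case using v by (intro exI[of _ 1]) (auto simp: null_def)
  next
    case (Suc n)
    then obtain u where u: "u * v \<notin> N" "null n (u * v)" by auto
    show ?case
    proof (cases "\<exists>a b. 1 \<le> a \<and> a < b \<and> b \<le> k \<and> a * (k + 1) + b = n")
      case True
      then obtain a b where ab: "1 \<le> a" "a < b" "b \<le> k" "a * (k + 1) + b = n" by auto
      have step: "null n (x a b * w)" if w: "null n w" for w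
        unfolding null_def
      proof (intro allI impI)
        fix l m assume lm: "1 \<le> l" "l < m" "m \<le> k" "l * (k + 1) + m < n"
        have xw: "x l m * w \<in> N" by (rule w[unfolded null_def, rule_format, OF lm])
        have "x l b * w \<in> N" if "m = a"
        proof -
          have "Suc l * (k + 1) \<le> a * (k + 1)" using lm(2) that by (intro mult_right_mono) auto
          then have "l * (k + 1) + b < n" using ab(3,4) by simp
          moreover have "l < b" using lm(2) that ab(2) by simp
          ultimately show ?thesis by (intro w[unfolded null_def, rule_format, OF lm(1) _ ab(3)])
        qed
        moreover have False if "l = b"
        proof -
          have "Suc a * (k + 1) \<le> l * (k + 1)" using ab(2) that by (intro mult_right_mono) auto
          then show False using ab lm(4) by simp
        qed
        ultimately show "x l m * (x a b * w) \<in> N"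
          using lm ab left_idealD(3)[OF N xw] by - (rule comm_closed[OF N], auto)
      qed
      have extend: "null (Suc n) w" if w: "null n w" "x a b * w \<in> N" for w
        unfolding null_def
      proof (intro allI impI)
        fix l m assume lm: "1 \<le> l" "l < m" "m \<le> k" "l * (k + 1) + m < Suc n"
        show "x l m * w \<in> N"
        proof (cases "l * (k + 1) + m = n")
          case True
          then have eq: "l * (k + 1) + m = a * (k + 1) + b" using ab by simp
          have "l = a"
          proof -
            have quot: "(a * (k + 1) + b) div (k + 1) = a" if "b \<le> k" for a b
            proof -
              have "(b + a * (k + 1)) div (k + 1) = a + b div (k + 1)" by (rule div_mult_self1) simp
              then show ?thesis using that by (simp only: add.commute) simp
            qed
            show ?thesis using quot[of b a] quot[of m l] eq lm ab by metis
          qed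
          then show ?thesis using eq w(2) by simp
        qed (use lm w(1) in \<open>auto simp: null_def\<close>)
      qed
      have c: "x a b * (x a b * (x a b * (u * v))) \<in> N"
        using left_idealD(7)[OF N cube[OF ab(1-3)], of "u * v"] by (simp add: mult.assoc)
      consider "x a b * (u * v) \<in> N" | "x a b * (u * v) \<notin> N" "x a b * (x a b * (u * v)) \<in> N"
        | "x a b * (x a b * (u * v)) \<notin> N" by blast
      then show ?thesis
      proof cases
        case 1
        then show ?thesis using u extend by blast
      next
        case 2
        then show ?thesis using extend[OF step[OF u(2)]]
          by (intro exI[of _ "x a b * u"]) (simp add: mult.assoc)
      next
        case 3
        then show ?thesis using extend[OF step[OF step[OF u(2)]]] c
          by (intro exI[of _ "x a b * (x a b * u)"]) (simp add: mult.assoc)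
      qed
    next
      case False
      have "null (Suc n) (u * v)"
        unfolding null_def
      proof (intro allI impI)
        fix a b assume ab: "1 \<le> a" "a < b" "b \<le> k" "a * (k + 1) + b < Suc n"
        moreover have "a * (k + 1) + b \<noteq> n" using False ab by blast
        ultimately have "a * (k + 1) + b < n" by linarith
        then show "x a b * (u * v) \<in> N" by (rule u(2)[unfolded null_def, rule_format, OF ab(1-3)])
      qed
      then show ?thesis using u by auto
    qed
  qed
  from this[of "(k + 1) * (k + 1)"] obtain u where u: "u * v \<notin> N" "null ((k + 1) * (k + 1)) (u * v)" by auto
  have "raising_null N (u * v)"
    unfolding raising_null_def
  proof (intro allI impI)
    fix a b assume ab: "1 \<le> a" "a < b" "b \<le> k"
    then have "a * (k + 1) \<le> k * (k + 1)" by (intro mult_right_mono) auto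
    moreover have "(k + 1) * (k + 1) = k * (k + 1) + (k + 1)" by (rule add_mult_distrib[of k 1, unfolded mult_1_left])
    ultimately have "a * (k + 1) + b < (k + 1) * (k + 1)" using ab(3) by linarith
    then show "x a b * (u * v) \<in> N" by (rule u(2)[unfolded null_def, rule_format, OF ab])
  qed
  then show ?thesis using u(1) by blast
qed

lemma raising_null_cubic:
  assumes N: "left_ideal N" and v: "raising_null N v" and ij: "1 \<le> i" "i < j" "j \<le> k"
  shows "shifted_prod (diag_diff i j) [0, 1, 2] * v \<in> N"
proof -
  let ?h = "diag_diff i j"
  have ef: "x i j * x j i - x j i * x i j - ?h \<in> I"
    using comm[of i j j i] ij by (simp add: diag_diff_def)
  have "x i i * x i j - x i j * x i i - x i j \<in> I" "x j j * x i j - x i j * x j j - (- x i j) \<in> I"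
    using comm[of i i i j] comm[of j j i j] ij by auto
  then have "(x i i * x i j - x i j * x i i - x i j) - (x j j * x i j - x i j * x j j - (- x i j)) \<in> I"
    by (rule I_closed(4))
  then have he: "?h * x i j - x i j * ?h - (x i j + x i j) \<in> I"
    by (simp add: diag_diff_def algebra_simps)
  have "x i i * x j i - x j i * x i i - (- x j i) \<in> I" "x j j * x j i - x j i * x j j - x j i \<in> I"
    using comm[of i i j i] comm[of j j j i] ij by auto
  then have "(x i i * x j i - x j i * x i i - (- x j i)) - (x j j * x j i - x j i * x j j - x j i) \<in> I"
    by (rule I_closed(4))
  then have hf: "?h * x j i - x j i * ?h + (x j i + x j i) \<in> I"
    by (simp add: diag_diff_def algebra_simps)
  have "shifted_prod ?h [0, 1, 2] * v = ?h * ((?h - 1) * ((?h - 1 - 1) * v))"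
    by (simp add: sc_0 sc_1 sc_numeral mult.assoc diff_diff_add)
  then show ?thesis
    using highest_vector_cubic[OF N ef he hf cube[OF ij] raising_nullD[OF v ij]] by metis
qed

lemma diag_diff_commute: "i \<in> {1..k} \<Longrightarrow> j \<in> {1..k} \<Longrightarrow> a \<in> {1..k} \<Longrightarrow> b \<in> {1..k} \<Longrightarrow>
  diag_diff i j * diag_diff a b - diag_diff a b * diag_diff i j \<in> I"
proof -
  assume ij: "i \<in> {1..k}" "j \<in> {1..k}" "a \<in> {1..k}" "b \<in> {1..k}"
  have c: "x i i * x j j - x j j * x i i \<in> I" if "i \<in> {1..k}" "j \<in> {1..k}" for i j
    using comm[OF that(1,1,2,2)] by (cases "i = j") auto
  have "(x i i * x a a - x a a * x i i) - (x i i * x b b - x b b * x i i) - (x j j * x a a - x a a * x j j)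
      + (x j j * x b b - x b b * x j j) \<in> I"
    by (rule I_closed(2)[OF I_closed(4)[OF I_closed(4)[OF c c] c] c]) (use ij in simp_all)
  then show ?thesis by (simp add: diag_diff_def algebra_simps)
qed

text \<open>The elements \<open>x\<^sub>i\<^sub>i - x\<^sub>k\<^sub>k\<close> commute and preserve the vectors killed by the raising operators, and on
these each satisfies \<open>h (h - 1) (h - 2) = 0\<close>. So they can be diagonalized one after the other,
each time taking the last nonzero one of \<open>v\<close>, \<open>(h - 2) v\<close>, \<open>(h - 1) (h - 2) v\<close>.\<close>

lemma exists_weight_vector:
  assumes N: "left_ideal N" and v: "v \<notin> N" "raising_null N v"
  shows "\<exists>u d. u * v \<notin> N \<and> raising_null N (u * v) \<and>
    (\<forall>i\<in>{1..k}. d i \<le> (2::nat) \<and> (diag_diff i k - sc (of_nat (d i))) * (u * v) \<in> N) \<and> d k = 0"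
proof -
  have "n < k \<Longrightarrow> \<exists>u d. u * v \<notin> N \<and> raising_null N (u * v) \<and>
    (\<forall>i\<in>{1..n}. d i \<le> (2::nat) \<and> (diag_diff i k - sc (of_nat (d i))) * (u * v) \<in> N)" for n
  proof (induction n)
    case 0
    then show ?case using v by (intro exI[of _ 1]) auto
  next
    case (Suc n)
    then obtain u d where u: "u * v \<notin> N" "raising_null N (u * v)"
      and d: "\<forall>i\<in>{1..n}. d i \<le> (2::nat) \<and> (diag_diff i k - sc (of_nat (d i))) * (u * v) \<in> N"
      using Suc_lessD by blast
    define h where "h = diag_diff (Suc n) k"
    define good where "good w \<longleftrightarrow> raising_null N w \<and> (\<forall>i\<in>{1..n}. (diag_diff i k - sc (of_nat (d i))) * w \<in> N)" for w
    have good: "good (u * v)" using u d by (auto simp: good_def)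
    have step: "good ((h - sc c) * w)" if w: "good w" for c w
      unfolding good_def
    proof (intro conjI ballI)
      have "raising_null N (x (Suc n) (Suc n) * w)" "raising_null N (x k k * w)"
        using w k Suc.prems by (auto simp: good_def intro!: raising_null_diagonal[OF N])
      then show "raising_null N ((h - sc c) * w)"
        using w unfolding h_def diag_diff_def left_diff_distrib good_def by (intro raising_null_linear[OF N]) auto
      fix i assume i: "i \<in> {1..n}"
      have "(diag_diff i k - sc (of_nat (d i))) * ((h - sc c) * w) =
          (h - sc c) * ((diag_diff i k - sc (of_nat (d i))) * w) + (diag_diff i k * h - h * diag_diff i k) * w"
        using sc_left[of "diag_diff i k" c w] sc_left[of h "of_nat (d i)" w] sc_left[of "sc (of_nat (d i))" c w]
        by (simp add: algebra_simps)
      also have "\<dots> \<in> N"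
      proof (rule left_idealD(2)[OF N])
        show "(h - sc c) * ((diag_diff i k - sc (of_nat (d i))) * w) \<in> N"
          using w i by (auto simp: good_def intro: left_idealD(3)[OF N, of "_ * w"])
        show "(diag_diff i k * h - h * diag_diff i k) * w \<in> N"
          unfolding h_def using i Suc.prems by (intro left_idealD(7)[OF N] diag_diff_commute) auto
      qed
      finally show "(diag_diff i k - sc (of_nat (d i))) * ((h - sc c) * w) \<in> N" .
    qed
    have ex: "\<exists>w c. w \<notin> N \<and> good w \<and> c \<le> 2 \<and> (h - sc (of_nat c)) * w \<in> N \<and> (\<exists>u. w = u * v)"
    proof -
      define w1 where "w1 = (h - sc (of_nat 2)) * (u * v)"
      define w2 where "w2 = (h - sc (of_nat 1)) * w1"
      have g: "good w1" "good w2" using good step by (auto simp: w1_def w2_def)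
      have "shifted_prod h [0, 1, 2] * (u * v) \<in> N"
        unfolding h_def using Suc.prems by (intro raising_null_cubic[OF N u(2)]) auto
      then have w3: "(h - sc (of_nat 0)) * w2 \<in> N" by (simp add: w1_def w2_def mult.assoc)
      have mem: "\<exists>u. w1 = u * v" "\<exists>u. w2 = u * v" unfolding w1_def w2_def by (metis mult.assoc)+
      consider "w1 \<in> N" | "w1 \<notin> N" "w2 \<in> N" | "w2 \<notin> N" by blast
      then show ?thesis
      proof cases
        case 1
        then show ?thesis using u good by (intro exI[of _ "u * v"] exI[of _ 2]) (auto simp: w1_def)
      next
        case 2
        then show ?thesis using g mem by (intro exI[of _ w1] exI[of _ 1]) (auto simp: w2_def)
      next
        case 3
        then show ?thesis using g mem w3 by (intro exI[of _ w2] exI[of _ 0]) auto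
      qed
    qed
    then obtain w c u' where w: "w \<notin> N" "good w" "c \<le> 2" "(h - sc (of_nat c)) * w \<in> N" "w = u' * v" by blast
    show ?case
      using w by (intro exI[of _ u'] exI[of _ "d(Suc n := c)"]) (auto simp: good_def h_def le_Suc_eq d)
  qed
  from this[of "k - 1"] obtain u d where u: "u * v \<notin> N" "raising_null N (u * v)"
    and d: "\<forall>i\<in>{1..k - 1}. d i \<le> (2::nat) \<and> (diag_diff i k - sc (of_nat (d i))) * (u * v) \<in> N"
    using k by auto
  have "(d(k := 0)) i \<le> 2 \<and> (diag_diff i k - sc (of_nat ((d(k := 0)) i))) * (u * v) \<in> N" if "i \<in> {1..k}" for i
    using d that left_idealD(6)[OF N] by (cases "i = k") (auto simp: diag_diff_def sc_0)
  then show ?thesis using u by (intro exI[of _ u] exI[of _ "d(k := 0)"]) auto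
qed

definition highest :: "'t set \<Rightarrow> 't \<Rightarrow> bool" where
  "highest N w \<longleftrightarrow> raising_null N w \<and> weight_vector N (adjoint_weight k) w"

text \<open>Applied to a vector of a left ideal, the element \<open>u\<close> keeps it there; so each nonzero quotient of left
ideals contains such a highest weight vector.\<close>

theorem exists_highest:
  assumes N: "left_ideal N" and v: "v \<notin> N"
  shows "\<exists>u. u * v \<notin> N \<and> highest N (u * v)"
proof -
  obtain u1 where u1: "u1 * v \<notin> N" "raising_null N (u1 * v)" using exists_raising_null[OF assms] by auto
  obtain u2 d where w: "u2 * (u1 * v) \<notin> N" "raising_null N (u2 * (u1 * v))"
    and d: "\<And>i. i \<in> {1..k} \<Longrightarrow> d i \<le> (2::nat)" "d k = 0"
    and dw: "\<And>i. i \<in> {1..k} \<Longrightarrow> (diag_diff i k - sc (of_nat (d i))) * (u2 * (u1 * v)) \<in> N"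
    using exists_weight_vector[OF N u1] by blast
  define w where "w = u2 * (u1 * v)"
  define s where "s = (\<Sum>i=1..k. d i)"
  define m :: "nat \<Rightarrow> 'a" where "m i = of_nat (d i) - of_nat s / of_nat k" for i
  have "(\<Sum>i=1..k. m i) = 0" using k by (simp add: m_def sum_subtractf s_def)
  then have mw: "weight_vector N m w"
    using dw d by (intro weight_vectorI[OF N]) (auto simp: m_def w_def)
  have anti: "d j \<le> d i" if ij: "1 \<le> i" "i \<le> j" "j \<le> k" for i j
  proof (cases "i = j")
    case False
    then have "shifted_prod (diag_diff i j) [0, 1, 2] * w \<in> N"
      using ij w by (intro raising_null_cubic[OF N]) (auto simp: w_def)
    moreover have "(diag_diff i j - sc (m i - m j)) * w \<in> N"
      using ij by (intro weight_vector_diag_diff[OF N mw]) auto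
    moreover have "w \<notin> N" using w by (simp add: w_def)
    ultimately have "m i - m j \<in> set [0, 1, 2]"
      using shifted_prod_eigen_cancel[OF N] by metis
    then have "of_nat (d i) = (of_nat (d j) :: 'a) \<or> of_nat (d i) = (of_nat (d j + 1) :: 'a) \<or> of_nat (d i) = (of_nat (d j + 2) :: 'a)"
      by (auto simp: m_def algebra_simps)
    then show ?thesis unfolding of_nat_eq_iff by auto
  qed simp
  have "raising_null N w" using w by (simp add: w_def)
  then have "(casimir2 - sc (2 * of_nat k)) * w - (casimir2 * w - sc (casimir_value k m) * w) \<in> N"
    by (intro left_idealD(4)[OF N left_idealD(7)[OF N casimir2] casimir2_highest_vector[OF N _ mw]])
  then have "sc (casimir_value k m - 2 * of_nat k) * w \<in> N"
    by (simp add: algebra_simps sc_diff)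
  then have val: "casimir_value k m = 2 * of_nat k"
    using left_ideal_sc_cancel[OF N, of "casimir_value k m - 2 * of_nat k" w] w(1) unfolding w_def by fastforce
  have "m i = adjoint_weight k i" if "i \<in> {1..k}" for i
    by (rule casimir_value_determines_adjoint_weight[where d = d and m = m, OF k d(1) anti d(2) _ \<open>(\<Sum>i=1..k. m i) = 0\<close> val that])
      (simp_all add: m_def d)
  then have "highest N w" using mw w by (auto simp: highest_def weight_vector_def w_def)
  then show ?thesis using w(1) unfolding w_def by (metis mult.assoc)
qed

end

context gl_relations
begin

section \<open>Triangular decomposition\<close>

text \<open>\<open>- \<Sum> a x\<^sub>a\<^sub>a\<close>, for which \<open>x\<^sub>a\<^sub>b\<close> has the degree \<open>b - a\<close>. Its eigenvalue on \<open>e\<^sub>1\<^sub>k\<close> is \<open>k - 1\<close>, larger than on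
every other matrix unit.\<close>

definition grading :: 't where
  "grading = (\<Sum>a=1..k. sc (- of_nat a) * x a a)"

lemma grading_comm:
  assumes ab: "a \<in> {1..k}" "b \<in> {1..k}"
  shows "grading * x a b - x a b * grading - sc (of_nat b - of_nat a) * x a b \<in> I"
proof -
  let ?C = "\<lambda>c. (if c = a then x c b else 0) - (if c = b then x a c else 0)"
  have "grading * x a b - x a b * grading - sc (of_nat b - of_nat a) * x a b =
      (\<Sum>c=1..k. sc (- of_nat c) * (x c c * x a b - x a b * x c c)) - (\<Sum>c=1..k. sc (- of_nat c) * ?C c)"
  proof -
    have "(\<Sum>c=1..k. sc (- of_nat c) * ?C c) =
        (\<Sum>c=1..k. if c = a then sc (- of_nat c) * x c b else 0) - (\<Sum>c=1..k. if c = b then sc (- of_nat c) * x a c else 0)"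
      unfolding sum_subtractf[symmetric] by (intro sum.cong refl) (simp add: right_diff_distrib)
    also have "\<dots> = sc (of_nat b - of_nat a) * x a b"
      using ab by (simp add: sc_diff sc_minus left_diff_distrib)
    finally show ?thesis
      by (simp add: grading_def sum_distrib_left sum_distrib_right sum_subtractf right_diff_distrib sc_left mult.assoc)
  qed
  also have "\<dots> = (\<Sum>c=1..k. sc (- of_nat c) * (x c c * x a b - x a b * x c c - ?C c))"
    by (simp add: sum_subtractf right_diff_distrib)
  also have "\<dots> \<in> I"
  proof (rule left_ideal_sum[OF left_ideal_I])
    fix c assume "c \<in> {1..k}"
    then have "x c c * x a b - x a b * x c c - ?C c \<in> I" using comm[of c c a b] ab by (simp add: eq_commute[of b c])
    then show "sc (- of_nat c) * (x c c * x a b - x a b * x c c - ?C c) \<in> I" by (rule I_left)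
  qed
  finally show ?thesis .
qed

lemma grading_apply:
  assumes N: "left_ideal N" and ab: "a \<in> {1..k}" "b \<in> {1..k}" and v: "(grading - sc c) * v \<in> N"
  shows "(grading - sc (c + (of_nat b - of_nat a))) * (x a b * v) \<in> N"
proof -
  have "(grading - sc (c + (of_nat b - of_nat a))) * (x a b * v) =
      x a b * ((grading - sc c) * v) + (grading * x a b - x a b * grading - sc (of_nat b - of_nat a) * x a b) * v"
    by (simp add: sc_add left_diff_distrib right_diff_distrib distrib_right mult.assoc sc_left[of "x a b"])
  then show ?thesis
    using left_idealD(2)[OF N left_idealD(3)[OF N v] left_idealD(7)[OF N grading_comm[OF ab]], of "x a b" v]
    by (simp only:)
qed

lemma shifted_prod_shift:
  assumes ab: "a \<in> {1..k}" "b \<in> {1..k}"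
  shows "shifted_prod grading (map (\<lambda>c. c + (of_nat b - of_nat a)) cs) * x a b - x a b * shifted_prod grading cs \<in> I"
proof (induction cs)
  case Nil
  then show ?case by (simp add: I_closed(6))
next
  case (Cons c cs)
  let ?S = "shifted_prod grading (map (\<lambda>c. c + (of_nat b - of_nat a)) cs)" and ?d = "of_nat b - of_nat a :: 'a"
  have "shifted_prod grading (map (\<lambda>c. c + ?d) (c # cs)) * x a b - x a b * shifted_prod grading (c # cs) =
      (grading - sc (c + ?d)) * (?S * x a b - x a b * shifted_prod grading cs)
      + (grading * x a b - x a b * grading - sc ?d * x a b) * shifted_prod grading cs"
    by (simp add: sc_add left_diff_distrib right_diff_distrib distrib_right mult.assoc sc_left[of "x a b"])
  then show ?case
    using I_closed(2)[OF I_left[OF Cons.IH] I_right[OF grading_comm[OF ab]], of "grading - sc (c + ?d)" "shifted_prod grading cs"]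
    by (simp only:)
qed

inductive_set lowering :: "'t set" where
  lowering_0: "0 \<in> lowering"
| lowering_gen: "a \<in> {1..k} \<Longrightarrow> b \<in> {1..k} \<Longrightarrow> b < a \<Longrightarrow> x a b \<in> lowering"
| lowering_mult: "a \<in> {1..k} \<Longrightarrow> b \<in> {1..k} \<Longrightarrow> b < a \<Longrightarrow> t \<in> lowering \<Longrightarrow> x a b * t \<in> lowering"
| lowering_add: "s \<in> lowering \<Longrightarrow> t \<in> lowering \<Longrightarrow> s + t \<in> lowering"
| lowering_sc: "t \<in> lowering \<Longrightarrow> sc c * t \<in> lowering"

text \<open>The left ideal that defines the Verma module of highest weight \<open>adjoint_weight k\<close>.\<close>

inductive_set verma :: "'t set" where
  verma_rel: "r \<in> I \<Longrightarrow> r \<in> verma"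
| verma_raise: "a \<in> {1..k} \<Longrightarrow> b \<in> {1..k} \<Longrightarrow> a < b \<Longrightarrow> t * x a b \<in> verma"
| verma_weight: "i \<in> {1..k} \<Longrightarrow> t * (x i i - sc (adjoint_weight k i)) \<in> verma"
| verma_add: "s \<in> verma \<Longrightarrow> t \<in> verma \<Longrightarrow> s + t \<in> verma"

lemma verma_left: "r \<in> verma \<Longrightarrow> t * r \<in> verma"
  by (induction rule: verma.induct)
    (auto intro: verma.intros I_left simp: distrib_left mult.assoc[symmetric])

text \<open>The filtration by the length of words, modulo \<open>I\<close>.\<close>

inductive word_degree :: "nat \<Rightarrow> 't \<Rightarrow> bool" where
  word_degree_rel: "r \<in> I \<Longrightarrow> word_degree n r"
| word_degree_sc: "word_degree n (sc c)"
| word_degree_mult: "word_degree n u \<Longrightarrow> a \<in> {1..k} \<Longrightarrow> b \<in> {1..k} \<Longrightarrow> word_degree (Suc n) (u * x a b)"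
| word_degree_add: "word_degree n u \<Longrightarrow> word_degree n v \<Longrightarrow> word_degree n (u + v)"

lemma word_degree_Suc: "word_degree n t \<Longrightarrow> word_degree (Suc n) t"
  by (induction rule: word_degree.induct) (auto intro: word_degree.intros)

lemma word_degree_exists: "\<exists>n. word_degree n t"
proof (induction t rule: gen)
  case (mult u a b)
  then obtain n where "word_degree n u" by blast
  then have "word_degree (Suc n) (u * x a b)" using mult.hyps by (rule word_degree_mult)
  then show ?case by blast
next
  case (add u v)
  then obtain m n where mn: "word_degree m u" "word_degree n v" by auto
  have up: "word_degree (l + d) s" if "word_degree l s" for l d s
    using that by (induction d) (auto intro: word_degree_Suc)
  have "word_degree (m + n) u" "word_degree (m + n) v"
    using up[OF mn(1), of n] up[OF mn(2), of m] by (simp_all add: add.commute)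
  then show ?case by (auto intro: word_degree_add)
qed (auto intro: word_degree.intros)

lemma word_degree_scale: "word_degree n t \<Longrightarrow> word_degree n (sc c * t)"
proof (induction rule: word_degree.induct)
  case (word_degree_sc n d)
  show ?case by (metis sc_mult word_degree.word_degree_sc)
next
  case (word_degree_mult n u a b)
  then show ?case by (auto intro: word_degree.word_degree_mult simp: mult.assoc[symmetric])
qed (auto intro: word_degree.intros I_left simp: distrib_left)

lemma word_degree_0: "word_degree n 0"
  by (rule word_degree_rel) (rule I_closed(6))

lemma word_degree_diff: "word_degree n s \<Longrightarrow> word_degree n t \<Longrightarrow> word_degree n (s - t)"
  using word_degree_add[of n s "sc (- 1) * t"] word_degree_scale[of n t "- 1"] by (simp add: sc_minus sc_1)

text \<open>A commutator replaces one factor of a word by a combination of letters, so it does not lengthen the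
word. This makes the induction for the triangular decomposition possible.\<close>

lemma word_degree_commutator:
  assumes "word_degree n t" and ij: "i \<in> {1..k}" "j \<in> {1..k}"
  shows "word_degree n (t * x i j - x i j * t)"
  using assms(1)
proof (induction rule: word_degree.induct)
  case (word_degree_rel r n)
  then show ?case by (intro word_degree.word_degree_rel I_closed(4) I_left I_right)
next
  case (word_degree_sc n c)
  then show ?case by (simp add: sc_comm word_degree_0)
next
  case (word_degree_mult n u a b)
  let ?C = "(if b = i then x a j else 0) - (if a = j then x i b else 0)"
  have "u * x a b * x i j - x i j * (u * x a b) =
      (u * x i j - x i j * u) * x a b + u * (x a b * x i j - x i j * x a b - ?C)
      + ((if b = i then u * x a j else 0) - (if a = j then u * x i b else 0))"
    by (simp add: algebra_simps)
  moreover have "word_degree (Suc n) ((u * x i j - x i j * u) * x a b)"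
    using word_degree_mult by (intro word_degree.word_degree_mult)
  moreover have "word_degree (Suc n) (u * (x a b * x i j - x i j * x a b - ?C))"
    using word_degree_mult ij by (intro word_degree_rel I_left comm)
  moreover have "word_degree (Suc n) (if b = i then u * x a j else 0)" "word_degree (Suc n) (if a = j then u * x i b else 0)"
    using word_degree_mult ij by (auto intro: word_degree.word_degree_mult word_degree_0)
  ultimately show ?case by (simp only:) (intro word_degree_add word_degree_diff)
next
  case (word_degree_add n u v)
  have "(u + v) * x i j - x i j * (u + v) = (u * x i j - x i j * u) + (v * x i j - x i j * v)"
    by (simp add: algebra_simps)
  then show ?case using word_degree_add.IH by (simp only:) (rule word_degree.word_degree_add)
qed

definition triangular :: "'t \<Rightarrow> bool" where
  "triangular t \<longleftrightarrow> (\<exists>c. \<exists>n\<in>lowering. \<exists>r\<in>verma. t = sc c + n + r)"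

lemma triangularI: "n \<in> lowering \<Longrightarrow> r \<in> verma \<Longrightarrow> triangular (sc c + n + r)"
  by (auto simp: triangular_def)

lemma verma_triangular: "r \<in> verma \<Longrightarrow> triangular r"
  using triangularI[of 0 r 0] by (simp add: sc_0 lowering_0)

lemma triangular_add:
  assumes "triangular s" "triangular t" shows "triangular (s + t)"
proof -
  obtain c n r c' n' r' where *: "n \<in> lowering" "r \<in> verma" "s = sc c + n + r"
    "n' \<in> lowering" "r' \<in> verma" "t = sc c' + n' + r'"
    using assms by (auto simp: triangular_def)
  have "s + t = sc (c + c') + (n + n') + (r + r')" by (simp add: * sc_add algebra_simps)
  then show ?thesis using * by (simp only:) (intro triangularI lowering_add verma_add)
qed

text \<open>By induction on the length of words. Let \<open>u x\<^sub>a\<^sub>b\<close> be a word with last letter \<open>x\<^sub>a\<^sub>b\<close>. If \<open>a < b\<close>, it lies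
in the Verma ideal; if \<open>a = b\<close>, the letter can be replaced by a scalar; if \<open>a > b\<close>, the letter can
be moved to the front at the cost of a commutator, which is shorter.\<close>

theorem triangular_decomposition: "triangular t"
proof -
  have "word_degree n t \<Longrightarrow> triangular t" for n
  proof (induction n arbitrary: t rule: less_induct)
    case (less n)
    from less.prems less.IH show ?case
    proof (induction n t rule: word_degree.induct)
      case (word_degree_rel r n)
      then show ?case by (intro verma_triangular verma_rel)
    next
      case (word_degree_sc n c)
      then show ?case using triangularI[of 0 0 c] lowering_0 verma_rel[OF I_closed(6)] by simp
    next
      case (word_degree_mult n u a b)
      have IH: "triangular s" if "word_degree n s" for s
        using word_degree_mult.prems[OF lessI that] .
      show ?case
      proof (cases a b rule: linorder_cases)
        case less
        then show ?thesis using word_degree_mult by (intro verma_triangular verma_raise)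
      next
        case equal
        have "u * x a b = sc (adjoint_weight k a) * u + u * (x a a - sc (adjoint_weight k a))"
          using equal sc_comm[of u] by (simp add: algebra_simps)
        moreover have "triangular (sc (adjoint_weight k a) * u)"
          using word_degree_mult by (intro IH word_degree_scale)
        moreover have "triangular (u * (x a a - sc (adjoint_weight k a)))"
          using word_degree_mult by (intro verma_triangular verma_weight)
        ultimately show ?thesis using triangular_add by metis
      next
        case greater
        obtain c l r where u: "l \<in> lowering" "r \<in> verma" "u = sc c + l + r"
          using IH[OF word_degree_mult.hyps(1)] by (auto simp: triangular_def)
        have "u * x a b = (u * x a b - x a b * u) + (sc 0 + (sc c * x a b + x a b * l) + x a b * r)"
          unfolding u(3) by (simp add: algebra_simps sc_0 sc_comm)
        moreover have "triangular (u * x a b - x a b * u)"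
          using word_degree_mult by (intro IH word_degree_commutator)
        moreover have "triangular (sc 0 + (sc c * x a b + x a b * l) + x a b * r)"
          using word_degree_mult greater u
          by (intro triangularI lowering_add lowering_sc lowering_gen lowering_mult verma_left)
        ultimately show ?thesis using triangular_add by metis
      qed
    next
      case (word_degree_add n u v)
      then show ?case by (intro triangular_add) auto
    qed
  qed
  then show ?thesis using word_degree_exists by blast
qed

end

context adjoint_relations
begin

lemma highest_verma:
  assumes N: "left_ideal N" and w: "highest N w"
  shows "r \<in> verma \<Longrightarrow> r * w \<in> N"
proof (induction rule: verma.induct)
  case (verma_rel r)
  then show ?case by (rule left_idealD(7)[OF N])
next
  case (verma_raise a b t)
  then have "x a b * w \<in> N" using w by (simp add: highest_def raising_null_def)
  then show ?case using left_idealD(3)[OF N] by (simp add: mult.assoc)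
next
  case (verma_weight i t)
  then have "(x i i - sc (adjoint_weight k i)) * w \<in> N" using w by (simp add: highest_def weight_vector_def)
  then show ?case using left_idealD(3)[OF N] by (simp add: mult.assoc)
next
  case (verma_add s t)
  then show ?case using left_idealD(2)[OF N] by (simp add: distrib_right)
qed

lemma highest_grading:
  assumes N: "left_ideal N" and w: "highest N w"
  shows "(grading - sc (of_nat k - 1)) * w \<in> N"
proof -
  have "(\<Sum>a=1..k. sc (- of_nat a) * ((x a a - sc (adjoint_weight k a)) * w)) \<in> N"
    by (rule left_ideal_sum[OF N], rule left_idealD(3)[OF N]) (use w in \<open>simp add: highest_def weight_vector_def\<close>)
  also have "(\<Sum>a=1..k. sc (- of_nat a) * ((x a a - sc (adjoint_weight k a)) * w)) =
      (grading - sc (\<Sum>a=1..k. - of_nat a * adjoint_weight k a)) * w"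
    by (simp add: grading_def sc_sum sum_distrib_right sum_subtractf left_diff_distrib right_diff_distrib sc_mult sc_minus sum_negf mult.assoc)
  also have "(\<Sum>a=1..k. - of_nat a * adjoint_weight k a) =
      (\<Sum>a=1..k. if a = k then of_nat a else 0) - (\<Sum>a=1..k. if a = 1 then of_nat a else (0::'a))"
    unfolding sum_subtractf[symmetric] by (intro sum.cong refl) (auto simp: adjoint_weight_def)
  also have "\<dots> = of_nat k - 1" using k by (simp add: sum.delta)
  finally show ?thesis .
qed

text \<open>A product of lowering operators lowers the eigenvalue \<open>k - 1\<close> of the grading element. A sum of
vectors with various lower eigenvalues is described by a polynomial in the grading element that
kills it and for which \<open>k - 1\<close> is not a root.\<close>

lemma lowering_highest:
  assumes w: "highest I w" and t: "t \<in> lowering"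
  shows "\<exists>cs. of_nat k - 1 \<notin> set cs \<and> shifted_prod grading cs * (t * w) \<in> I"
proof -
  define low :: "'a set" where "low = {of_nat k - 1 - of_nat n |n. n \<ge> 1}"
  have "\<exists>cs. set cs \<subseteq> low \<and> shifted_prod grading cs * (t * w) \<in> I"
    using t
  proof (induction rule: lowering.induct)
    case lowering_0
    then show ?case by (intro exI[of _ "[]"]) (simp add: I_closed(6))
  next
    case (lowering_gen a b)
    have "(grading - sc (of_nat k - 1 + (of_nat b - of_nat a))) * (x a b * w) \<in> I"
      using lowering_gen by (intro grading_apply[OF left_ideal_I] highest_grading[OF left_ideal_I w]) auto
    moreover have eq: "of_nat k - 1 + (of_nat b - of_nat a) = (of_nat k - 1 - of_nat (a - b) :: 'a)" and "1 \<le> a - b"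
      using lowering_gen by (simp_all add: of_nat_diff)
    ultimately have "shifted_prod grading [of_nat k - 1 - of_nat (a - b)] * (x a b * w) \<in> I"
      by (simp only: shifted_prod_simps mult_1_right)
    moreover have "of_nat k - 1 - of_nat (a - b) \<in> low"
      unfolding low_def using \<open>1 \<le> a - b\<close> by blast
    ultimately show ?case by (intro exI[of _ "[of_nat k - 1 - of_nat (a - b)]"]) (simp del: shifted_prod_simps of_nat_diff)
  next
    case (lowering_mult a b t)
    then obtain cs where cs: "set cs \<subseteq> low" "shifted_prod grading cs * (t * w) \<in> I"
      by auto
    let ?cs = "map (\<lambda>c. c + (of_nat b - of_nat a)) cs"
    have "shifted_prod grading ?cs * (x a b * t * w) =
        (shifted_prod grading ?cs * x a b - x a b * shifted_prod grading cs) * (t * w) + x a b * (shifted_prod grading cs * (t * w))"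
      by (simp add: algebra_simps)
    also have "\<dots> \<in> I"
      using lowering_mult by (intro I_closed(2) I_right[OF shifted_prod_shift] I_left[OF cs(2)]) auto
    finally have "shifted_prod grading ?cs * (x a b * t * w) \<in> I" .
    moreover have "set ?cs \<subseteq> low"
    proof
      fix c assume "c \<in> set ?cs"
      then obtain n where "n \<ge> 1" "c = of_nat k - 1 - of_nat n + (of_nat b - of_nat a)" using cs(1) by (auto simp: low_def)
      then have "c = of_nat k - 1 - of_nat (n + (a - b)) \<and> 1 \<le> n + (a - b)"
        using lowering_mult by (simp add: of_nat_diff)
      then show "c \<in> low" unfolding low_def by blast
    qed
    ultimately show ?case by blast
  next
    case (lowering_add s t)
    then obtain cs ds where cs: "set cs \<subseteq> low" "shifted_prod grading cs * (s * w) \<in> I"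
      and ds: "set ds \<subseteq> low" "shifted_prod grading ds * (t * w) \<in> I"
      by auto
    have "shifted_prod grading (cs @ ds) * ((s + t) * w) =
        shifted_prod grading ds * (shifted_prod grading cs * (s * w)) + shifted_prod grading cs * (shifted_prod grading ds * (t * w))"
    proof -
      have "shifted_prod grading (cs @ ds) * ((s + t) * w) =
          shifted_prod grading (cs @ ds) * (s * w) + shifted_prod grading (cs @ ds) * (t * w)"
        by (simp only: distrib_left distrib_right)
      also have "shifted_prod grading (cs @ ds) * (s * w) = shifted_prod grading ds * shifted_prod grading cs * (s * w)"
        by (simp only: shifted_prod_append shifted_prod_commute[of _ cs ds])
      finally show ?thesis by (simp only: shifted_prod_append mult.assoc)
    qed
    also have "\<dots> \<in> I" by (intro I_closed(2) I_left[OF cs(2)] I_left[OF ds(2)])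
    finally show ?case using cs(1) ds(1) by (intro exI[of _ "cs @ ds"]) auto
  next
    case (lowering_sc t c)
    then obtain cs where cs: "set cs \<subseteq> low" "shifted_prod grading cs * (t * w) \<in> I"
      by auto
    have "shifted_prod grading cs * (sc c * t * w) = sc c * (shifted_prod grading cs * (t * w))"
      by (simp add: mult.assoc sc_left[of "shifted_prod grading cs"])
    then show ?case using cs I_left[OF cs(2)] by (intro exI[of _ cs]) simp
  qed
  then obtain cs where cs: "set cs \<subseteq> low" "shifted_prod grading cs * (t * w) \<in> I"
    by blast
  have "(of_nat k - 1 :: 'a) \<noteq> of_nat k - 1 - of_nat n" if "n \<ge> 1" for n
    using that by simp
  then have "of_nat k - 1 \<notin> set cs" using cs(1) by (auto simp: low_def)
  then show ?thesis using cs(2) by blast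
qed

end

section \<open>The annihilator of the adjoint representation\<close>

text \<open>\<open>P\<close> is the kernel of the adjoint representation and \<open>\<phi> u\<close> is the coefficient of \<open>e\<^sub>1\<^sub>k\<close> in \<open>u \<cdot> e\<^sub>1\<^sub>k\<close>. The
roots \<open>1 - k, \<dots>, k - 2\<close> together with \<open>k - 1\<close> are the eigenvalues of the grading element on \<open>L\<close>;
the polynomial without the root \<open>k - 1\<close> maps \<open>L\<close> to the multiples of \<open>e\<^sub>1\<^sub>k\<close>, on which \<open>x\<^sub>i\<^sub>i\<close> acts by
\<open>adjoint_weight k i\<close>.\<close>

locale adjoint_annihilator = adjoint_relations k sc x I
  for k :: nat and sc :: "'a::field_char_0 \<Rightarrow> 't::ring_1" and x :: "nat \<Rightarrow> nat \<Rightarrow> 't" and I :: "'t set" +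
  fixes P :: "'t set" and \<phi> :: "'t \<Rightarrow> 'a"
  assumes I_P: "I \<subseteq> P"
    and P_left: "p \<in> P \<Longrightarrow> t * p \<in> P" and P_right: "p \<in> P \<Longrightarrow> p * t \<in> P"
    and P_add: "p \<in> P \<Longrightarrow> p' \<in> P \<Longrightarrow> p + p' \<in> P"
    and P_grading: "shifted_prod grading (map of_int [1 - int k..int k - 2]) * (grading - sc (of_nat k - 1)) \<in> P"
    and P_weight: "i \<in> {1..k} \<Longrightarrow>
      (x i i - sc (adjoint_weight k i)) * shifted_prod grading (map of_int [1 - int k..int k - 2]) \<in> P"
    and \<phi>_add: "\<phi> (s + t) = \<phi> s + \<phi> t" and \<phi>_sc: "\<phi> (sc c * t) = c * \<phi> t" and \<phi>_1: "\<phi> 1 = 1"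
    and \<phi>_P: "p \<in> P \<Longrightarrow> \<phi> p = 0"
    and \<phi>_lower: "a \<in> {1..k} \<Longrightarrow> b \<in> {1..k} \<Longrightarrow> b < a \<Longrightarrow> \<phi> (x a b * t) = 0"
    and \<phi>_raise: "a \<in> {1..k} \<Longrightarrow> b \<in> {1..k} \<Longrightarrow> a < b \<Longrightarrow> \<phi> (t * x a b) = 0"
    and \<phi>_weight: "i \<in> {1..k} \<Longrightarrow> \<phi> (t * (x i i - sc (adjoint_weight k i))) = 0"
begin

lemma \<phi>_lowering: "t \<in> lowering \<Longrightarrow> \<phi> t = 0"
proof (induction rule: lowering.induct)
  case lowering_0
  show ?case using \<phi>_sc[of 0 0] by (simp add: sc_0)
next
  case (lowering_gen a b)
  then show ?case using \<phi>_lower[of a b 1] by simp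
qed (simp_all add: \<phi>_lower \<phi>_add \<phi>_sc)

lemma \<phi>_verma: "r \<in> verma \<Longrightarrow> \<phi> r = 0"
proof (induction rule: verma.induct)
  case (verma_rel r)
  then show ?case using I_P by (intro \<phi>_P) blast
qed (simp_all add: \<phi>_raise \<phi>_weight \<phi>_add)

text \<open>If \<open>p w \<noteq> 0\<close>, then some \<open>u p w\<close> is a highest weight vector of the same weight as \<open>w\<close>. As \<open>\<phi>\<close> vanishes on
\<open>u p\<close>, the scalar part of \<open>u p\<close> is 0, so \<open>u p w\<close> comes from lowering operators and has only lower
eigenvalues of the grading element.\<close>

lemma P_highest:
  assumes w: "highest I w" and p: "p \<in> P"
  shows "p * w \<in> I"
proof (rule ccontr)
  assume "p * w \<notin> I"
  then obtain u where u: "u * (p * w) \<notin> I" "highest I (u * (p * w))"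
    using exists_highest[OF left_ideal_I] by blast
  obtain c l r where d: "l \<in> lowering" "r \<in> verma" "u * p = sc c + l + r"
    using triangular_decomposition[of "u * p"] by (auto simp: triangular_def)
  have "\<phi> (u * p) = 0" using P_left[OF p] by (rule \<phi>_P)
  then have "c = 0" using \<phi>_sc[of c 1] d by (simp add: \<phi>_add \<phi>_1 \<phi>_lowering \<phi>_verma)
  then have up: "u * (p * w) = l * w + r * w" using d(3) by (simp add: mult.assoc[symmetric] sc_0 distrib_right)
  have r: "r * w \<in> I" by (rule highest_verma[OF left_ideal_I w d(2)])
  obtain cs where cs: "of_nat k - 1 \<notin> set cs" "shifted_prod grading cs * (l * w) \<in> I"
    using lowering_highest[OF w d(1)] by blast
  have "shifted_prod grading cs * (u * (p * w)) \<in> I"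
    unfolding up distrib_left by (rule I_closed(2)[OF cs(2) I_left[OF r]])
  then have "u * (p * w) \<in> I"
    using shifted_prod_eigen_cancel[OF left_ideal_I highest_grading[OF left_ideal_I u(2)]] cs(1) by blast
  then show False using u(1) by blast
qed

text \<open>A proper \<open>N\<close> leads to a highest weight vector \<open>w\<close> modulo \<open>N\<close>. The vector \<open>q w\<close>, where \<open>q\<close> is the
polynomial in the grading element with all eigenvalues on \<open>L\<close> except \<open>k - 1\<close> as roots, is a
nonzero multiple of \<open>w\<close> modulo \<open>N\<close> and is highest modulo \<open>I\<close>. The reason is that \<open>N\<close>, being killed
by \<open>P\<close>, has only the eigenvalues of \<open>L\<close>: it has none above \<open>k - 1\<close>, so the raising operators kill
\<open>q w\<close>, and \<open>q\<close> maps it to vectors of weight \<open>adjoint_weight k\<close>, so each \<open>x\<^sub>i\<^sub>i\<close> acts on \<open>q w\<close> with a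
single generalized eigenvalue, which the cubic relation makes a genuine one.\<close>

theorem annihilator_subset_relations: "P \<subseteq> I"
proof -
  define N where "N = {v. \<forall>p\<in>P. p * v \<in> I}"
  have N: "left_ideal N"
    unfolding left_ideal_def
  proof (intro conjI ballI allI subsetI)
    fix r assume "r \<in> I"
    then show "r \<in> N" by (simp add: N_def I_left)
  next
    fix s t assume "s \<in> N" "t \<in> N"
    then show "s + t \<in> N" by (simp add: N_def distrib_left I_add)
  next
    fix s t assume "s \<in> N"
    then show "t * s \<in> N" by (simp add: N_def P_right mult.assoc[symmetric])
  qed
  have PN: "p * v \<in> I" if "p \<in> P" "v \<in> N" for p v using that by (simp add: N_def)
  have "1 \<in> N"
  proof (rule ccontr)
    assume "1 \<notin> N"
    then obtain w where w: "w \<notin> N" "highest N w" using exists_highest[OF N] by blast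
    define c0 :: 'a where "c0 = of_nat k - 1"
    define cs :: "'a list" where "cs = map of_int [1 - int k..int k - 2]"
    define q where "q = shifted_prod grading cs"
    define w' where "w' = q * w"
    note H_w = highest_grading[OF N w(2), folded c0_def]
    have c0_eq: "c0 = of_int (int k - 1)" by (simp add: c0_def)
    have cs_le: "c0 + of_nat s \<notin> set cs" for s
    proof
      assume "c0 + of_nat s \<in> set cs"
      then obtain m where m: "m \<le> int k - 2" "c0 + of_nat s = of_int m" by (auto simp: cs_def)
      have "(of_int (int k - 1 + int s) :: 'a) = of_int m" using m(2) by (simp add: c0_eq)
      then have "int k - 1 + int s = m" by (simp only: of_int_eq_iff)
      then show False using m(1) by simp
    qed
    have q_P: "q * (grading - sc c0) \<in> P" using P_grading by (simp add: q_def cs_def c0_def)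
    have q_comm: "q * (grading - sc c0) = (grading - sc c0) * q"
      using shifted_prod_commute[of grading cs "[c0]"] by (simp add: q_def)
    \<comment> \<open>modulo \<open>I\<close>, no nonzero vector of \<open>N\<close> has an eigenvalue above \<open>k - 1\<close>\<close>
    have vanish: "y \<in> I" if y: "y \<in> N" "(grading - sc (c0 + of_nat s)) * y \<in> I" and s: "1 \<le> s" for y s
    proof (rule shifted_prod_eigen_cancel[OF left_ideal_I y(2)])
      show "shifted_prod grading (cs @ [c0]) * y \<in> I"
        using PN[OF q_P y(1)] by (simp add: shifted_prod_append q_def)
      show "c0 + of_nat s \<notin> set (cs @ [c0])" using cs_le[of s] s by auto
    qed
    have w'_mod: "w' - sc (prod_list (map (\<lambda>d. c0 - d) cs)) * w \<in> N"
      unfolding w'_def q_def by (rule shifted_prod_eigen[OF N H_w])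
    have "w' \<notin> N"
    proof
      assume "w' \<in> N"
      then have "w \<in> N"
        using shifted_prod_eigen_cancel[OF N H_w, of cs] cs_le[of 0] by (simp add: w'_def q_def)
      then show False using w(1) by blast
    qed
    have null: "raising_null I w'"
      unfolding raising_null_def
    proof (intro allI impI)
      fix a b assume ab: "1 \<le> a" "a < b" "b \<le> k"
      then have ab': "a \<in> {1..k}" "b \<in> {1..k}" by auto
      have step: "c0 + (of_nat b - of_nat a) = c0 + of_nat (b - a)" "1 \<le> b - a"
        using ab by (simp_all add: of_nat_diff)
      \<comment> \<open>\<open>(grading - c0) w' = n\<close> lies in \<open>N\<close> and has the eigenvalue \<open>c0\<close> modulo \<open>I\<close>\<close>
      define n where "n = q * ((grading - sc c0) * w)"
      have n: "n \<in> N" unfolding n_def by (rule left_idealD(3)[OF N H_w])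
      have "(grading - sc c0) * n = q * (grading - sc c0) * ((grading - sc c0) * w)"
        by (simp only: n_def q_comm mult.assoc)
      then have n_top: "(grading - sc c0) * n \<in> I" using PN[OF q_P H_w] by simp
      have xn: "x a b * n \<in> I"
        by (rule vanish[OF left_idealD(3)[OF N n] grading_apply[OF left_ideal_I ab' n_top, unfolded step(1)] step(2)])
      have xw: "x a b * w \<in> N" using w(2) ab by (simp add: highest_def raising_null_def)
      have "x a b * w' = x a b * (w' - sc (prod_list (map (\<lambda>d. c0 - d) cs)) * w)
          + sc (prod_list (map (\<lambda>d. c0 - d) cs)) * (x a b * w)"
        by (simp add: right_diff_distrib sc_left[of "x a b"])
      also have "\<dots> \<in> N"
        by (intro left_idealD(2)[OF N] left_idealD(3)[OF N w'_mod] left_idealD(3)[OF N xw])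
      finally have y: "x a b * w' \<in> N" .
      have "(grading - sc c0) * w' = n" by (simp only: n_def w'_def q_comm mult.assoc[symmetric])
      then have "(grading - sc (c0 + (of_nat b - of_nat a))) * (x a b * w') =
          x a b * n + (grading * x a b - x a b * grading - sc (of_nat b - of_nat a) * x a b) * w'"
        by (simp add: sc_add left_diff_distrib right_diff_distrib distrib_right mult.assoc sc_left[of "x a b"] flip: \<open>(grading - sc c0) * w' = n\<close>)
      also have "\<dots> \<in> I" by (rule I_closed(2)[OF xn I_right[OF grading_comm[OF ab']]])
      finally have top: "(grading - sc (c0 + (of_nat b - of_nat a))) * (x a b * w') \<in> I" .
      show "x a b * w' \<in> I" by (rule vanish[OF y top[unfolded step(1)] step(2)])
    qed
    have weight: "(diag_diff i k - sc (adjoint_weight k i - adjoint_weight k k)) * w' \<in> I" if i: "i \<in> {1..k}" for i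
    proof (cases "i = k")
      case True
      then show ?thesis by (simp add: diag_diff_def sc_0 I_closed(6))
    next
      case False
      define c where "c = adjoint_weight k i - (adjoint_weight k k :: 'a)"
      define g where "g = diag_diff i k - sc c"
      have kk: "k \<in> {1..k}" using k by simp
      have gw: "g * w \<in> N"
        unfolding g_def c_def using w(2) i kk by (intro weight_vector_diag_diff[OF N]) (simp_all add: highest_def)
      have "g * q = (x i i - sc (adjoint_weight k i)) * q + (- 1) * ((x k k - sc (adjoint_weight k k)) * q)"
        by (simp add: g_def c_def diag_diff_def sc_diff algebra_simps)
      also have "\<dots> \<in> P"
        unfolding q_def cs_def by (rule P_add[OF P_weight[OF i] P_left[OF P_weight[OF kk]]])
      finally have gq: "g * q \<in> P" .
      have x_q: "q * x j j - x j j * q \<in> I" if "j \<in> {1..k}" for j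
        using shifted_prod_shift[OF that that, of cs] by (simp add: q_def)
      have "q * g - g * q = (q * x i i - x i i * q) - (q * x k k - x k k * q)"
        using sc_comm[of q c] by (simp add: g_def diag_diff_def algebra_simps)
      then have q_g: "q * g - g * q \<in> I" using I_closed(4)[OF x_q[OF i] x_q[OF kk]] by simp
      have "g * (g * w') = (g * q) * (g * w) - g * ((q * g - g * q) * w)"
        by (simp add: w'_def algebra_simps)
      also have "\<dots> \<in> I" by (rule I_closed(4)[OF PN[OF gq gw] I_left[OF I_right[OF q_g]]])
      finally have ggw: "(diag_diff i k - sc c) * (g * w') \<in> I" by (simp add: g_def)
      \<comment> \<open>\<open>(h - c)\<^sup>2\<close> kills \<open>w'\<close> for \<open>h = x\<^sub>i\<^sub>i - x\<^sub>k\<^sub>k\<close>, and \<open>c\<close> is a simple root of \<open>h (h - 1) (h - 2)\<close>\<close>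
      have cubic: "shifted_prod (diag_diff i k) [0, 1, 2] * w' \<in> I"
        using i False by (intro raising_null_cubic[OF left_ideal_I null]) auto
      obtain ds where ds: "c \<notin> set ds" "shifted_prod (diag_diff i k) ds * (g * w') \<in> I"
      proof (cases "i = 1")
        case True
        then have "c = 2" using False k by (simp add: c_def adjoint_weight_def)
        then show ?thesis using cubic that[of "[0, 1]"] by (simp add: g_def mult.assoc)
      next
        case i1: False
        then have c: "c = 1" using False k by (simp add: c_def adjoint_weight_def)
        have "shifted_prod (diag_diff i k) [1, 2] = shifted_prod (diag_diff i k) [2, 1]"
          using shifted_prod_commute[of "diag_diff i k" "[1]" "[2]"] by simp
        then show ?thesis using cubic that[of "[0, 2]"] c by (simp add: g_def mult.assoc[symmetric])
      qed
      have "g * w' \<in> I" by (rule shifted_prod_eigen_cancel[OF left_ideal_I ggw ds(2,1)])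
      then show ?thesis by (simp add: g_def c_def)
    qed
    have "(\<Sum>i=1..k. adjoint_weight k i) = (0::'a)"
      using k by (simp add: adjoint_weight_def sum_subtractf of_bool_def)
    then have "highest I w'"
      using null weight_vectorI[OF left_ideal_I weight] by (simp add: highest_def)
    then have "w' \<in> N" using P_highest by (simp add: N_def)
    then show False using \<open>w' \<notin> N\<close> by blast
  qed
  then show ?thesis by (auto simp: N_def)
qed

end

context gl_relations
begin

section \<open>Central elements\<close>

text \<open>The \<open>(i, j)\<close> entry of the \<open>p\<close>-th power of the matrix \<open>(x\<^sub>i\<^sub>j)\<close>; the Casimir elements are the traces of
these powers.\<close>

primrec path_sum :: "nat \<Rightarrow> nat \<Rightarrow> nat \<Rightarrow> 't" where
  "path_sum 0 i j = (if i = j then 1 else 0)"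
| "path_sum (Suc p) i j = (\<Sum>m=1..k. x i m * path_sum p m j)"

text \<open>The entries of the powers of \<open>(x\<^sub>i\<^sub>j)\<close> satisfy the same commutation relations with \<open>x\<^sub>a\<^sub>b\<close> as the entries
of the matrix itself; in the sum over \<open>m\<close> the inner terms cancel.\<close>

lemma path_sum_comm:
  assumes ab: "a \<in> {1..k}" "b \<in> {1..k}" and i: "i \<in> {1..k}" and j: "j \<in> {1..k}"
  shows "x a b * path_sum p i j - path_sum p i j * x a b
    - ((if b = i then path_sum p a j else 0) - (if a = j then path_sum p i b else 0)) \<in> I"
  using i
proof (induction p arbitrary: i)
  case 0
  then show ?case by (auto simp: I_closed(6))
next
  case (Suc p)
  let ?C = "\<lambda>m. (if b = i then x a m else 0) - (if a = m then x i b else 0)"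
  let ?D = "\<lambda>m. (if b = m then path_sum p a j else 0) - (if a = j then path_sum p m b else 0)"
  have "(\<Sum>m=1..k. ?C m * path_sum p m j + x i m * ?D m) =
      (\<Sum>m=1..k. if b = i then x a m * path_sum p m j else 0) - (\<Sum>m=1..k. if a = m then x i b * path_sum p m j else 0)
      + (\<Sum>m=1..k. if b = m then x i m * path_sum p a j else 0) - (\<Sum>m=1..k. if a = j then x i m * path_sum p m b else 0)"
    unfolding sum_subtractf[symmetric] sum.distrib[symmetric] by (intro sum.cong refl) (simp add: algebra_simps)
  also have "\<dots> = (if b = i then path_sum (Suc p) a j else 0) - (if a = j then path_sum (Suc p) i b else 0)"
    using ab by simp
  finally have CD: "(\<Sum>m=1..k. ?C m * path_sum p m j + x i m * ?D m) =
      (if b = i then path_sum (Suc p) a j else 0) - (if a = j then path_sum (Suc p) i b else 0)" .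
  have "x a b * path_sum (Suc p) i j - path_sum (Suc p) i j * x a b
      - ((if b = i then path_sum (Suc p) a j else 0) - (if a = j then path_sum (Suc p) i b else 0)) =
    (\<Sum>m=1..k. (x a b * x i m - x i m * x a b - ?C m) * path_sum p m j
      + x i m * (x a b * path_sum p m j - path_sum p m j * x a b - ?D m))"
    unfolding CD[symmetric] unfolding path_sum.simps sum_distrib_left sum_distrib_right sum_subtractf[symmetric]
    by (intro sum.cong refl) (simp add: left_diff_distrib right_diff_distrib mult.assoc)
  also have "\<dots> \<in> I"
  proof (rule left_ideal_sum[OF left_ideal_I])
    fix m assume m: "m \<in> {1..k}"
    show "(x a b * x i m - x i m * x a b - ?C m) * path_sum p m j
      + x i m * (x a b * path_sum p m j - path_sum p m j * x a b - ?D m) \<in> I"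
      by (rule I_closed(2)[OF I_right[OF comm[OF ab Suc.prems m]] I_left[OF Suc.IH[OF m]]])
  qed
  finally show ?case .
qed

definition casimir_sum :: "nat \<Rightarrow> 't" where
  "casimir_sum p = (\<Sum>i=1..k. path_sum p i i)"

lemma casimir_sum_comm_gen:
  assumes ab: "a \<in> {1..k}" "b \<in> {1..k}"
  shows "x a b * casimir_sum p - casimir_sum p * x a b \<in> I"
proof -
  have "(\<Sum>i=1..k. (if b = i then path_sum p a i else 0) - (if a = i then path_sum p i b else 0)) = 0"
    using ab by (simp add: sum_subtractf)
  then have "x a b * casimir_sum p - casimir_sum p * x a b =
      (\<Sum>i=1..k. x a b * path_sum p i i - path_sum p i i * x a b
        - ((if b = i then path_sum p a i else 0) - (if a = i then path_sum p i b else 0)))"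
    by (simp add: casimir_sum_def sum_distrib_left sum_distrib_right sum_subtractf)
  also have "\<dots> \<in> I" by (rule left_ideal_sum[OF left_ideal_I], rule path_sum_comm[OF ab])
  finally show ?thesis .
qed

lemma casimir_sum_central: "t * casimir_sum p - casimir_sum p * t \<in> I"
proof (induction t rule: gen)
  case (rel r)
  show ?case by (rule I_closed(4)[OF I_right[OF rel] I_left[OF rel]])
next
  case (sc c)
  then show ?case by (simp add: sc_comm I_closed(6))
next
  case (mult u a b)
  have "u * x a b * casimir_sum p - casimir_sum p * (u * x a b) =
      u * (x a b * casimir_sum p - casimir_sum p * x a b) + (u * casimir_sum p - casimir_sum p * u) * x a b"
    by (simp add: algebra_simps)
  also have "\<dots> \<in> I" 
    by (rule I_closed(2)[OF I_left[OF casimir_sum_comm_gen[OF mult.hyps]] I_right[OF mult.IH]])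
  finally show ?case .
next
  case (add u v)
  have "(u + v) * casimir_sum p - casimir_sum p * (u + v) =
      (u * casimir_sum p - casimir_sum p * u) + (v * casimir_sum p - casimir_sum p * v)"
    by (simp add: algebra_simps)
  also have "\<dots> \<in> I" by (rule I_closed(2)[OF add.IH])
  finally show ?case .
qed

lemma casimir_sum_2: "casimir_sum 2 = casimir2"
proof -
  have "path_sum 2 i i = (\<Sum>j=1..k. x i j * x j i)" if i: "i \<in> {1..k}" for i
  proof -
    have "x j m * (if m = i then 1 else 0) = (if m = i then x j i else 0)" for j m by simp
    then show ?thesis using i by (simp add: numeral_2_eq_2)
  qed
  then show ?thesis by (simp add: casimir_sum_def casimir2_def)
qed

end

section \<open>Free algebras and enveloping algebras\<close>

lemma scalar_add: "scalar (c + d) = scalar c + scalar d"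
  by (simp add: scalar_def single_add)

lemma scalar_mult: "scalar (c * d) = scalar c * scalar d"
  by (simp add: scalar_def mult_single)

lemma scalar_1 [simp]: "scalar 1 = 1"
  by (simp add: scalar_def)

lemma scalar_0 [simp]: "scalar 0 = 0"
  by (simp add: scalar_def)

lemma scalar_minus: "scalar (- c) = - scalar c"
  by (simp add: scalar_def single_uminus)

lemma poly_mapping_induct_single [case_names single add]:
  assumes single: "\<And>w c. Q (Poly_Mapping.single w c)"
    and add: "\<And>f g. Q f \<Longrightarrow> Q g \<Longrightarrow> Q (f + g)"
  shows "Q f"
proof (induction f rule: update_induct)
  case const
  show ?case using single[of undefined 0] by simp
next
  case (update f w c)
  then have "Poly_Mapping.update w c f = f + Poly_Mapping.single w c"
    by (intro poly_mapping_eqI) (auto simp: lookup_update lookup_add lookup_single when_def in_keys_iff)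
  then show ?case using update.IH single add by simp
qed

lemma scalar_commute: "f * scalar c = scalar c * f" for c :: "'a::comm_ring_1"
  by (induction f rule: poly_mapping_induct_single)
    (simp_all add: scalar_def mult_single mult.commute distrib_left distrib_right)

lemma free_algebra_induct [case_names scalar letter add]:
  fixes f :: "'x free_monoid \<Rightarrow>\<^sub>0 'a::comm_ring_1"
  assumes scalar: "\<And>c. Q (scalar c)" and letter: "\<And>u X. Q u \<Longrightarrow> Q (u * letter X)"
    and add: "\<And>u v. Q u \<Longrightarrow> Q v \<Longrightarrow> Q (u + v)"
  shows "Q f"
proof (induction f rule: poly_mapping_induct_single)
  case (single w c)
  have "Q (Poly_Mapping.single (Word ws) c)" for ws
  proof (induction ws rule: rev_induct)
    case Nil
    show ?case using scalar[of c] by (simp add: scalar_def zero_free_monoid_def)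
  next
    case (snoc X ws)
    have "Poly_Mapping.single (Word (ws @ [X])) c = Poly_Mapping.single (Word ws) c * letter X"
      by (simp add: letter_def mult_single plus_free_monoid_def)
    then show ?case using snoc letter by simp
  qed
  then show ?case by (cases w) simp
qed (rule add)

text \<open>Deleting the words with a letter outside \<open>L\<close> is a retraction onto the free algebra on \<open>L\<close>. It
allows working with all words over all matrices, that is with a full type.\<close>

definition restrict_letters :: "'x set \<Rightarrow> ('x free_monoid \<Rightarrow>\<^sub>0 'a::ring_1) \<Rightarrow> ('x free_monoid \<Rightarrow>\<^sub>0 'a)" where
  "restrict_letters L f = (\<Sum>w\<in>Poly_Mapping.keys f. if set (letters w) \<subseteq> L then Poly_Mapping.single w (Poly_Mapping.lookup f w) else 0)"

lemma lookup_restrict_letters: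
  "Poly_Mapping.lookup (restrict_letters L f) w = (if set (letters w) \<subseteq> L then Poly_Mapping.lookup f w else 0)"
proof -
  have "Poly_Mapping.lookup (restrict_letters L f) w =
      (\<Sum>v\<in>Poly_Mapping.keys f. if v = w then if set (letters w) \<subseteq> L then Poly_Mapping.lookup f w else 0 else 0)"
    unfolding restrict_letters_def lookup_sum
    by (intro sum.cong refl) (auto simp: lookup_single when_def)
  then show ?thesis by (simp add: in_keys_iff)
qed

lemma restrict_letters_add: "restrict_letters L (f + g) = restrict_letters L f + restrict_letters L g"
  by (intro poly_mapping_eqI) (simp add: lookup_restrict_letters lookup_add)

lemma restrict_letters_minus: "restrict_letters L (- f) = - restrict_letters L f"
  by (intro poly_mapping_eqI) (simp add: lookup_restrict_letters)

lemma restrict_letters_diff: "restrict_letters L (f - g) = restrict_letters L f - restrict_letters L g"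
  by (intro poly_mapping_eqI) (simp add: lookup_restrict_letters lookup_minus)

lemma restrict_letters_single:
  "restrict_letters L (Poly_Mapping.single w c) = (if set (letters w) \<subseteq> L then Poly_Mapping.single w c else 0)"
  by (intro poly_mapping_eqI) (auto simp: lookup_restrict_letters lookup_single when_def)

lemma restrict_letters_mult: "restrict_letters L (f * g) = restrict_letters L f * restrict_letters L g"
proof (induction f rule: poly_mapping_induct_single)
  case (single v c)
  show ?case
  proof (induction g rule: poly_mapping_induct_single)
    case (single w d)
    show ?case by (simp add: mult_single restrict_letters_single plus_free_monoid_def)
  qed (simp add: distrib_left restrict_letters_add)
qed (simp add: distrib_right restrict_letters_add)

lemma restrict_letters_scalar [simp]: "restrict_letters L (scalar c) = scalar c"
  by (simp add: scalar_def restrict_letters_single zero_free_monoid_def)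

lemma restrict_letters_1 [simp]: "restrict_letters L 1 = 1"
  using restrict_letters_scalar[of L 1] by simp

lemma restrict_letters_0 [simp]: "restrict_letters L 0 = 0"
  by (simp add: restrict_letters_def)

lemma restrict_letters_letter: "restrict_letters L (letter X) = (if X \<in> L then letter X else 0)"
  by (simp add: letter_def restrict_letters_single)

lemma carrier_free_algebra:
  "carrier (free_algebra L) = {f :: 'x free_monoid \<Rightarrow>\<^sub>0 'a::ring_1. restrict_letters L f = f}"
proof (rule Set.set_eqI)
  fix f :: "'x free_monoid \<Rightarrow>\<^sub>0 'a"
  have "f \<in> carrier (free_algebra L) \<longleftrightarrow> (\<forall>w. Poly_Mapping.lookup f w \<noteq> 0 \<longrightarrow> set (letters w) \<subseteq> L)"
    by (auto simp: free_algebra_def in_keys_iff)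
  also have "\<dots> \<longleftrightarrow> (\<forall>w. Poly_Mapping.lookup (restrict_letters L f) w = Poly_Mapping.lookup f w)"
    by (auto simp: lookup_restrict_letters)
  also have "\<dots> \<longleftrightarrow> restrict_letters L f = f" by (auto intro: poly_mapping_eqI)
  finally show "f \<in> carrier (free_algebra L) \<longleftrightarrow> f \<in> {f. restrict_letters L f = f}" by simp
qed

lemma free_algebra_simps:
  "f \<otimes>\<^bsub>free_algebra L\<^esub> g = f * g" "f \<oplus>\<^bsub>free_algebra L\<^esub> g = f + g" "\<one>\<^bsub>free_algebra L\<^esub> = 1" "\<zero>\<^bsub>free_algebra L\<^esub> = 0"
  by (simp_all add: free_algebra_def)

lemma restrict_letters_idem: "restrict_letters L (restrict_letters L f) = restrict_letters L f"
  by (intro poly_mapping_eqI) (simp add: lookup_restrict_letters)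

lemma restrict_letters_carrier: "restrict_letters L f \<in> carrier (free_algebra L)"
  by (simp add: carrier_free_algebra restrict_letters_idem)

lemma ring_free_algebra: "ring (free_algebra L)"
proof (intro ringI abelian_groupI monoidI)
  fix f assume f: "f \<in> carrier (free_algebra L)"
  show "\<exists>g\<in>carrier (free_algebra L). g \<oplus>\<^bsub>free_algebra L\<^esub> f = \<zero>\<^bsub>free_algebra L\<^esub>"
    using f by (intro bexI[of _ "- f"]) (simp_all add: free_algebra_simps carrier_free_algebra restrict_letters_minus)
qed (simp_all add: free_algebra_simps carrier_free_algebra restrict_letters_add restrict_letters_mult algebra_simps)

text \<open>The class in the enveloping algebra, extended to words over all matrices by sending the letters
outside \<open>L\<close> to 0.\<close>

definition env_class :: "'a::field mat set \<Rightarrow> ('a mat free_monoid \<Rightarrow>\<^sub>0 'a) \<Rightarrow> ('a mat free_monoid \<Rightarrow>\<^sub>0 'a) set" where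
  "env_class L f = enveloping_ideal L +>\<^bsub>free_algebra L\<^esub> restrict_letters L f"

locale matrix_lie_algebra =
  fixes L :: "'a::field mat set"
  assumes L_add: "X \<in> L \<Longrightarrow> Y \<in> L \<Longrightarrow> X + Y \<in> L" and L_smult: "X \<in> L \<Longrightarrow> c \<cdot>\<^sub>m X \<in> L"
    and L_commutator: "X \<in> L \<Longrightarrow> Y \<in> L \<Longrightarrow> X * Y - Y * X \<in> L"
begin

abbreviation "E \<equiv> enveloping_ideal L"
abbreviation "FA \<equiv> free_algebra L :: ('a mat free_monoid \<Rightarrow>\<^sub>0 'a) ring"
abbreviation "U \<equiv> enveloping L"
abbreviation "cls \<equiv> env_class L"

lemma relations_carrier: "enveloping_relations L \<subseteq> carrier FA"
  unfolding enveloping_relations_def carrier_free_algebra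
  by (auto simp: restrict_letters_add restrict_letters_diff restrict_letters_mult restrict_letters_letter
      L_add L_smult L_commutator)

lemma ideal_E: "ideal E FA"
  unfolding enveloping_ideal_def by (rule ring.genideal_ideal[OF ring_free_algebra relations_carrier])

lemma ring_U: "ring U"
  unfolding enveloping_def by (rule ideal.quotient_is_ring[OF ideal_E])

lemma rcos_hom: "(+>\<^bsub>FA\<^esub>) E \<in> ring_hom FA U"
  unfolding enveloping_def by (rule ideal.rcos_ring_hom[OF ideal_E])

lemma cls_carrier: "cls f \<in> carrier U"
  unfolding env_class_def by (rule ring_hom_closed[OF rcos_hom restrict_letters_carrier])

lemma cls_add: "cls (f + g) = cls f \<oplus>\<^bsub>U\<^esub> cls g"
  using ring_hom_add[OF rcos_hom restrict_letters_carrier restrict_letters_carrier, of f g]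
  by (simp add: env_class_def restrict_letters_add free_algebra_simps)

lemma cls_mult: "cls (f * g) = cls f \<otimes>\<^bsub>U\<^esub> cls g"
  using ring_hom_mult[OF rcos_hom restrict_letters_carrier restrict_letters_carrier, of f g]
  by (simp add: env_class_def restrict_letters_mult free_algebra_simps)

lemma cls_1: "cls 1 = \<one>\<^bsub>U\<^esub>"
  using ring_hom_one[OF rcos_hom] by (simp add: env_class_def free_algebra_simps)

lemma cls_eq_zero_iff: "cls f = \<zero>\<^bsub>U\<^esub> \<longleftrightarrow> restrict_letters L f \<in> E"
proof -
  interpret ideal E FA by (rule ideal_E)
  have "\<zero>\<^bsub>U\<^esub> = E" by (simp add: enveloping_def FactRing_def)
  then have zero: "cls f = \<zero>\<^bsub>U\<^esub> \<longleftrightarrow> E +>\<^bsub>FA\<^esub> restrict_letters L f = E"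
    by (simp only: env_class_def)
  show ?thesis unfolding zero
  proof
    assume "E +>\<^bsub>FA\<^esub> restrict_letters L f = E"
    then show "restrict_letters L f \<in> E" by (rule rcos_const_imp_mem[OF restrict_letters_carrier])
  qed (rule a_rcos_zero[OF ideal_E])
qed

lemma cls_0: "cls 0 = \<zero>\<^bsub>U\<^esub>"
  using ideal.Icarr[OF ideal_E] additive_subgroup.zero_closed[OF ideal.axioms(1)[OF ideal_E]]
  by (simp add: cls_eq_zero_iff free_algebra_simps)

lemma cls_diff: "cls (f - g) = cls f \<ominus>\<^bsub>U\<^esub> cls g"
proof -
  interpret U: ring U by (rule ring_U)
  have "cls f \<ominus>\<^bsub>U\<^esub> cls g = (cls (f - g) \<oplus>\<^bsub>U\<^esub> cls g) \<ominus>\<^bsub>U\<^esub> cls g" by (simp flip: cls_add)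
  also have "\<dots> = cls (f - g)" by (simp add: U.minus_eq U.a_assoc U.r_neg cls_carrier)
  finally show ?thesis by simp
qed

lemma cls_surj: "u \<in> carrier U \<Longrightarrow> \<exists>f\<in>carrier FA. u = cls f"
  unfolding enveloping_def FactRing_def A_RCOSETS_def' env_class_def
  by (auto simp: carrier_free_algebra)

lemma cls_letter: "X \<in> L \<Longrightarrow> cls (letter X) = env_gen L X"
  by (simp add: env_class_def env_gen_def restrict_letters_letter)

lemma cls_scalar: "cls (scalar c) = env_scalar L c"
  by (simp add: env_class_def env_scalar_def)

lemma cls_pow: "cls (f ^ n) = cls f [^]\<^bsub>U\<^esub> n"
proof -
  interpret U: ring U by (rule ring_U)
  show ?thesis by (induction n) (simp_all add: cls_1 cls_mult power_commutes[symmetric] cls_carrier)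
qed

lemma cls_sum: "finite A \<Longrightarrow> cls (\<Sum>a\<in>A. f a) = (\<Oplus>\<^bsub>U\<^esub>a\<in>A. cls (f a))"
proof -
  interpret U: ring U by (rule ring_U)
  show "finite A \<Longrightarrow> cls (\<Sum>a\<in>A. f a) = (\<Oplus>\<^bsub>U\<^esub>a\<in>A. cls (f a))"
    by (induction A rule: finite_induct) (simp_all add: cls_0 cls_add cls_carrier)
qed

definition env_null :: "('a mat free_monoid \<Rightarrow>\<^sub>0 'a) set" where
  "env_null = {f. cls f = \<zero>\<^bsub>U\<^esub>}"

text \<open>Ideals of the enveloping algebra correspond to ideals of the free algebra on all matrices.\<close>

definition env_preimage :: "('a mat free_monoid \<Rightarrow>\<^sub>0 'a) set set \<Rightarrow> ('a mat free_monoid \<Rightarrow>\<^sub>0 'a) set" where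
  "env_preimage J = {f. cls f \<in> J}"

lemma env_preimage_ideal:
  assumes J: "ideal J U"
  shows "r \<in> env_preimage J \<Longrightarrow> s \<in> env_preimage J \<Longrightarrow> r + s \<in> env_preimage J"
    "r \<in> env_preimage J \<Longrightarrow> t * r \<in> env_preimage J" "r \<in> env_preimage J \<Longrightarrow> r * t \<in> env_preimage J"
    "env_null \<subseteq> env_preimage J"
proof -
  interpret ideal J U by (rule J)
  show "r \<in> env_preimage J \<Longrightarrow> s \<in> env_preimage J \<Longrightarrow> r + s \<in> env_preimage J"
    "r \<in> env_preimage J \<Longrightarrow> t * r \<in> env_preimage J" "r \<in> env_preimage J \<Longrightarrow> r * t \<in> env_preimage J"
    by (simp_all add: env_preimage_def cls_add cls_mult cls_carrier I_l_closed I_r_closed)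
  show "env_null \<subseteq> env_preimage J" by (auto simp: env_preimage_def env_null_def)
qed

lemma env_null_ideal:
  shows "r \<in> env_null \<Longrightarrow> s \<in> env_null \<Longrightarrow> r + s \<in> env_null"
    "r \<in> env_null \<Longrightarrow> t * r \<in> env_null" "r \<in> env_null \<Longrightarrow> r * t \<in> env_null"
proof -
  interpret U: ring U by (rule ring_U)
  show "r \<in> env_null \<Longrightarrow> s \<in> env_null \<Longrightarrow> r + s \<in> env_null"
    "r \<in> env_null \<Longrightarrow> t * r \<in> env_null" "r \<in> env_null \<Longrightarrow> r * t \<in> env_null"
    by (simp_all add: env_null_def cls_add cls_mult cls_carrier)
qed

lemma relation_null: "r \<in> enveloping_relations L \<Longrightarrow> r \<in> env_null"
proof -
  assume r: "r \<in> enveloping_relations L"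
  then have "r \<in> E" unfolding enveloping_ideal_def
    using ring.genideal_self[OF ring_free_algebra relations_carrier] by blast
  moreover have "restrict_letters L r = r" using r relations_carrier by (auto simp: carrier_free_algebra)
  ultimately show ?thesis by (simp add: env_null_def cls_eq_zero_iff)
qed

lemma letter_add_null: "X \<in> L \<Longrightarrow> Y \<in> L \<Longrightarrow> letter (X + Y) - (letter X + letter Y) \<in> env_null"
  by (rule relation_null) (unfold enveloping_relations_def, blast)

lemma letter_smult_null: "X \<in> L \<Longrightarrow> letter (c \<cdot>\<^sub>m X) - scalar c * letter X \<in> env_null"
  by (rule relation_null) (unfold enveloping_relations_def, blast)

lemma letter_commutator_null:
  "X \<in> L \<Longrightarrow> Y \<in> L \<Longrightarrow> letter X * letter Y - letter Y * letter X - letter (X * Y - Y * X) \<in> env_null"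
  by (rule relation_null) (unfold enveloping_relations_def, blast)

lemma letter_outside_null: "X \<notin> L \<Longrightarrow> letter X \<in> env_null"
  using cls_0 by (simp add: env_null_def env_class_def restrict_letters_letter)

lemma env_null_0: "0 \<in> env_null"
  by (simp add: env_null_def cls_0)

lemma env_null_minus: "r \<in> env_null \<Longrightarrow> - r \<in> env_null"
  using env_null_ideal(2)[of r "- 1"] by simp

lemma env_null_diff: "r \<in> env_null \<Longrightarrow> s \<in> env_null \<Longrightarrow> r - s \<in> env_null"
  using env_null_ideal(1)[OF _ env_null_minus, of r s] by simp

lemma env_null_trans: "r - s \<in> env_null \<Longrightarrow> s - t \<in> env_null \<Longrightarrow> r - t \<in> env_null"
  using env_null_ideal(1)[of "r - s" "s - t"] by simp

lemma letter_linear_null: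
  assumes "X \<in> L" "Y \<in> L"
  shows "letter (c \<cdot>\<^sub>m X + d \<cdot>\<^sub>m Y) - (scalar c * letter X + scalar d * letter Y) \<in> env_null"
proof -
  have "letter (c \<cdot>\<^sub>m X + d \<cdot>\<^sub>m Y) - (scalar c * letter X + scalar d * letter Y) =
      (letter (c \<cdot>\<^sub>m X + d \<cdot>\<^sub>m Y) - (letter (c \<cdot>\<^sub>m X) + letter (d \<cdot>\<^sub>m Y)))
      + ((letter (c \<cdot>\<^sub>m X) - scalar c * letter X) + (letter (d \<cdot>\<^sub>m Y) - scalar d * letter Y))"
    by simp
  also have "\<dots> \<in> env_null"
    by (rule env_null_ideal(1)[OF letter_add_null[OF L_smult[OF assms(1)] L_smult[OF assms(2)]]
          env_null_ideal(1)[OF letter_smult_null[OF assms(1)] letter_smult_null[OF assms(2)]]])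
  finally show ?thesis .
qed

end

section \<open>Matrices of trace zero\<close>

lemma mat_carrier_eqI:
  assumes "A \<in> carrier_mat k k" "B \<in> carrier_mat k k" "\<And>r s. r < k \<Longrightarrow> s < k \<Longrightarrow> A $$ (r, s) = B $$ (r, s)"
  shows "A = B"
  using assms by (intro eq_matI) auto

lemma sl_carrier: "X \<in> sl k \<Longrightarrow> X \<in> carrier_mat k k"
  by (simp add: sl_def)

lemma sl_add: "X \<in> sl k \<Longrightarrow> Y \<in> sl k \<Longrightarrow> X + Y \<in> sl k"
  by (auto simp: sl_def sum.distrib)

lemma sl_smult: "X \<in> sl k \<Longrightarrow> c \<cdot>\<^sub>m X \<in> sl k"
  by (auto simp: sl_def sum_distrib_left[symmetric])

lemma mult_index:
  assumes "A \<in> carrier_mat k k" "B \<in> carrier_mat k k" "r < k" "s < k"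
  shows "(A * B) $$ (r, s) = (\<Sum>t<k. A $$ (r, t) * B $$ (t, s))"
  using assms by (simp add: scalar_prod_def atLeast0LessThan)

lemma commutator_sl:
  assumes A: "A \<in> carrier_mat k k" and B: "B \<in> carrier_mat k k"
  shows "A * B - B * A \<in> sl k"
proof -
  have "(\<Sum>i<k. (A * B) $$ (i, i)) = (\<Sum>i<k. \<Sum>t<k. A $$ (i, t) * B $$ (t, i))"
    using mult_index[OF A B] by simp
  also have "\<dots> = (\<Sum>t<k. \<Sum>i<k. B $$ (t, i) * A $$ (i, t))"
    by (subst sum.swap) (simp add: mult.commute)
  also have "\<dots> = (\<Sum>i<k. (B * A) $$ (i, i))"
    using mult_index[OF B A] by simp
  finally have tr: "(\<Sum>i<k. (A * B) $$ (i, i)) = (\<Sum>i<k. (B * A) $$ (i, i))" .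
  have BA: "B * A \<in> carrier_mat k k" using A B by simp
  have "(\<Sum>i<k. (A * B - B * A) $$ (i, i)) = (\<Sum>i<k. (A * B) $$ (i, i) - (B * A) $$ (i, i))"
    using carrier_matD[OF BA] by (intro sum.cong refl index_minus_mat) auto
  then show ?thesis using BA tr by (simp only: sl_def mem_Collect_eq minus_carrier_mat sum_subtractf) simp
qed

lemma ad_sl: "A \<in> carrier_mat k k \<Longrightarrow> B \<in> carrier_mat k k \<Longrightarrow> ad A B \<in> sl k"
  unfolding ad_def by (rule commutator_sl)

lemma mat_unit_carrier [simp]: "mat_unit k i j \<in> carrier_mat k k"
  by (simp add: mat_unit_def)

lemma mat_unit_index: "r < k \<Longrightarrow> s < k \<Longrightarrow> mat_unit k i j $$ (r, s) = of_bool (Suc r = i \<and> Suc s = j)"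
  by (simp add: mat_unit_def)

lemma mat_unit_dim [simp]: "dim_row (mat_unit k i j) = k" "dim_col (mat_unit k i j) = k"
  by (simp_all add: mat_unit_def)

lemma mat_unit_sl: "i \<noteq> j \<Longrightarrow> mat_unit k i j \<in> sl k"
proof -
  assume "i \<noteq> j"
  then have "mat_unit k i j $$ (r, r) = 0" if "r < k" for r using that by (auto simp: mat_unit_index)
  then show ?thesis by (auto simp: sl_def intro!: sum.neutral)
qed

lemma sum_of_bool_Suc: "i \<in> {1..k} \<Longrightarrow> (\<Sum>t<k. of_bool (Suc t = i) * f t) = (f (i - 1) :: 'a::semiring_1)"
proof -
  assume i: "i \<in> {1..k}"
  have "(\<Sum>t<k. of_bool (Suc t = i) * f t) = (\<Sum>t<k. if t = i - 1 then f t else 0)"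
    using i by (intro sum.cong refl) auto
  also have "\<dots> = f (i - 1)"
  proof -
    have "i - 1 \<in> {..<k}" using i by auto
    then show ?thesis by (simp only: sum.delta finite_lessThan if_True)
  qed
  finally show ?thesis .
qed

lemma mat_unit_diff_sl:
  assumes "i \<in> {1..k}" "j \<in> {1..k}"
  shows "mat_unit k i i - mat_unit k j j \<in> (sl k :: 'a::field mat set)"
proof -
  have "(mat_unit k i i - mat_unit k j j) $$ (r, r) = of_bool (Suc r = i) * 1 - (of_bool (Suc r = j) * 1 :: 'a)"
    if "r < k" for r using that by (simp add: mat_unit_index)
  then have "(\<Sum>r<k. (mat_unit k i i - mat_unit k j j) $$ (r, r)) =
      (\<Sum>r<k. of_bool (Suc r = i) * 1) - (\<Sum>r<k. of_bool (Suc r = j) * (1::'a))"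
    by (simp only: sum_subtractf[symmetric]) (intro sum.cong refl, simp)
  also have "\<dots> = 0" unfolding sum_of_bool_Suc[OF assms(1)] sum_of_bool_Suc[OF assms(2)] by simp
  finally show ?thesis by (simp add: sl_def minus_carrier_mat)
qed

lemma cartan_carrier [simp]: "cartan k l \<in> carrier_mat k k"
  by (simp add: cartan_def minus_carrier_mat)

lemma cartan_index: "r < k \<Longrightarrow> s < k \<Longrightarrow>
  cartan k l $$ (r, s) = of_bool (r = s) * (of_bool (l = Suc r) - of_bool (l = r))"
  by (auto simp: cartan_def mat_unit_index)

lemma cartan_dim [simp]: "dim_row (cartan k l) = k" "dim_col (cartan k l) = k"
  by (simp_all add: cartan_def)

lemma finsum_module_mat:
  fixes f :: "'b \<Rightarrow> 'a::field mat"
  assumes "finite A" "\<And>a. a \<in> A \<Longrightarrow> f a \<in> carrier_mat n n"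
  shows "finsum (module_mat TYPE('a) n n) f A \<in> carrier_mat n n \<and>
    (\<forall>r<n. \<forall>s<n. finsum (module_mat TYPE('a) n n) f A $$ (r, s) = (\<Sum>a\<in>A. f a $$ (r, s)))"
  using assms
proof (induction A rule: finite_induct)
  case empty
  interpret abelian_group "module_mat TYPE('a) n n" by (rule abelian_group_mat)
  show ?case by (simp add: module_mat_simps)
next
  case (insert a A)
  interpret abelian_group "module_mat TYPE('a) n n" by (rule abelian_group_mat)
  have f: "f a \<in> carrier_mat n n" and A: "f \<in> A \<rightarrow> carrier (module_mat TYPE('a) n n)"
    using insert.prems by (auto simp: module_mat_simps)
  have "finsum (module_mat TYPE('a) n n) f (insert a A) = f a + finsum (module_mat TYPE('a) n n) f A"
    using finsum_insert[OF insert.hyps(1,2) A] f by (simp add: module_mat_simps)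
  then show ?case using insert f by auto
qed

lemma casimir_entry_carrier [simp]: "casimir_entry k i j \<in> (carrier_mat k k :: 'a::field mat set)"
proof (cases "i = j")
  case True
  have "(\<Oplus>\<^bsub>module_mat TYPE('a) k k\<^esub>l\<in>{1..k-1}. casimir_coeff k i l \<cdot>\<^sub>m cartan k l) \<in> carrier_mat k k"
    by (intro finsum_module_mat[THEN conjunct1]) simp_all
  then show ?thesis using True by (simp add: casimir_entry_def)
qed (simp add: casimir_entry_def)

lemma casimir_entry_dim [simp]: "dim_row (casimir_entry k i j) = k" "dim_col (casimir_entry k i j) = k"
  using casimir_entry_carrier carrier_matD by blast+

lemma casimir_entry_index:
  assumes ij: "i \<in> {1..k}" "j \<in> {1..k}" and rs: "r < k" "s < k"
  shows "casimir_entry k i j $$ (r, s) =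
    of_bool (Suc r = i) * of_bool (Suc s = j) - (of_bool (i = j) / of_nat k * of_bool (r = s) :: 'a::field_char_0)"
proof (cases "i = j")
  case False
  then show ?thesis using rs by (simp add: casimir_entry_def mat_unit_index)
next
  case True
  let ?S = "\<Oplus>\<^bsub>module_mat TYPE('a) k k\<^esub>l\<in>{1..k-1}. casimir_coeff k i l \<cdot>\<^sub>m cartan k l"
  let ?c = "\<lambda>l. casimir_coeff k i l :: 'a"
  have S: "?S \<in> carrier_mat k k" "?S $$ (r, s) = (\<Sum>l\<in>{1..k-1}. (?c l \<cdot>\<^sub>m cartan k l) $$ (r, s))"
    using finsum_module_mat[of "{1..k-1}" "\<lambda>l. ?c l \<cdot>\<^sub>m cartan k l" k] rs by auto
  have k0: "(of_nat k :: 'a) \<noteq> 0" using rs by simp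
  have "?S $$ (r, s) = (\<Sum>l\<in>{1..k-1}. of_bool (r = s) * ((if l = Suc r then ?c l else 0) - (if l = r then ?c l else 0)))"
    unfolding S(2) using rs by (intro sum.cong refl) (auto simp: cartan_index)
  also have "\<dots> = of_bool (r = s) * ((if Suc r \<le> k - 1 then ?c (Suc r) else 0) - (if 1 \<le> r then ?c r else 0))"
    unfolding sum_distrib_left[symmetric] sum_subtractf using rs by auto
  also have "\<dots> = of_bool (r = s) * (?c (Suc r) - ?c r)"
  proof -
    have "(if Suc r \<le> k - 1 then ?c (Suc r) else 0) = ?c (Suc r)"
    proof (cases "Suc r = k")
      case True
      then show ?thesis using ij(1) by (auto simp: casimir_coeff_def)
    qed (use rs in auto)
    moreover have "(if 1 \<le> r then ?c r else 0) = ?c r" using ij(1) by (cases r) (auto simp: casimir_coeff_def)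
    ultimately show ?thesis by simp
  qed
  also have "\<dots> = of_bool (r = s) * (of_nat k * of_bool (Suc r = i) - 1)"
    using ij(1) rs by (auto simp: casimir_coeff_def of_nat_Suc algebra_simps le_Suc_eq)
  finally have "casimir_entry k i j $$ (r, s) = (1 / of_nat k :: 'a) * (of_bool (r = s) * (of_nat k * of_bool (Suc r = i) - 1))"
    using True S(1) rs by (simp add: casimir_entry_def)
  then show ?thesis using True k0 by (auto simp: field_simps)
qed

lemma casimir_entry_sl:
  assumes "i \<in> {1..k}" "j \<in> {1..k}"
  shows "casimir_entry k i j \<in> (sl k :: 'a::field_char_0 mat set)"
proof -
  have k0: "(of_nat k :: 'a) \<noteq> 0" using assms by auto
  have "(\<Sum>r<k. casimir_entry k i j $$ (r, r)) =
      (\<Sum>r<k. of_bool (Suc r = i) * of_bool (Suc r = j)) - (\<Sum>r<k. of_bool (i = j) / of_nat k :: 'a)"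
    using assms unfolding sum_subtractf[symmetric] by (intro sum.cong refl) (simp add: casimir_entry_index)
  also have "(\<Sum>r<k. of_bool (Suc r = i) * of_bool (Suc r = j)) = (of_bool (Suc (i - 1) = j) :: 'a)"
    by (rule sum_of_bool_Suc[OF assms(1)])
  also have "\<dots> - (\<Sum>r<k. of_bool (i = j) / of_nat k) = 0" using assms k0 by (auto simp: of_bool_def)
  finally show ?thesis by (simp add: sl_def)
qed

lemma casimir_entry_offdiag: "i \<noteq> j \<Longrightarrow> casimir_entry k i j = mat_unit k i j"
  by (simp add: casimir_entry_def)

lemma ad_casimir_entry_index:
  assumes ij: "i \<in> {1..k}" "j \<in> {1..k}" and A: "A \<in> carrier_mat k k" and rs: "r < k" "s < k"
  shows "ad (casimir_entry k i j) A $$ (r, s) =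
    of_bool (Suc r = i) * A $$ (j - 1, s) - A $$ (r, i - 1) * (of_bool (Suc s = j) :: 'a::field_char_0)"
proof -
  let ?c = "of_bool (i = j) / of_nat k :: 'a"
  have delta: "(\<Sum>t<k. of_bool (r = t) * f t) = f r" "(\<Sum>t<k. f t * of_bool (t = s)) = f s" for f :: "nat \<Rightarrow> 'a"
  proof -
    have "(\<Sum>t<k. of_bool (r = t) * f t) = (\<Sum>t<k. if t = r then f t else 0)"
      by (intro sum.cong refl) auto
    then show "(\<Sum>t<k. of_bool (r = t) * f t) = f r" using rs by simp
    have "(\<Sum>t<k. f t * of_bool (t = s)) = (\<Sum>t<k. if t = s then f t else 0)"
      by (intro sum.cong refl) auto
    then show "(\<Sum>t<k. f t * of_bool (t = s)) = f s" using rs by simp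
  qed
  have "(casimir_entry k i j * A) $$ (r, s) =
      (\<Sum>t<k. of_bool (Suc t = j) * (of_bool (Suc r = i) * A $$ (t, s)) - of_bool (r = t) * (?c * A $$ (t, s)))"
    unfolding mult_index[OF casimir_entry_carrier A rs]
    using ij rs by (intro sum.cong refl) (simp add: casimir_entry_index algebra_simps)
  then have 1: "(casimir_entry k i j * A) $$ (r, s) = of_bool (Suc r = i) * A $$ (j - 1, s) - ?c * A $$ (r, s)"
    using sum_of_bool_Suc[OF ij(2), of "\<lambda>t. of_bool (Suc r = i) * A $$ (t, s)"] delta(1) by (simp only: sum_subtractf)
  have "(A * casimir_entry k i j) $$ (r, s) =
      (\<Sum>t<k. of_bool (Suc t = i) * (A $$ (r, t) * of_bool (Suc s = j)) - (A $$ (r, t) * ?c) * of_bool (t = s))"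
    unfolding mult_index[OF A casimir_entry_carrier rs]
    using ij rs by (intro sum.cong refl) (simp add: casimir_entry_index algebra_simps)
  then have 2: "(A * casimir_entry k i j) $$ (r, s) = A $$ (r, i - 1) * of_bool (Suc s = j) - A $$ (r, s) * ?c"
    using sum_of_bool_Suc[OF ij(1), of "\<lambda>t. A $$ (r, t) * of_bool (Suc s = j)"] delta(2) by (simp only: sum_subtractf)
  show ?thesis
    unfolding ad_def using A rs carrier_matD[OF A] by (subst index_minus_mat) (simp_all del: index_mult_mat(1) add: 1 2 mult.commute)
qed

lemma casimir_entry_commutator:
  assumes "a \<in> {1..k}" "b \<in> {1..k}" "i \<in> {1..k}" "j \<in> {1..k}"
  shows "ad (casimir_entry k a b) (casimir_entry k i j) =
    of_bool (b = i) \<cdot>\<^sub>m casimir_entry k a j + (- of_bool (a = j)) \<cdot>\<^sub>m (casimir_entry k i b :: 'a::field_char_0 mat)"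
proof (rule mat_carrier_eqI)
  show "ad (casimir_entry k a b) (casimir_entry k i j) \<in> (carrier_mat k k :: 'a mat set)"
    by (rule sl_carrier[OF ad_sl]) simp_all
  fix r s assume rs: "r < k" "s < k"
  have idx: "Suc (b - 1) = b" "b - 1 < k" "Suc (a - 1) = a" "a - 1 < k" using assms by auto
  have eqs: "b - 1 = s \<longleftrightarrow> Suc s = b" "r = a - 1 \<longleftrightarrow> Suc r = a" using assms by auto
  have "ad (casimir_entry k a b) (casimir_entry k i j) $$ (r, s) =
      of_bool (Suc r = a) * (of_bool (b = i) * of_bool (Suc s = j) - (of_bool (i = j) / of_nat k * of_bool (Suc s = b) :: 'a))
      - (of_bool (Suc r = i) * of_bool (a = j) - of_bool (i = j) / of_nat k * of_bool (Suc r = a)) * of_bool (Suc s = b)"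
    unfolding ad_casimir_entry_index[OF assms(1,2) casimir_entry_carrier rs]
    using assms idx rs by (simp add: casimir_entry_index eqs)
  also have "\<dots> = of_bool (b = i) * (casimir_entry k a j $$ (r, s)) + (- of_bool (a = j)) * casimir_entry k i b $$ (r, s)"
    using assms rs by (auto simp: casimir_entry_index)
  finally show "ad (casimir_entry k a b) (casimir_entry k i j) $$ (r, s) =
      (of_bool (b = i) \<cdot>\<^sub>m casimir_entry k a j + (- of_bool (a = j)) \<cdot>\<^sub>m (casimir_entry k i b :: 'a mat)) $$ (r, s)"
    using rs by simp
qed simp

text \<open>For a set \<open>S\<close> of positions other than the last diagonal one, \<open>M S\<close> keeps the entries of \<open>X\<close> in \<open>S\<close> and
restores trace 0 by the last diagonal entry. Adding one position to \<open>S\<close> adds a multiple of one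
basis matrix.\<close>

lemma sl_induct [consumes 2, case_names add smult unit diag]:
  fixes X :: "'a::field mat"
  assumes X: "X \<in> sl k" and k: "2 \<le> k"
    and add: "\<And>X Y. X \<in> sl k \<Longrightarrow> Y \<in> sl k \<Longrightarrow> Q X \<Longrightarrow> Q Y \<Longrightarrow> Q (X + Y)"
    and smult: "\<And>c X. X \<in> sl k \<Longrightarrow> Q X \<Longrightarrow> Q (c \<cdot>\<^sub>m X)"
    and unit: "\<And>i j. i \<in> {1..k} \<Longrightarrow> j \<in> {1..k} \<Longrightarrow> i \<noteq> j \<Longrightarrow> Q (mat_unit k i j)"
    and diag: "\<And>i. i \<in> {1..<k} \<Longrightarrow> Q (mat_unit k i i - mat_unit k k k)"
  shows "Q X"
proof -
  define M where "M S = mat k k (\<lambda>(r, s). if r = s \<and> r = k - 1 then - (\<Sum>t\<in>{t. t < k - 1 \<and> (t, t) \<in> S}. X $$ (t, t))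
      else if (r, s) \<in> S then X $$ (r, s) else 0)" for S
  have M_sl: "M S \<in> sl k" for S
  proof -
    have "(\<Sum>r<k. M S $$ (r, r)) = (\<Sum>r<k - 1. if (r, r) \<in> S then X $$ (r, r) else 0) + M S $$ (k - 1, k - 1)"
      using k lessThan_Suc[of "k - 1"] by (simp add: M_def add.commute)
    also have "(\<Sum>r<k - 1. if (r, r) \<in> S then X $$ (r, r) else 0) = (\<Sum>t\<in>{t. t < k - 1 \<and> (t, t) \<in> S}. X $$ (t, t))"
      by (simp add: sum.inter_filter[symmetric] lessThan_def)
    also have "\<dots> + M S $$ (k - 1, k - 1) = 0" using k by (simp add: M_def)
    finally show ?thesis by (simp add: sl_def M_def)
  qed
  have "Q (M S)" if "finite S" "S \<subseteq> {..<k} \<times> {..<k} - {(k - 1, k - 1)}" for S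
    using that
  proof (induction S rule: finite_induct)
    case empty
    have "M {} = 0 \<cdot>\<^sub>m mat_unit k 1 2" by (rule eq_matI) (auto simp: M_def mat_unit_def)
    then show ?case using smult[OF mat_unit_sl unit] k by simp
  next
    case (insert p S)
    obtain r s where p: "p = (r, s)" by (cases p)
    define B where "B = (if r = s then mat_unit k (Suc r) (Suc r) - mat_unit k k k else mat_unit k (Suc r) (Suc s) :: 'a mat)"
    have rs: "r < k" "s < k" "r = s \<Longrightarrow> r < k - 1" using insert.prems p by (cases "r = s"; force)+
    have B: "Q B" "B \<in> carrier_mat k k"
      using rs unit diag by (auto simp: B_def minus_carrier_mat)
    have "mat_unit k (Suc r) (Suc r) - mat_unit k k k \<in> (sl k :: 'a mat set)" if "r = s"
      using rs that k by (intro mat_unit_diff_sl) auto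
    then have B_sl: "B \<in> sl k" using mat_unit_sl[of "Suc r" "Suc s" k] by (auto simp: B_def)
    have "M (insert p S) = M S + X $$ (r, s) \<cdot>\<^sub>m B"
    proof (rule mat_carrier_eqI)
      fix u v assume uv: "u < k" "v < k"
      have fin: "finite {t. t < k - 1 \<and> (t, t) \<in> S}" by simp
      have ins: "{t. t < k - 1 \<and> (t, t) \<in> insert p S} =
          (if r = s then insert r {t. t < k - 1 \<and> (t, t) \<in> S} else {t. t < k - 1 \<and> (t, t) \<in> S})"
        using rs p by auto
      show "M (insert p S) $$ (u, v) = (M S + X $$ (r, s) \<cdot>\<^sub>m B) $$ (u, v)"
      proof (cases "u = v \<and> u = k - 1")
        case True
        then have "M (insert p S) $$ (u, v) = - (\<Sum>t\<in>{t. t < k - 1 \<and> (t, t) \<in> insert p S}. X $$ (t, t))"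
          using uv by (simp add: M_def)
        also have "\<dots> = M S $$ (u, v) + X $$ (r, s) * B $$ (u, v)"
          using True uv rs k insert.hyps(2) p fin unfolding ins by (auto simp: M_def B_def mat_unit_index)
        finally show ?thesis using uv B(2) by simp
      next
        case False
        then have "M (insert p S) $$ (u, v) = (if (u, v) \<in> insert p S then X $$ (u, v) else 0)"
          using uv by (auto simp: M_def)
        also have "\<dots> = M S $$ (u, v) + X $$ (r, s) * B $$ (u, v)"
          using False uv rs k insert.hyps(2) p by (auto simp: M_def B_def mat_unit_index)
        finally show ?thesis using uv B(2) by simp
      qed
    qed (use B(2) in \<open>simp_all add: M_def\<close>)
    then show ?case using insert B(1) B_sl add[OF M_sl sl_smult[OF B_sl]] smult[OF B_sl] by simp
  qed
  from this[of "{..<k} \<times> {..<k} - {(k - 1, k - 1)}"]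
  have "Q (M ({..<k} \<times> {..<k} - {(k - 1, k - 1)}))" by simp
  also have "M ({..<k} \<times> {..<k} - {(k - 1, k - 1)}) = X"
  proof (rule eq_matI)
    have "(\<Sum>t<k. X $$ (t, t)) = (\<Sum>t<k - 1. X $$ (t, t)) + X $$ (k - 1, k - 1)"
      using k lessThan_Suc[of "k - 1"] by (simp add: add.commute)
    moreover have "{t. t < k - 1 \<and> (t, t) \<in> {..<k} \<times> {..<k} - {(k - 1, k - 1)}} = {..<k - 1}"
      by auto
    ultimately have last: "- (\<Sum>t\<in>{t. t < k - 1 \<and> (t, t) \<in> {..<k} \<times> {..<k} - {(k - 1, k - 1)}}. X $$ (t, t)) = X $$ (k - 1, k - 1)"
      using X by (simp add: sl_def eq_neg_iff_add_eq_0 neg_eq_iff_add_eq_0)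
    fix u v assume "u < dim_row X" "v < dim_col X"
    then have "u < k" "v < k" using sl_carrier[OF X] by auto
    then show "M ({..<k} \<times> {..<k} - {(k - 1, k - 1)}) $$ (u, v) = X $$ (u, v)"
      unfolding M_def by (auto simp only: index_mat case_prod_conv last split: if_splits)
  qed (use sl_carrier[OF X] in \<open>simp_all add: M_def\<close>)
  finally show ?thesis .
qed

text \<open>\<open>L\<close> is simple: a property inherited by linear combinations and
commutators passes from one matrix unit to all of \<open>L\<close>. From \<open>e\<^sub>a\<^sub>b\<close> one obtains \<open>h = e\<^sub>a\<^sub>a - e\<^sub>b\<^sub>b\<close>, then
each \<open>e\<^sub>i\<^sub>j\<close> that shares an index with it as an eigenvector of \<open>h\<close>, and then the other ones.\<close>

lemma lie_ideal_sl:
  fixes Q :: "'a::field_char_0 mat \<Rightarrow> bool"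
  assumes k: "2 \<le> k"
    and add: "\<And>X Y. X \<in> sl k \<Longrightarrow> Y \<in> sl k \<Longrightarrow> Q X \<Longrightarrow> Q Y \<Longrightarrow> Q (X + Y)"
    and smult: "\<And>c X. X \<in> sl k \<Longrightarrow> Q X \<Longrightarrow> Q (c \<cdot>\<^sub>m X)"
    and ad: "\<And>X Y. X \<in> sl k \<Longrightarrow> Y \<in> sl k \<Longrightarrow> Q Y \<Longrightarrow> Q (ad X Y)"
    and ab: "a \<in> {1..k}" "b \<in> {1..k}" "a \<noteq> b" and start: "Q (mat_unit k a b)"
    and X: "X \<in> sl k"
  shows "Q X"
proof -
  let ?e = "mat_unit k :: nat \<Rightarrow> nat \<Rightarrow> 'a mat"
  have ad_unit: "ad (?e i j) (?e l m) = of_bool (j = l) \<cdot>\<^sub>m ?e i m - of_bool (m = i) \<cdot>\<^sub>m ?e l j"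
    if "i \<in> {1..k}" "j \<in> {1..k}" "i \<noteq> j" for i j l m
  proof (rule mat_carrier_eqI)
    show "ad (?e i j) (?e l m) \<in> carrier_mat k k" by (rule sl_carrier[OF ad_sl]) simp_all
    fix r s assume rs: "r < k" "s < k"
    have "i - 1 < k" "j - 1 < k" "Suc (i - 1) = i" "Suc (j - 1) = j" using that by auto
    then show "ad (?e i j) (?e l m) $$ (r, s) = (of_bool (j = l) \<cdot>\<^sub>m ?e i m - of_bool (m = i) \<cdot>\<^sub>m ?e l j) $$ (r, s)"
      using ad_casimir_entry_index[OF that(1,2) mat_unit_carrier rs, of l m] rs that
      by (auto simp: casimir_entry_offdiag mat_unit_index)
  qed (simp add: minus_carrier_mat)
  define h where "h = ?e a a - ?e b b"
  have h_eq: "h = (- 1) \<cdot>\<^sub>m ad (?e b a) (?e a b)"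
    using ad_unit[OF ab(2,1), of a b] ab(3) by (intro eq_matI) (auto simp: h_def mat_unit_def)
  have h: "Q h" "h \<in> sl k"
  proof -
    have "ad (?e b a) (?e a b) \<in> sl k" "Q (ad (?e b a) (?e a b))"
      using ab start by (auto intro!: ad_sl ad mat_unit_sl)
    then show "Q h" "h \<in> sl k" unfolding h_eq by (auto intro: smult sl_smult)
  qed
  have root: "Q (?e i j)" if ij: "i \<in> {1..k}" "j \<in> {1..k}" "i \<noteq> j" "{i, j} \<inter> {a, b} \<noteq> {}" for i j
  proof -
    define c :: 'a where "c = of_bool (j = a) - of_bool (j = b) - (of_bool (i = a) - of_bool (i = b))"
    have "c \<noteq> 0" using ij ab by (auto simp: c_def)
    have "ad (?e i j) h = c \<cdot>\<^sub>m ?e i j"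
    proof (rule mat_carrier_eqI)
      have hc: "h \<in> carrier_mat k k" using sl_carrier[OF h(2)] .
      then show "ad (?e i j) h \<in> carrier_mat k k" by (intro sl_carrier[OF ad_sl]) simp_all
      fix r s assume rs: "r < k" "s < k"
      have hi: "h $$ (u, v) = of_bool (u = v) * (of_bool (Suc u = a) - of_bool (Suc u = b))" if "u < k" "v < k" for u v
        using that by (auto simp: h_def mat_unit_def)
      have "i - 1 < k" "j - 1 < k" "Suc (i - 1) = i" "Suc (j - 1) = j" using ij by auto
      then show "ad (?e i j) h $$ (r, s) = (c \<cdot>\<^sub>m ?e i j) $$ (r, s)"
        using ad_casimir_entry_index[OF ij(1,2) hc rs] rs ij
        by (auto simp: casimir_entry_offdiag mat_unit_index hi c_def)
    qed simp
    then have "Q (c \<cdot>\<^sub>m ?e i j)" using ad[OF mat_unit_sl h(2,1), of i j] ij by simp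
    then have "Q (inverse c \<cdot>\<^sub>m (c \<cdot>\<^sub>m ?e i j))" by (rule smult[OF sl_smult[OF mat_unit_sl[OF ij(3)]]])
    also have "inverse c \<cdot>\<^sub>m (c \<cdot>\<^sub>m ?e i j) = ?e i j"
      using \<open>c \<noteq> 0\<close> by (intro eq_matI) (auto simp: mat_unit_def)
    finally show ?thesis .
  qed
  have unit: "Q (?e i j)" if ij: "i \<in> {1..k}" "j \<in> {1..k}" "i \<noteq> j" for i j
  proof (cases "{i, j} \<inter> {a, b} = {}")
    case True
    then have "Q (?e a j)" using root[of a j] ij ab by auto
    then have "Q (ad (?e i a) (?e a j))" using True by (intro ad mat_unit_sl) auto
    also have "ad (?e i a) (?e a j) = ?e i j"
      using ad_unit[of i a a j] True ij ab by (auto intro!: eq_matI simp: mat_unit_def)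
    finally show ?thesis .
  qed (use root ij in auto)
  show ?thesis
    using X k
  proof (induction rule: sl_induct)
    case (diag i)
    then have ik: "i \<in> {1..k}" "k \<in> {1..k}" "i \<noteq> k" using k by auto
    have "Q (ad (?e i k) (?e k i))" using ik by (intro ad mat_unit_sl unit) auto
    also have "ad (?e i k) (?e k i) = ?e i i - ?e k k"
      using ad_unit[OF ik, of k i] by (auto intro!: eq_matI simp: mat_unit_def)
    finally show ?case .
  qed (use add smult unit in auto)
qed

section \<open>The action of the free algebra on matrices\<close>

lemma ad_carrier: "X \<in> carrier_mat k k \<Longrightarrow> A \<in> carrier_mat k k \<Longrightarrow> ad X A \<in> carrier_mat k k"
  by (rule sl_carrier[OF ad_sl])

lemma ad_linear:
  assumes "X \<in> carrier_mat k k" "Y \<in> carrier_mat k k" "A \<in> carrier_mat k k"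
  shows ad_add_right: "ad X (Y + A) = ad X Y + ad X A" and ad_add_left: "ad (X + Y) A = ad X A + ad Y A"
    and ad_smult_right: "ad X (c \<cdot>\<^sub>m A) = c \<cdot>\<^sub>m ad X A" and ad_smult_left: "ad (c \<cdot>\<^sub>m X) A = c \<cdot>\<^sub>m ad X A"
proof -
  note [simp] = minus_carrier_mat carrier_matD[OF assms(1)] carrier_matD[OF assms(2)] carrier_matD[OF assms(3)]
  note [simp del] = index_mult_mat(1)
  show "ad X (Y + A) = ad X Y + ad X A"
    unfolding ad_def mult_add_distrib_mat[OF assms] add_mult_distrib_mat[OF assms(2,3,1)]
    using assms by (intro mat_carrier_eqI[where k = k]) simp_all
  show "ad (X + Y) A = ad X A + ad Y A"
    unfolding ad_def mult_add_distrib_mat[OF assms(3,1,2)] add_mult_distrib_mat[OF assms]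
    using assms by (intro mat_carrier_eqI[where k = k]) simp_all
  show "ad X (c \<cdot>\<^sub>m A) = c \<cdot>\<^sub>m ad X A" "ad (c \<cdot>\<^sub>m X) A = c \<cdot>\<^sub>m ad X A"
    unfolding ad_def mult_smult_distrib[OF assms(1,3)] mult_smult_distrib[OF assms(3,1)]
      mult_smult_assoc_mat[OF assms(1,3)] mult_smult_assoc_mat[OF assms(3,1)]
    using assms by (intro mat_carrier_eqI[where k = k]; simp add: right_diff_distrib)+
qed

lemma ad_commutator:
  assumes X: "X \<in> carrier_mat k k" and Y: "Y \<in> carrier_mat k k" and A: "A \<in> carrier_mat k k"
  shows "ad X (ad Y A) - ad Y (ad X A) = ad (X * Y - Y * X) A"
proof -
  have c: "B * C \<in> carrier_mat k k" if "B \<in> carrier_mat k k" "C \<in> carrier_mat k k" for B C :: "'a mat"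
    using that by simp
  have expand: "ad B (ad C A) = (B * C * A - B * A * C) - (C * A * B - A * C * B)"
    if B: "B \<in> carrier_mat k k" and C: "C \<in> carrier_mat k k" for B C
    unfolding ad_def using B C A
    by (simp add: mult_minus_distrib_mat[OF B c[OF C A] c[OF A C]] minus_mult_distrib_mat[OF c[OF C A] c[OF A C] B])
  have "ad (X * Y - Y * X) A = (X * Y * A - Y * X * A) - (A * X * Y - A * Y * X)"
    unfolding ad_def using X Y A
    by (simp add: mult_minus_distrib_mat[OF A c[OF X Y] c[OF Y X]] minus_mult_distrib_mat[OF c[OF X Y] c[OF Y X] A])
  then show ?thesis
    unfolding expand[OF X Y] expand[OF Y X] using X Y A
    by (intro eq_matI) (simp_all del: index_mult_mat(1))
qed

locale sl_algebra =
  fixes k :: nat and ty :: "'a::field_char_0 itself"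
  assumes k2: "2 \<le> k"
begin

abbreviation L :: "'a mat set" where "L \<equiv> sl k"
abbreviation M :: "'a mat set" where "M \<equiv> carrier_mat k k"
abbreviation x :: "nat \<Rightarrow> nat \<Rightarrow> 'a mat free_monoid \<Rightarrow>\<^sub>0 'a" where "x i j \<equiv> letter (casimir_entry k i j)"

end

sublocale sl_algebra \<subseteq> matrix_lie_algebra "sl k :: 'a mat set"
  by unfold_locales (auto intro: sl_add sl_smult commutator_sl sl_carrier)

context sl_algebra
begin

text \<open>Letting matrices outside \<open>L\<close> act by 0 extends the adjoint action to all words.\<close>

definition rho :: "'a mat \<Rightarrow> 'a mat \<Rightarrow> 'a mat" where
  "rho X A = (if X \<in> L then ad X A else 0\<^sub>m k k)"

definition act :: "('a mat free_monoid \<Rightarrow>\<^sub>0 'a) \<Rightarrow> 'a mat \<Rightarrow> 'a mat" where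
  "act f A = free_action k rho f A"

lemma rho_carrier: "A \<in> M \<Longrightarrow> rho X A \<in> M"
  by (simp add: rho_def ad_carrier sl_carrier)

lemma foldr_rho_carrier: "A \<in> M \<Longrightarrow> foldr rho ws A \<in> M"
  by (induction ws) (simp_all add: rho_carrier)

lemma rho_add: "A \<in> M \<Longrightarrow> B \<in> M \<Longrightarrow> rho X (A + B) = rho X A + rho X B"
  using sl_carrier[of X k] by (auto simp: rho_def ad_add_right[where k = k])

lemma rho_smult: "A \<in> M \<Longrightarrow> rho X (c \<cdot>\<^sub>m A) = c \<cdot>\<^sub>m rho X A"
  using sl_carrier[of X k] by (auto simp: rho_def ad_smult_right[where k = k and Y = X])

lemma foldr_rho_add: "A \<in> M \<Longrightarrow> B \<in> M \<Longrightarrow> foldr rho ws (A + B) = foldr rho ws A + foldr rho ws B"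
  by (induction ws) (simp_all add: rho_add foldr_rho_carrier)

lemma foldr_rho_smult: "A \<in> M \<Longrightarrow> foldr rho ws (c \<cdot>\<^sub>m A) = c \<cdot>\<^sub>m foldr rho ws A"
  by (induction ws) (simp_all add: rho_smult foldr_rho_carrier)

lemma rho_zero: "rho X (0\<^sub>m k k) = 0\<^sub>m k k"
  using sl_carrier[of X k] by (auto simp: rho_def ad_def)

lemma foldr_rho_outside: "\<not> set ws \<subseteq> L \<Longrightarrow> foldr rho ws A = 0\<^sub>m k k"
proof (induction ws)
  case (Cons X ws)
  then show ?case by (cases "X \<in> L") (auto simp: rho_zero, simp add: rho_def)
qed simp

lemma act_carrier [simp]: "act f A \<in> M"
  by (simp add: act_def free_action_def)

lemma act_dim [simp]: "dim_row (act f A) = k" "dim_col (act f A) = k"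
  by (simp_all add: act_def free_action_def)

lemma act_index: "r < k \<Longrightarrow> s < k \<Longrightarrow> act f A $$ (r, s) =
    (\<Sum>w\<in>Poly_Mapping.keys f. Poly_Mapping.lookup f w * foldr rho (letters w) A $$ (r, s))"
  by (simp add: act_def free_action_def)

lemma act_add: "act (f + g) A = act f A + act g A"
proof (rule eq_matI)
  fix r s assume "r < dim_row (act f A + act g A)" "s < dim_col (act f A + act g A)"
  then have rs: "r < k" "s < k" by simp_all
  show "act (f + g) A $$ (r, s) = (act f A + act g A) $$ (r, s)"
    using rs setsum_keys_plus_distrib[of "\<lambda>w c. c * foldr rho (letters w) A $$ (r, s)" f g]
    by (simp add: act_index distrib_right)
qed simp_all

lemma act_single: "A \<in> M \<Longrightarrow> act (Poly_Mapping.single w c) A = c \<cdot>\<^sub>m foldr rho (letters w) A"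
  using foldr_rho_carrier[of A "letters w"]
  by (intro eq_matI) (auto simp: act_index when_def)

lemma act_scalar: "A \<in> M \<Longrightarrow> act (scalar c) A = c \<cdot>\<^sub>m A"
  by (simp add: scalar_def act_single zero_free_monoid_def)

lemma act_letter: "A \<in> M \<Longrightarrow> act (letter X) A = rho X A"
  using rho_carrier[of A X] by (simp add: letter_def act_single) (intro eq_matI, auto)

lemma act_mult:
  assumes A: "A \<in> M"
  shows "act (f * g) A = act f (act g A)"
proof (induction f rule: poly_mapping_induct_single)
  case (single w c)
  show ?case
  proof (induction g rule: poly_mapping_induct_single)
    case (single v d)
    show ?case
      using A foldr_rho_carrier[OF A, of "letters v"] foldr_rho_carrier[OF foldr_rho_carrier[OF A, of "letters v"], of "letters w"]
      by (simp add: mult_single act_single plus_free_monoid_def foldr_rho_smult) (intro eq_matI, auto)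
  next
    case (add g h)
    have "act (Poly_Mapping.single w c) (act g A + act h A) =
        act (Poly_Mapping.single w c) (act g A) + act (Poly_Mapping.single w c) (act h A)"
      using foldr_rho_carrier[of "act g A" "letters w"] foldr_rho_carrier[of "act h A" "letters w"]
      by (simp add: act_single foldr_rho_add) (intro eq_matI, auto simp: distrib_left)
    then show ?case by (simp add: distrib_left act_add add.IH)
  qed
qed (simp add: distrib_right act_add)

lemma act_1: "A \<in> M \<Longrightarrow> act 1 A = A"
  using act_scalar[of A 1] by (auto intro!: eq_matI)

lemma act_smult_right: "A \<in> M \<Longrightarrow> act f (c \<cdot>\<^sub>m A) = c \<cdot>\<^sub>m act f A"
  using act_mult[of A f "scalar c"] act_mult[of A "scalar c" f]
  by (simp add: act_scalar scalar_commute)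

lemma act_add_right: "A \<in> M \<Longrightarrow> B \<in> M \<Longrightarrow> act f (A + B) = act f A + act f B"
proof (induction f rule: poly_mapping_induct_single)
  case (single w c)
  then show ?case
    using foldr_rho_carrier[of A "letters w"] foldr_rho_carrier[of B "letters w"]
    by (simp add: act_single foldr_rho_add) (intro eq_matI, auto simp: distrib_left)
next
  case (add f g)
  then show ?case by (simp add: act_add) (intro eq_matI, auto)
qed

lemma act_zero_right: "act f (0\<^sub>m k k) = 0\<^sub>m k k"
proof -
  have "act f (0\<^sub>m k k) = 0 \<cdot>\<^sub>m act f (0\<^sub>m k k)"
    using act_smult_right[of "0\<^sub>m k k" f 0] by simp
  also have "\<dots> = 0\<^sub>m k k" by (rule eq_matI) simp_all
  finally show ?thesis .
qed

lemma act_zero: "act 0 A = 0\<^sub>m k k"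
  by (rule eq_matI) (simp_all add: act_index)

lemma act_diff: "A \<in> M \<Longrightarrow> act (f - g) A = act f A - act g A"
proof -
  have "act (f - g) A + act g A = act f A" by (simp flip: act_add)
  then have "act (f - g) A + act g A - act g A = act f A - act g A" by simp
  then show ?thesis by (auto intro!: eq_matI simp: mat_eq_iff)
qed

lemma act_sum_index:
  assumes "r < k" "s < k"
  shows "act (\<Sum>i\<in>S. f i) A $$ (r, s) = (\<Sum>i\<in>S. act (f i) A $$ (r, s))"
  using assms by (induction S rule: infinite_finite_induct) (simp_all add: act_zero act_add)

lemma foldr_rho_sl: "A \<in> L \<Longrightarrow> foldr rho ws A \<in> L"
proof (induction ws)
  case (Cons X ws)
  have "0\<^sub>m k k \<in> L" by (simp add: sl_def)
  then show ?case using Cons sl_carrier by (auto simp: rho_def intro!: ad_sl)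
qed simp

lemma act_sl: "A \<in> L \<Longrightarrow> act f A \<in> L"
proof (induction f rule: poly_mapping_induct_single)
  case (single w c)
  then show ?case using sl_carrier[of A k] by (simp add: act_single foldr_rho_sl sl_smult)
qed (simp add: act_add sl_add)

lemma act_restrict: "A \<in> M \<Longrightarrow> act (restrict_letters L f) A = act f A"
proof (induction f rule: poly_mapping_induct_single)
  case (single w c)
  show ?case
  proof (cases "set (letters w) \<subseteq> L")
    case False
    then show ?thesis using single
      by (simp add: restrict_letters_single act_zero act_single foldr_rho_outside)
  qed (simp add: restrict_letters_single)
qed (simp add: restrict_letters_add act_add)

definition annihilator :: "'a mat set \<Rightarrow> ('a mat free_monoid \<Rightarrow>\<^sub>0 'a) set" where
  "annihilator V = {f. \<forall>v\<in>V. act f v = 0\<^sub>m k k}"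

lemma annihilator_ideal:
  assumes V: "V \<subseteq> M"
  shows "p \<in> annihilator V \<Longrightarrow> p' \<in> annihilator V \<Longrightarrow> p + p' \<in> annihilator V"
    and "p \<in> annihilator V \<Longrightarrow> t * p \<in> annihilator V"
    and "p \<in> annihilator V \<Longrightarrow> (\<And>v. v \<in> V \<Longrightarrow> act t v \<in> V) \<Longrightarrow> p * t \<in> annihilator V"
  using V by (auto simp: annihilator_def act_add act_mult act_zero_right subset_iff)

lemma relation_annihilates:
  assumes r: "r \<in> enveloping_relations L" and A: "A \<in> M"
  shows "act r A = 0\<^sub>m k k"
proof -
  have zero: "B - C = 0\<^sub>m k k" if "B = C" "C \<in> M" for B C :: "'a mat" using that by auto
  from r consider X Y where "X \<in> L" "Y \<in> L" "r = letter (X + Y) - (letter X + letter Y)"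
    | c X where "X \<in> L" "r = letter (c \<cdot>\<^sub>m X) - scalar c * letter X"
    | X Y where "X \<in> L" "Y \<in> L" "r = letter X * letter Y - letter Y * letter X - letter (X * Y - Y * X)"
    unfolding enveloping_relations_def by blast
  then show ?thesis
  proof cases
    case 1
    then show ?thesis
      using A by (auto simp: act_diff act_add act_letter rho_def L_add ad_add_left[where k = k] sl_carrier intro!: zero ad_carrier add_carrier_mat)
  next
    case 2
    then show ?thesis
      using A by (auto simp: act_diff act_mult act_scalar act_letter rho_def L_smult ad_smult_left[where k = k and Y = X] sl_carrier ad_carrier intro!: zero ad_carrier)
  next
    case 3
    have "ad X (ad Y A) - ad Y (ad X A) = ad (X * Y - Y * X) A"
      using 3 A by (intro ad_commutator) (auto intro: sl_carrier)
    then show ?thesis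
      using 3 A L_commutator[of X Y]
      by (simp add: act_diff act_mult act_letter rho_def rho_carrier sl_carrier ad_carrier)
  qed
qed

lemma E_annihilates:
  assumes e: "e \<in> enveloping_ideal L" and A: "A \<in> M"
  shows "act e A = 0\<^sub>m k k"
proof -
  let ?N = "annihilator M \<inter> carrier FA"
  interpret FA: ring FA by (rule ring_free_algebra)
  have "ideal ?N FA"
  proof (rule idealI[OF ring_free_algebra])
    show "subgroup ?N (add_monoid FA)"
    proof (rule FA.add.subgroupI)
      have "0 \<in> ?N" by (simp add: annihilator_def act_zero carrier_free_algebra)
      then show "?N \<noteq> {}" by blast
    next
      fix f assume f: "f \<in> ?N"
      have neg: "\<ominus>\<^bsub>FA\<^esub> f = - f"
      proof -
        have "- f \<in> carrier FA" using f by (simp add: carrier_free_algebra restrict_letters_minus)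
        then show ?thesis using f by (intro FA.minus_equality) (auto simp: free_algebra_simps)
      qed
      have "act (- f) A = 0\<^sub>m k k" if "A \<in> M" for A
        using f that act_diff[OF that, of 0 f] by (simp add: annihilator_def act_zero)
      then show "\<ominus>\<^bsub>FA\<^esub> f \<in> ?N"
        using f by (simp add: neg annihilator_def carrier_free_algebra restrict_letters_minus)
    qed (auto simp: free_algebra_simps carrier_free_algebra restrict_letters_add intro: annihilator_ideal(1)[OF order_refl])
  qed (auto simp: free_algebra_simps carrier_free_algebra restrict_letters_mult intro: annihilator_ideal(2,3)[OF order_refl])
  moreover have "enveloping_relations L \<subseteq> ?N"
    using relations_carrier relation_annihilates by (auto simp: annihilator_def)
  ultimately have "enveloping_ideal L \<subseteq> ?N"
    unfolding enveloping_ideal_def by (rule FA.genideal_minimal)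
  then show ?thesis using e A by (auto simp: annihilator_def)
qed

lemma env_null_annihilates: "env_null \<subseteq> annihilator M"
proof
  fix f assume "f \<in> env_null"
  then have "restrict_letters L f \<in> enveloping_ideal L" by (simp add: env_null_def cls_eq_zero_iff)
  then have "act f A = 0\<^sub>m k k" if "A \<in> M" for A
    using E_annihilates[OF _ that] act_restrict[OF that, of f] by simp
  then show "f \<in> annihilator M" by (simp add: annihilator_def)
qed

text \<open>All elements of a coset act alike because the enveloping ideal acts by 0, and words over \<open>L\<close> act
through \<open>ad\<close>.\<close>

lemma env_rep_cls:
  assumes V: "V \<subseteq> M" and v: "v \<in> V"
  shows "env_rep k V ad (cls f) v = act f v"
proof -
  have word: "foldr ad ws A = foldr rho ws A" if "set ws \<subseteq> L" for ws and A :: "'a mat"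
    using that by (induction ws) (auto simp: rho_def)
  have free: "free_action k ad g A = act g A" if g: "g \<in> carrier FA" for g and A :: "'a mat"
  proof (rule eq_matI)
    fix r s assume "r < dim_row (act g A)" "s < dim_col (act g A)"
    then have "r < k" "s < k" by simp_all
    moreover have "set (letters w) \<subseteq> L" if "w \<in> Poly_Mapping.keys g" for w
      using g that by (simp add: free_algebra_def)
    ultimately show "free_action k ad g A $$ (r, s) = act g A $$ (r, s)"
      using word by (simp add: free_action_def act_index)
  qed (simp_all add: free_action_def)
  have "restrict (free_action k ad g) V = restrict (act f) V" if g: "g \<in> cls f" for g
  proof (rule ext)
    fix A
    obtain e where e: "e \<in> enveloping_ideal L" "g = e + restrict_letters L f"
      using g by (auto simp: env_class_def a_r_coset_def' free_algebra_simps)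
    have "e \<in> carrier FA" by (rule ideal.Icarr[OF ideal_E e(1)])
    then have "g \<in> carrier FA" unfolding e(2)
      by (simp add: carrier_free_algebra restrict_letters_add restrict_letters_idem)
    then have "free_action k ad g A = act f A" if "A \<in> V"
      using that V e E_annihilates[of e A] by (auto simp: free act_add act_restrict intro!: eq_matI)
    then show "restrict (free_action k ad g) V A = restrict (act f) V A" by simp
  qed
  moreover have "cls f \<noteq> {}"
    using additive_subgroup.zero_closed[OF ideal.axioms(1)[OF ideal_E]]
    by (auto simp: env_class_def a_r_coset_def')
  ultimately have "(\<lambda>g. restrict (free_action k ad g) V) ` cls f = {restrict (act f) V}"
    by auto
  then show ?thesis using v by (simp add: env_rep_def)
qed

lemma cls_ker_Ad: "cls f \<in> ker_Ad k \<longleftrightarrow> f \<in> annihilator L"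
  using env_rep_cls[OF subsetI[OF sl_carrier]] cls_carrier
  by (auto simp: ker_Ad_def Ad_rep_def annihilator_def)

lemma cls_ker_phi: "cls f \<in> ker_phi k \<longleftrightarrow> f \<in> annihilator M"
  using env_rep_cls[of M] cls_carrier
  by (auto simp: ker_phi_def phi_rep_def annihilator_def)

section \<open>The relations of the matrix units in the enveloping algebra\<close>

lemma scalar_of_bool: "scalar (of_bool b) * t = (if b then t else 0)"
  by (simp add: scalar_def)

text \<open>The elements \<open>x i j\<close> span the letters of \<open>L\<close>. The expansion uses the plain entries of \<open>X\<close>: the
contributions of \<open>\<delta>\<^sub>i\<^sub>j / k\<close> cancel as \<open>X\<close> has trace 0.\<close>

lemma letter_expansion_null:
  assumes "X \<in> L"
  shows "letter X - (\<Sum>i=1..k. \<Sum>j=1..k. scalar (X $$ (i - 1, j - 1)) * x i j) \<in> env_null"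
  using assms k2
proof (induction rule: sl_induct)
  case (add X Y)
  let ?S = "\<lambda>X. \<Sum>i=1..k. \<Sum>j=1..k. scalar (X $$ (i - 1, j - 1)) * x i j"
  have "?S (X + Y) = ?S X + ?S Y"
    unfolding sum.distrib[symmetric] using sl_carrier[OF add.hyps(2)]
    by (intro sum.cong refl) (auto simp: scalar_add distrib_right)
  then have "letter (X + Y) - ?S (X + Y) = (letter (X + Y) - (letter X + letter Y)) + ((letter X - ?S X) + (letter Y - ?S Y))"
    by simp
  also have "\<dots> \<in> env_null"
    by (rule env_null_ideal(1)[OF letter_add_null[OF add.hyps] env_null_ideal(1)[OF add.IH]])
  finally show ?case .
next
  case (smult c X)
  let ?S = "\<lambda>X. \<Sum>i=1..k. \<Sum>j=1..k. scalar (X $$ (i - 1, j - 1)) * x i j"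
  have "?S (c \<cdot>\<^sub>m X) = scalar c * ?S X"
    unfolding sum_distrib_left using sl_carrier[OF smult.hyps(1)]
    by (intro sum.cong refl) (auto simp: scalar_mult mult.assoc)
  then have "letter (c \<cdot>\<^sub>m X) - ?S (c \<cdot>\<^sub>m X) = (letter (c \<cdot>\<^sub>m X) - scalar c * letter X) + scalar c * (letter X - ?S X)"
    by (simp add: right_diff_distrib)
  also have "\<dots> \<in> env_null"
    by (rule env_null_ideal(1)[OF letter_smult_null[OF smult.hyps(1)] env_null_ideal(2)[OF smult.IH]])
  finally show ?case .
next
  case (unit i j)
  have "(\<Sum>l=1..k. \<Sum>m=1..k. scalar (mat_unit k i j $$ (l - 1, m - 1)) * x l m) =
      (\<Sum>l=1..k. \<Sum>m=1..k. if m = j then if l = i then x l m else 0 else 0)"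
    by (intro sum.cong refl) (auto simp: mat_unit_index scalar_of_bool)
  also have "\<dots> = x i j" using unit by simp
  finally show ?case using unit by (simp add: casimir_entry_offdiag env_null_0)
next
  case (diag i)
  have ik: "i \<in> {1..k}" "k \<in> {1..k}" using diag by auto
  have "(\<Sum>l=1..k. \<Sum>m=1..k. scalar ((mat_unit k i i - mat_unit k k k) $$ (l - 1, m - 1)) * x l m) =
      (\<Sum>l=1..k. \<Sum>m=1..k. if m = l then if l = i then x l m else 0 else 0)
      - (\<Sum>l=1..k. \<Sum>m=1..k. if m = l then if l = k then x l m else 0 else 0)"
    unfolding sum_subtractf[symmetric] using diag
    by (intro sum.cong refl) (auto simp: mat_unit_index scalar_of_bool scalar_minus)
  also have "\<dots> = x i i - x k k" using ik by simp
  finally have S: "(\<Sum>l=1..k. \<Sum>m=1..k. scalar ((mat_unit k i i - mat_unit k k k) $$ (l - 1, m - 1)) * x l m) = x i i - x k k" .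
  have "mat_unit k i i - mat_unit k k k = 1 \<cdot>\<^sub>m casimir_entry k i i + (- 1) \<cdot>\<^sub>m (casimir_entry k k k :: 'a mat)"
    using ik by (intro eq_matI) (auto simp: mat_unit_index casimir_entry_index)
  then have "letter (mat_unit k i i - mat_unit k k k :: 'a mat) - (scalar 1 * x i i + scalar (- 1) * x k k) \<in> env_null"
    using letter_linear_null[OF casimir_entry_sl[OF ik(1,1)] casimir_entry_sl[OF ik(2,2)], of 1 "- 1"] by (simp only:)
  then show ?case unfolding S by (simp add: scalar_minus)
qed

lemma letter_zero_null: "letter (0\<^sub>m k k) \<in> env_null"
proof -
  have "0 \<cdot>\<^sub>m 0\<^sub>m k k = (0\<^sub>m k k :: 'a mat)" by (rule eq_matI) simp_all
  then show ?thesis using letter_smult_null[of "0\<^sub>m k k" 0] by (simp add: sl_def scalar_def)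
qed

text \<open>The relations of the \<open>x i j\<close> hold modulo the enveloping ideal, hence modulo the preimage of each
ideal of the enveloping algebra.\<close>

lemma gl_relations_env:
  assumes add: "\<And>r s. r \<in> J \<Longrightarrow> s \<in> J \<Longrightarrow> r + s \<in> J"
    and left: "\<And>r t. r \<in> J \<Longrightarrow> t * r \<in> J" and right: "\<And>r t. r \<in> J \<Longrightarrow> r * t \<in> J"
    and null: "env_null \<subseteq> J"
  shows "gl_relations k scalar x J"
proof
  show "x a b * x i j - x i j * x a b - ((if b = i then x a j else 0) - (if a = j then x i b else 0)) \<in> J"
    if "a \<in> {1..k}" "b \<in> {1..k}" "i \<in> {1..k}" "j \<in> {1..k}" for a b i j
  proof -
    have "x a b * x i j - x i j * x a b - letter (ad (casimir_entry k a b) (casimir_entry k i j)) \<in> env_null"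
      using letter_commutator_null casimir_entry_sl that unfolding ad_def by blast
    moreover have "letter (ad (casimir_entry k a b) (casimir_entry k i j))
        - (scalar (of_bool (b = i)) * x a j + scalar (- of_bool (a = j)) * x i b) \<in> env_null"
      unfolding casimir_entry_commutator[OF that] by (intro letter_linear_null casimir_entry_sl that)
    ultimately have "x a b * x i j - x i j * x a b
        - (scalar (of_bool (b = i)) * x a j + scalar (- of_bool (a = j)) * x i b) \<in> env_null"
      by (rule env_null_trans)
    moreover have "scalar (- of_bool (a = j)) * x i b = - (if a = j then x i b else 0)"
      by (simp add: scalar_minus)
    ultimately show ?thesis using null by (auto simp: scalar_of_bool)
  qed
  show "(\<Sum>i=1..k. x i i) \<in> J"
  proof -
    \<comment> \<open>the sum of the first \<open>n\<close> matrices \<open>casimir_entry k i i\<close>; \<open>S k = 0\<close>\<close>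
    define S where "S n = mat k k (\<lambda>(r, s). if r = s then of_bool (r < n) - of_nat n / of_nat k else (0::'a))" for n
    have S_Suc: "S (Suc n) = S n + casimir_entry k (Suc n) (Suc n)" if "n < k" for n
      using that by (intro eq_matI) (auto simp: S_def casimir_entry_index add_divide_distrib less_Suc_eq)
    have S_sl: "n \<le> k \<Longrightarrow> S n \<in> L \<and> (\<Sum>i=1..n. x i i) - letter (S n) \<in> env_null" for n
    proof (induction n)
      case 0
      have "S 0 = 0\<^sub>m k k" by (rule eq_matI) (simp_all add: S_def)
      then show ?case using env_null_minus[OF letter_zero_null] by (simp add: sl_def)
    next
      case (Suc n)
      let ?c = "casimir_entry k (Suc n) (Suc n) :: 'a mat"
      have c: "?c \<in> L" using Suc.prems by (intro casimir_entry_sl) auto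
      have "(\<Sum>i=1..Suc n. x i i) - letter (S (Suc n)) =
          ((\<Sum>i=1..n. x i i) - letter (S n)) - (letter (S n + ?c) - (letter (S n) + letter ?c))"
        using S_Suc[of n] Suc.prems by simp
      also have "\<dots> \<in> env_null"
        using Suc c by (intro env_null_diff[OF _ letter_add_null]) auto
      finally show ?case using S_Suc[of n] Suc c by (auto intro: sl_add)
    qed
    have "S k = 0\<^sub>m k k" using k2 by (intro eq_matI) (auto simp: S_def)
    then have "(\<Sum>i=1..k. x i i) \<in> env_null"
      using S_sl[of k] env_null_ideal(1)[OF _ letter_zero_null, of "(\<Sum>i=1..k. x i i) - letter (0\<^sub>m k k)"] by simp
    then show ?thesis using null by blast
  qed
next
  fix Q :: "('a mat free_monoid \<Rightarrow>\<^sub>0 'a) \<Rightarrow> bool" and t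
  assume rel: "\<And>r. r \<in> J \<Longrightarrow> Q r" and sc: "\<And>d. Q (scalar d)"
    and mult: "\<And>u a b. Q u \<Longrightarrow> a \<in> {1..k} \<Longrightarrow> b \<in> {1..k} \<Longrightarrow> Q (u * x a b)"
    and plus: "\<And>u v. Q u \<Longrightarrow> Q v \<Longrightarrow> Q (u + v)"
  \<comment> \<open>the rule multiplies by \<open>x a b\<close> on the right, so scalars are collected on the left\<close>
  define Q' where "Q' u \<longleftrightarrow> (\<forall>c. Q (scalar c * u))" for u
  have Q'_rel: "Q' r" if "r \<in> J" for r using rel left[OF that] by (simp add: Q'_def)
  have Q'_add: "Q' (u + v)" if "Q' u" "Q' v" for u v using that plus by (simp add: Q'_def distrib_left)
  have Q'_sum: "Q' (\<Sum>i\<in>S. f i)" if "\<And>i. i \<in> S \<Longrightarrow> Q' (f i)" for S :: "nat set" and f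
    using that
  proof (induction S rule: infinite_finite_induct)
    case (insert i S)
    then show ?case by (simp add: Q'_add)
  qed (use null env_null_0 Q'_rel in auto)
  have Q'_mult: "Q' (u * (scalar c * x a b))" if "Q' u" "a \<in> {1..k}" "b \<in> {1..k}" for u a b c
  proof -
    have "scalar d * (u * (scalar c * x a b)) = scalar (d * c) * u * x a b" for d
      by (simp add: scalar_mult scalar_commute[of u] mult.assoc flip: mult.assoc[of u])
    then show ?thesis using that mult unfolding Q'_def by metis
  qed
  have "Q' t"
  proof (induction t rule: free_algebra_induct)
    case (scalar c)
    show ?case using sc by (simp add: Q'_def flip: scalar_mult)
  next
    case (letter u X)
    show ?case
    proof (cases "X \<in> L")
      case True
      let ?S = "\<Sum>i=1..k. \<Sum>j=1..k. scalar (X $$ (i - 1, j - 1)) * x i j"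
      have "u * letter X = u * (letter X - ?S) + (\<Sum>i=1..k. \<Sum>j=1..k. u * (scalar (X $$ (i - 1, j - 1)) * x i j))"
        by (simp add: right_diff_distrib sum_distrib_left)
      moreover have "Q' (u * (letter X - ?S))"
        using letter_expansion_null[OF True] null by (intro Q'_rel left) blast
      moreover have "Q' (\<Sum>i=1..k. \<Sum>j=1..k. u * (scalar (X $$ (i - 1, j - 1)) * x i j))"
        using letter by (intro Q'_sum Q'_mult)
      ultimately show ?thesis using Q'_add by simp
    next
      case False
      then have "letter X \<in> J" using letter_outside_null null by blast
      then show ?thesis by (intro Q'_rel left)
    qed
  qed (rule Q'_add)
  then show "Q t" unfolding Q'_def by (metis scalar_1 mult_1_left)
next
  show "t * scalar c = scalar c * t" for t :: "'a mat free_monoid \<Rightarrow>\<^sub>0 'a" and c by (rule scalar_commute)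
  show "r + s \<in> J" if "r \<in> J" "s \<in> J" for r s using that by (rule add)
  show "t * r \<in> J" "r * t \<in> J" if "r \<in> J" for r t using that by (rule left, rule right)
qed (use k2 in \<open>simp_all add: scalar_add scalar_mult\<close>)

end

sublocale sl_algebra \<subseteq> gl: gl_relations k scalar x env_null
  by (rule gl_relations_env) (auto intro: env_null_ideal)

context sl_algebra
begin

abbreviation e :: "nat \<Rightarrow> nat \<Rightarrow> 'a mat" where "e i j \<equiv> mat_unit k i j"

lemma act_x_index:
  assumes "i \<in> {1..k}" "j \<in> {1..k}" "A \<in> M" "r < k" "s < k"
  shows "act (x i j) A $$ (r, s) = of_bool (Suc r = i) * A $$ (j - 1, s) - A $$ (r, i - 1) * of_bool (Suc s = j)"
  using assms casimir_entry_sl[OF assms(1,2), where 'a='a]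
  by (simp add: act_letter rho_def ad_casimir_entry_index)

lemma act_grading_index:
  assumes A: "A \<in> M" and rs: "r < k" "s < k"
  shows "act gl.grading A $$ (r, s) = (of_nat s - of_nat r) * A $$ (r, s)"
proof -
  have "act gl.grading A $$ (r, s) = (\<Sum>a=1..k. (if a = Suc s then of_nat a * A $$ (r, s) else 0) - (if a = Suc r then of_nat a * A $$ (r, s) else 0))"
    unfolding gl.grading_def act_sum_index[OF rs]
  proof (intro sum.cong refl)
    fix a assume a: "a \<in> {1..k}"
    have "act (scalar (- of_nat a) * x a a) A $$ (r, s) = - of_nat a * act (x a a) A $$ (r, s)"
      using A rs by (simp add: act_mult act_scalar)
    also have "\<dots> = (if a = Suc s then of_nat a * A $$ (r, s) else 0) - (if a = Suc r then of_nat a * A $$ (r, s) else 0)"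
      unfolding act_x_index[OF a a A rs] by (auto simp: algebra_simps)
    finally show "act (scalar (- of_nat a) * x a a) A $$ (r, s) =
        (if a = Suc s then of_nat a * A $$ (r, s) else 0) - (if a = Suc r then of_nat a * A $$ (r, s) else 0)" .
  qed
  also have "\<dots> = of_nat (Suc s) * A $$ (r, s) - of_nat (Suc r) * A $$ (r, s)"
    using rs by (simp add: sum_subtractf)
  finally show ?thesis by (simp add: algebra_simps)
qed

lemma act_shifted_prod_index:
  assumes A: "A \<in> M" and rs: "r < k" "s < k"
  shows "act (gl.shifted_prod gl.grading cs) A $$ (r, s) =
    prod_list (map (\<lambda>c. of_nat s - of_nat r - c) cs) * A $$ (r, s)"
proof (induction cs)
  case Nil
  then show ?case using A by (simp add: act_1)
next
  case (Cons c cs)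
  then show ?case using A rs
    by (simp add: act_mult act_diff act_scalar act_grading_index algebra_simps)
qed

lemma act_highest_unit:
  assumes A: "A = e 1 k"
  shows "\<lbrakk>a \<in> {1..k}; b \<in> {1..k}; a < b\<rbrakk> \<Longrightarrow> act (x a b) A = 0\<^sub>m k k"
    and "i \<in> {1..k} \<Longrightarrow> act (x i i - scalar (adjoint_weight k i)) A = 0\<^sub>m k k"
proof -
  have AM: "A \<in> M" by (simp add: A)
  show "act (x a b) A = 0\<^sub>m k k" if ab: "a \<in> {1..k}" "b \<in> {1..k}" "a < b" for a b
  proof (rule mat_carrier_eqI)
    fix r s assume rs: "r < k" "s < k"
    have "b - 1 < k" "a - 1 < k" "Suc (b - 1) = b" "Suc (a - 1) = a" using ab by auto
    then show "act (x a b) A $$ (r, s) = 0\<^sub>m k k $$ (r, s)"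
      unfolding act_x_index[OF ab(1,2) AM rs] using rs ab by (simp add: A mat_unit_index)
  qed simp_all
  show "act (x i i - scalar (adjoint_weight k i)) A = 0\<^sub>m k k" if i: "i \<in> {1..k}" for i
  proof (rule mat_carrier_eqI)
    fix r s assume rs: "r < k" "s < k"
    have "i - 1 < k" "Suc (i - 1) = i" using i by auto
    moreover have "act (x i i - scalar (adjoint_weight k i)) A $$ (r, s) =
        of_bool (Suc r = i) * A $$ (i - 1, s) - A $$ (r, i - 1) * of_bool (Suc s = i) - adjoint_weight k i * A $$ (r, s)"
      unfolding act_x_index[OF i i AM rs, symmetric] using rs AM by (simp add: act_diff act_scalar)
    ultimately show "act (x i i - scalar (adjoint_weight k i)) A $$ (r, s) = 0\<^sub>m k k $$ (r, s)"
      using rs by (auto simp: A mat_unit_index adjoint_weight_def)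
  qed simp_all
qed

text \<open>The functional \<open>\<phi>\<close> is the coefficient at the position \<open>(0, k - 1)\<close>, where matrices are indexed from
0, of the image of \<open>e\<^sub>1\<^sub>k\<close>. No lowering operator has an image with a nonzero entry there.\<close>

theorem annihilator_sl_subset:
  assumes add: "\<And>r s. r \<in> J \<Longrightarrow> s \<in> J \<Longrightarrow> r + s \<in> J"
    and left: "\<And>r t. r \<in> J \<Longrightarrow> t * r \<in> J" and right: "\<And>r t. r \<in> J \<Longrightarrow> r * t \<in> J"
    and null: "env_null \<subseteq> J" and J: "J \<subseteq> annihilator L"
    and cube: "x 1 2 * (x 1 2 * x 1 2) \<in> J" and casimir: "gl.casimir2 - scalar (2 * of_nat k) \<in> J"
  shows "annihilator L \<subseteq> J"
proof -
  have LM: "L \<subseteq> M" using sl_carrier by blast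
  have e1k: "e 1 k \<in> L" "e 1 k \<in> M" using k2 by (simp_all add: mat_unit_sl)
  have zero_k: "(0::nat) < k" "k - 1 < k" using k2 by auto
  define \<phi> where "\<phi> u = act u (e 1 k) $$ (0, k - 1)" for u
  let ?cs = "map of_int [1 - int k..int k - 2] :: 'a list"
  \<comment> \<open>the entry \<open>(r, s)\<close> has the degree \<open>s - r\<close>, which is \<open>k - 1\<close> only for \<open>e\<^sub>1\<^sub>k\<close>\<close>
  have in_cs: "of_nat s - of_nat r \<in> set ?cs" if "r < k" "s < k" "\<not> (r = 0 \<and> s = k - 1)" for r s
  proof -
    have "int s - int r \<in> {1 - int k..int k - 2}" using that by auto
    then have "of_int (int s - int r) \<in> set ?cs" by (simp only: set_map set_upto imageI)
    moreover have "(of_nat s - of_nat r :: 'a) = of_int (int s - int r)" by simp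
    ultimately show ?thesis by (simp only:)
  qed
  have q_zero: "prod_list (map (\<lambda>c. of_nat s - of_nat r - c) ?cs) = 0"
    if "r < k" "s < k" "\<not> (r = 0 \<and> s = k - 1)" for r s
  proof -
    have "0 \<in> (\<lambda>c. of_nat s - of_nat r - c) ` set ?cs"
      by (rule image_eqI[OF _ in_cs[OF that]]) simp
    then show ?thesis by (simp only: prod_list_zero_iff set_map)
  qed
  interpret J: gl_relations k scalar x J
    by (rule gl_relations_env[OF add left right null])
  interpret adjoint_annihilator k scalar x J "annihilator L" \<phi>
  proof (unfold_locales)
    show "x 1 2 * (x 1 2 * x 1 2) \<in> J" "J.casimir2 - scalar (2 * of_nat k) \<in> J" "J \<subseteq> annihilator L"
      using cube casimir J by auto
    show "p \<in> annihilator L \<Longrightarrow> t * p \<in> annihilator L" "p \<in> annihilator L \<Longrightarrow> p * t \<in> annihilator L"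
      "p \<in> annihilator L \<Longrightarrow> p' \<in> annihilator L \<Longrightarrow> p + p' \<in> annihilator L" for p p' t
      using annihilator_ideal[OF LM] act_sl by auto
    show "J.shifted_prod J.grading ?cs * (J.grading - scalar (of_nat k - 1)) \<in> annihilator L"
      unfolding annihilator_def
    proof (intro CollectI ballI mat_carrier_eqI)
      fix A r s assume A: "A \<in> L" and rs: "r < k" "s < k"
      then have AM: "A \<in> M" using sl_carrier by auto
      have "act (J.grading - scalar (of_nat k - 1)) A $$ (r, s) = 0" if "r = 0" "s = k - 1"
        using that rs AM k2 by (simp add: act_diff act_scalar act_grading_index of_nat_diff)
      then show "act (J.shifted_prod J.grading ?cs * (J.grading - scalar (of_nat k - 1))) A $$ (r, s) = 0\<^sub>m k k $$ (r, s)"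
        using rs AM q_zero[OF rs] unfolding act_mult[OF AM] act_shifted_prod_index[OF act_carrier rs]
        by (cases "r = 0 \<and> s = k - 1") simp_all
    qed simp_all
    show "(x i i - scalar (adjoint_weight k i)) * J.shifted_prod J.grading ?cs \<in> annihilator L" if i: "i \<in> {1..k}" for i
      unfolding annihilator_def
    proof (intro CollectI ballI mat_carrier_eqI)
      fix A r s assume A: "A \<in> L" and rs: "r < k" "s < k"
      then have AM: "A \<in> M" using sl_carrier by auto
      define B where "B = act (J.shifted_prod J.grading ?cs) A"
      have BM: "B \<in> M" by (simp add: B_def)
      have B0: "B $$ (u, v) = 0" if "u < k" "v < k" "\<not> (u = 0 \<and> v = k - 1)" for u v
        unfolding B_def act_shifted_prod_index[OF AM that(1,2)] q_zero[OF that] by simp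
      have i1: "i - 1 < k" "Suc (i - 1) = i" using i by auto
      have "act (x i i - scalar (adjoint_weight k i)) B $$ (r, s) =
          of_bool (Suc r = i) * B $$ (r, s) - B $$ (r, s) * of_bool (Suc s = i) - adjoint_weight k i * B $$ (r, s)"
        using rs BM i by (auto simp: act_diff act_scalar act_x_index[OF i i BM rs])
      also have "\<dots> = 0"
        using B0[OF rs] rs k2 by (cases "r = 0 \<and> s = k - 1") (auto simp: adjoint_weight_def)
      finally show "act ((x i i - scalar (adjoint_weight k i)) * J.shifted_prod J.grading ?cs) A $$ (r, s) = 0\<^sub>m k k $$ (r, s)"
        using rs by (simp add: act_mult[OF AM] flip: B_def)
    qed simp_all
    show "\<phi> (s + t) = \<phi> s + \<phi> t" "\<phi> (scalar c * t) = c * \<phi> t" "\<phi> 1 = 1" for s t c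
      using zero_k e1k k2 by (simp_all add: \<phi>_def act_add act_mult act_scalar act_1 mat_unit_index)
    show "p \<in> annihilator L \<Longrightarrow> \<phi> p = 0" for p
      using e1k zero_k by (simp add: \<phi>_def annihilator_def)
    show "\<phi> (x a b * t) = 0" if "a \<in> {1..k}" "b \<in> {1..k}" "b < a" for a b t
      using that zero_k e1k by (auto simp: \<phi>_def act_mult act_x_index)
    show "\<phi> (t * x a b) = 0" if "a \<in> {1..k}" "b \<in> {1..k}" "a < b" for a b t
      using act_highest_unit(1)[OF refl that] zero_k e1k by (simp add: \<phi>_def act_mult act_zero_right)
    show "\<phi> (t * (x i i - scalar (adjoint_weight k i))) = 0" if "i \<in> {1..k}" for i t
      using act_highest_unit(2)[OF refl that] zero_k e1k by (simp add: \<phi>_def act_mult act_zero_right)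
  qed
  show ?thesis by (rule annihilator_subset_relations)
qed

end

section \<open>Casimir elements and their eigenvalues\<close>

text \<open>The product of the entries \<open>y\<close> along a path from \<open>i\<close> to \<open>j\<close> with intermediate vertices \<open>ms\<close>.\<close>

primrec chain_prod :: "(nat \<Rightarrow> nat \<Rightarrow> 't::monoid_mult) \<Rightarrow> nat \<Rightarrow> nat list \<Rightarrow> nat \<Rightarrow> 't" where
  "chain_prod y i [] j = y i j"
| "chain_prod y i (m # ms) j = y i m * chain_prod y m ms j"

lemma foldr_chain_prod:
  "foldr (\<lambda>t z. y ((i # ms) ! t) ((i # ms @ [j]) ! Suc t) * z) [0..<Suc (length ms)] 1 = chain_prod y i ms j"
proof (induction ms arbitrary: i)
  case (Cons m ms)
  have upt: "[0..<Suc (Suc n)] = 0 # map Suc [0..<Suc n]" for n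
    by (subst upt_conv_Cons) (simp_all only: map_Suc_upt zero_less_Suc)
  show ?case
    by (simp only: length_Cons upt foldr_Cons foldr_map comp_def o_apply nth_Cons_Suc nth_Cons_0 append_Cons
        chain_prod.simps Cons.IH[of m, unfolded nth_Cons_Suc])
qed simp

lemma foldr_cyclic_chain_prod:
  assumes "length ms = p"
  shows "foldr (\<lambda>t z. y ((i # ms) ! t) ((i # ms) ! ((t + 1) mod Suc p)) * z) [0..<Suc p] 1 = chain_prod y i ms i"
proof -
  have nxt: "(i # ms) ! ((t + 1) mod Suc p) = (i # ms @ [i]) ! Suc t" if "t < Suc p" for t
  proof (cases "t = p")
    case True
    then show ?thesis using assms by (simp add: nth_append)
  qed (use that assms in \<open>simp add: nth_append\<close>)
  have "foldr (\<lambda>t z. y ((i # ms) ! t) ((i # ms) ! ((t + 1) mod Suc p)) * z) [0..<Suc p] 1 =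
      foldr (\<lambda>t z. y ((i # ms) ! t) ((i # ms @ [i]) ! Suc t) * z) [0..<Suc p] 1"
    by (intro foldr_cong refl) (simp only: nxt set_upt atLeastLessThan_iff)
  then show ?thesis using foldr_chain_prod[of y i ms i] assms by simp
qed

lemma sum_lists_Suc:
  assumes "finite S"
  shows "(\<Sum>ind\<in>{ind. set ind \<subseteq> S \<and> length ind = Suc p}. f ind) =
    (\<Sum>i\<in>S. \<Sum>ms\<in>{ms. set ms \<subseteq> S \<and> length ms = p}. f (i # ms))"
proof -
  have "{ind. set ind \<subseteq> S \<and> length ind = Suc p} = (\<lambda>(i, ms). i # ms) ` (S \<times> {ms. set ms \<subseteq> S \<and> length ms = p})"
    by (auto simp: image_iff length_Suc_conv)
  moreover have "inj_on (\<lambda>(i, ms). i # ms) (S \<times> {ms. set ms \<subseteq> S \<and> length ms = p})"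
    by (auto simp: inj_on_def)
  ultimately show ?thesis
    using assms finite_lists_length_eq[OF assms, of p]
    by (simp add: sum.reindex sum.cartesian_product case_prod_beta')
qed

context sl_algebra
begin

lemma path_sum_chain_prod:
  assumes "j \<in> {1..k}"
  shows "gl.path_sum (Suc p) i j = (\<Sum>ms\<in>{ms. set ms \<subseteq> {1..k} \<and> length ms = p}. chain_prod x i ms j)"
proof (induction p arbitrary: i)
  case 0
  have "gl.path_sum (Suc 0) i j = (\<Sum>m=1..k. if m = j then x i m else 0)"
    unfolding gl.path_sum.simps by (intro sum.cong refl) simp
  also have "\<dots> = x i j" using assms by simp
  also have "\<dots> = (\<Sum>ms\<in>{ms. set ms \<subseteq> {1..k} \<and> length ms = 0}. chain_prod x i ms j)"
  proof -
    have "{ms. set ms \<subseteq> {1..k} \<and> length ms = 0} = {[]}" by auto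
    then show ?thesis by simp
  qed
  finally show ?case .
next
  case (Suc p)
  have "gl.path_sum (Suc (Suc p)) i j = (\<Sum>m=1..k. x i m * gl.path_sum (Suc p) m j)" by (rule gl.path_sum.simps)
  also have "\<dots> = (\<Sum>m=1..k. \<Sum>ms\<in>{ms. set ms \<subseteq> {1..k} \<and> length ms = p}. chain_prod x i (m # ms) j)"
    by (simp only: Suc.IH sum_distrib_left chain_prod.simps)
  finally show ?case by (simp only: sum_lists_Suc finite_atLeastAtMost)
qed

lemma cls_casimir_sum:
  assumes p: "1 \<le> p"
  shows "cls (gl.casimir_sum p) = casimir k p"
proof -
  obtain q where q: "p = Suc q" using p by (cases p) auto
  let ?I = "{ind. set ind \<subseteq> {1..k} \<and> length ind = p}"
  let ?f = "\<lambda>ind. foldr (\<lambda>t z. x (ind ! t) (ind ! ((t + 1) mod p)) * z) [0..<p] 1"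
  have fin: "finite ?I" by (rule finite_lists_length_eq) simp
  have "gl.casimir_sum p = (\<Sum>i=1..k. \<Sum>ms\<in>{ms. set ms \<subseteq> {1..k} \<and> length ms = q}. chain_prod x i ms i)"
    unfolding gl.casimir_sum_def q by (intro sum.cong refl path_sum_chain_prod)
  also have "\<dots> = (\<Sum>i=1..k. \<Sum>ms\<in>{ms. set ms \<subseteq> {1..k} \<and> length ms = q}. ?f (i # ms))"
    unfolding q by (intro sum.cong refl foldr_cyclic_chain_prod[symmetric]) auto
  also have "\<dots> = (\<Sum>ind\<in>?I. ?f ind)" unfolding q by (rule sum_lists_Suc[symmetric]) simp
  finally have "cls (gl.casimir_sum p) = (\<Oplus>\<^bsub>U\<^esub>ind\<in>?I. cls (?f ind))" by (simp only: cls_sum[OF fin])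
  also have "\<dots> = casimir k p"
  proof -
    interpret U: ring U by (rule ring_U)
    have fold: "cls (foldr (\<lambda>t z. x (ind ! t) (ind ! ((t + 1) mod p)) * z) ts 1) =
        foldr (\<lambda>t z. env_gen (sl k) (casimir_entry k (ind ! t) (ind ! ((t + 1) mod p))) \<otimes>\<^bsub>U\<^esub> z) ts \<one>\<^bsub>U\<^esub>"
      if ind: "set ind \<subseteq> {1..k}" "length ind = p" and ts: "set ts \<subseteq> {..<p}" for ind ts
      using ts
    proof (induction ts)
      case (Cons t ts)
      have "ind ! t \<in> {1..k}" using ind Cons.prems by (metis list.set_intros(1) lessThan_iff nth_mem subsetD)
      moreover have "(t + 1) mod p < length ind" using ind p by simp
      then have "ind ! ((t + 1) mod p) \<in> {1..k}" using ind nth_mem by blast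
      ultimately have "casimir_entry k (ind ! t) (ind ! ((t + 1) mod p)) \<in> L" by (rule casimir_entry_sl)
      then show ?case using Cons by (simp add: cls_mult cls_letter)
    qed (simp add: cls_1)
    show ?thesis
      unfolding casimir_def
    proof (rule U.finsum_cong'[OF refl])
      show "cls (?f ind) = foldr (\<lambda>t z. env_gen (sl k) (casimir_entry k (ind ! t) (ind ! ((t + 1) mod p))) \<otimes>\<^bsub>U\<^esub> z) [0..<p] \<one>\<^bsub>U\<^esub>"
        if "ind \<in> ?I" for ind using that by (intro fold) auto
      then show "(\<lambda>ind. foldr (\<lambda>t z. env_gen (sl k) (casimir_entry k (ind ! t) (ind ! ((t + 1) mod p))) \<otimes>\<^bsub>U\<^esub> z) [0..<p] \<one>\<^bsub>U\<^esub>) \<in> ?I \<rightarrow> carrier U"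
        using cls_carrier by (metis (no_types, lifting) Pi_I)
    qed
  qed
  finally show ?thesis .
qed

lemma casimir_sum_act_commute: "A \<in> M \<Longrightarrow> act (gl.casimir_sum p) (act t A) = act t (act (gl.casimir_sum p) A)"
proof -
  assume A: "A \<in> M"
  have "t * gl.casimir_sum p - gl.casimir_sum p * t \<in> annihilator M"
    using gl.casimir_sum_central env_null_annihilates by blast
  then have "act t (act (gl.casimir_sum p) A) - act (gl.casimir_sum p) (act t A) = 0\<^sub>m k k"
    using A by (simp add: annihilator_def act_diff act_mult)
  then show ?thesis by (intro eq_matI) (simp_all add: mat_eq_iff)
qed

text \<open>The commutator with \<open>e\<^sub>1\<^sub>1 - e\<^sub>k\<^sub>k\<close> has the eigenvalue 2 only on \<open>e\<^sub>1\<^sub>k\<close>.\<close>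

lemma highest_unit_unique:
  assumes A: "A \<in> M" and top: "act (x 1 1) A - act (x k k) A = 2 \<cdot>\<^sub>m A"
  shows "A = A $$ (0, k - 1) \<cdot>\<^sub>m e 1 k"
proof (rule eq_matI)
  fix r s assume "r < dim_row (A $$ (0, k - 1) \<cdot>\<^sub>m e 1 k)" "s < dim_col (A $$ (0, k - 1) \<cdot>\<^sub>m e 1 k)"
  then have rs: "r < k" "s < k" by simp_all
  have k1: "1 \<in> {1..k}" "k \<in> {1..k}" using k2 by auto
  have "(act (x 1 1) A - act (x k k) A) $$ (r, s) = (2 \<cdot>\<^sub>m A) $$ (r, s)" using top by simp
  then have "act (x 1 1) A $$ (r, s) - act (x k k) A $$ (r, s) = 2 * A $$ (r, s)"
    using rs A by simp
  then show "A $$ (r, s) = (A $$ (0, k - 1) \<cdot>\<^sub>m e 1 k) $$ (r, s)"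
    unfolding act_x_index[OF k1(1,1) A rs] act_x_index[OF k1(2,2) A rs]
    using rs k2 by (cases "r = 0"; cases "Suc s = k"; cases "Suc r = k"; cases "s = 0") (auto simp: mat_unit_index)
qed (use A in simp_all)

text \<open>A central element maps \<open>e\<^sub>1\<^sub>k\<close> to a matrix of the same weight, hence to a multiple \<open>c e\<^sub>1\<^sub>k\<close>; the matrices
on which it acts by \<open>c\<close> are closed under commutators, so they are all of \<open>L\<close>.\<close>

lemma casimir_sum_scalar:
  obtains c where "\<And>A. A \<in> L \<Longrightarrow> act (gl.casimir_sum p) A = c \<cdot>\<^sub>m A"
proof -
  have k1: "1 \<in> {1..k}" "k \<in> {1..k}" "1 \<noteq> k" using k2 by auto
  define B where "B = act (gl.casimir_sum p) (e 1 k)"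
  have e1k: "e 1 k \<in> L" using k1 by (rule_tac mat_unit_sl) simp
  have "act (x 1 1) (e 1 k) - act (x k k) (e 1 k) = 2 \<cdot>\<^sub>m e 1 k"
  proof -
    have "act (x i i) (e 1 k) = adjoint_weight k i \<cdot>\<^sub>m e 1 k" if i: "i \<in> {1..k}" for i
    proof -
      have "act (x i i) (e 1 k) - adjoint_weight k i \<cdot>\<^sub>m e 1 k = 0\<^sub>m k k"
        using act_highest_unit(2)[OF refl i] by (simp add: act_diff act_scalar)
      then show ?thesis by (intro eq_matI) (simp_all add: mat_eq_iff)
    qed
    from this[OF k1(1)] this[OF k1(2)] show ?thesis
      using k1(3) by (intro eq_matI) (simp_all add: adjoint_weight_def)
  qed
  then have w: "act (x 1 1 - x k k) (e 1 k) = 2 \<cdot>\<^sub>m e 1 k" by (simp add: act_diff)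
  have "act (x 1 1 - x k k) B = act (gl.casimir_sum p) (act (x 1 1 - x k k) (e 1 k))"
    unfolding B_def by (rule casimir_sum_act_commute[symmetric]) simp
  also have "\<dots> = 2 \<cdot>\<^sub>m B" unfolding w B_def by (rule act_smult_right) simp
  finally have "act (x 1 1) B - act (x k k) B = 2 \<cdot>\<^sub>m B" by (simp add: act_diff B_def)
  then have Bc: "B = B $$ (0, k - 1) \<cdot>\<^sub>m e 1 k" by (intro highest_unit_unique) (simp add: B_def)
  define c where "c = B $$ (0, k - 1)"
  have start: "act (gl.casimir_sum p) (e 1 k) = c \<cdot>\<^sub>m e 1 k" using Bc by (simp add: B_def c_def)
  have "act (gl.casimir_sum p) A = c \<cdot>\<^sub>m A" if "A \<in> L" for A
  proof (rule lie_ideal_sl[where Q = "\<lambda>A. act (gl.casimir_sum p) A = c \<cdot>\<^sub>m A", OF k2 _ _ _ k1 start that])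
    fix X Y assume XY: "X \<in> L" "Y \<in> L" and Y: "act (gl.casimir_sum p) Y = c \<cdot>\<^sub>m Y"
    have YM: "Y \<in> M" using XY sl_carrier by auto
    have "ad X Y = act (letter X) Y" using XY YM by (simp add: act_letter rho_def)
    then show "act (gl.casimir_sum p) (ad X Y) = c \<cdot>\<^sub>m ad X Y"
      using casimir_sum_act_commute[OF YM, of p "letter X"] YM by (simp add: Y act_smult_right)
    assume X: "act (gl.casimir_sum p) X = c \<cdot>\<^sub>m X"
    have XM: "X \<in> M" using XY sl_carrier by auto
    have "act (gl.casimir_sum p) (X + Y) = act (gl.casimir_sum p) X + act (gl.casimir_sum p) Y"
      by (rule act_add_right[OF XM YM])
    then show "act (gl.casimir_sum p) (X + Y) = c \<cdot>\<^sub>m (X + Y)"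
      using XM YM by (auto simp: X Y intro!: eq_matI simp: distrib_left)
  next
    fix d X assume X: "X \<in> L" "act (gl.casimir_sum p) X = c \<cdot>\<^sub>m X"
    then show "act (gl.casimir_sum p) (d \<cdot>\<^sub>m X) = c \<cdot>\<^sub>m (d \<cdot>\<^sub>m X)"
      using sl_carrier[OF X(1)] by (auto simp: act_smult_right intro!: eq_matI)
  qed
  then show thesis using that by blast
qed

lemma casimir_sum_eigenvalue:
  assumes p: "1 \<le> p" and A: "A \<in> L"
  shows "act (gl.casimir_sum p) A = casimir_eigenvalue k p \<cdot>\<^sub>m A"
proof -
  obtain c where c: "\<And>A. A \<in> L \<Longrightarrow> act (gl.casimir_sum p) A = c \<cdot>\<^sub>m A" using casimir_sum_scalar[of p] by blast
  have Ad: "Ad_rep k (casimir k p) v = act (gl.casimir_sum p) v" if "v \<in> L" for v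
    unfolding Ad_rep_def cls_casimir_sum[OF p, symmetric] using that sl_carrier by (intro env_rep_cls) auto
  have e1k: "e 1 k \<in> L" using k2 by (intro mat_unit_sl) simp
  have "casimir_eigenvalue k p = c"
    unfolding casimir_eigenvalue_def
  proof (rule the_equality)
    show "\<forall>v\<in>L. Ad_rep k (casimir k p) v = c \<cdot>\<^sub>m v" using Ad c by simp
    fix d assume "\<forall>v\<in>L. Ad_rep k (casimir k p) v = d \<cdot>\<^sub>m v"
    then have "d \<cdot>\<^sub>m e 1 k = c \<cdot>\<^sub>m e 1 k" using Ad[OF e1k] c[OF e1k] e1k by simp
    then have "(d \<cdot>\<^sub>m e 1 k) $$ (0, k - 1) = (c \<cdot>\<^sub>m e 1 k) $$ (0, k - 1)" by simp
    then show "d = c" using k2 by (simp add: mat_unit_index)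
  qed
  then show ?thesis using c A by simp
qed

text \<open>\<open>e\<^sub>1\<^sub>k\<close> is a highest weight vector, so \<open>c\<^sub>2\<close> acts on it by the Casimir value of its weight. The elements
that kill \<open>e\<^sub>1\<^sub>k\<close> form the left ideal to which this is applied.\<close>

lemma casimir_eigenvalue_2: "casimir_eigenvalue k 2 = (2 * of_nat k :: 'a)"
proof -
  define N where "N = {u. act u (e 1 k) = 0\<^sub>m k k}"
  have N: "gl.left_ideal N"
    unfolding gl.left_ideal_def N_def using env_null_annihilates
    by (auto simp: annihilator_def act_add act_mult act_zero_right)
  have e1k: "e 1 k \<in> L" using k2 by (intro mat_unit_sl) simp
  have "gl.raising_null N 1" using act_highest_unit(1)[OF refl] by (simp add: gl.raising_null_def N_def)
  moreover have "gl.weight_vector N (adjoint_weight k) 1"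
    using act_highest_unit(2)[OF refl] by (simp add: gl.weight_vector_def N_def)
  ultimately have "gl.casimir2 * 1 - scalar (casimir_value k (adjoint_weight k)) * 1 \<in> N"
    by (rule gl.casimir2_highest_vector[OF N])
  then have "act gl.casimir2 (e 1 k) - (2 * of_nat k) \<cdot>\<^sub>m e 1 k = 0\<^sub>m k k"
    by (simp add: N_def act_diff act_scalar casimir_value_adjoint_weight[OF k2])
  then have "casimir_eigenvalue k 2 \<cdot>\<^sub>m e 1 k - (2 * of_nat k) \<cdot>\<^sub>m e 1 k = (0\<^sub>m k k :: 'a mat)"
    using casimir_sum_eigenvalue[OF _ e1k, of 2] by (simp add: gl.casimir_sum_2)
  then have "(casimir_eigenvalue k 2 \<cdot>\<^sub>m e 1 k - (2 * of_nat k) \<cdot>\<^sub>m e 1 k) $$ (0, k - 1) = (0\<^sub>m k k :: 'a mat) $$ (0, k - 1)"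
    by simp
  then show ?thesis using k2 by (simp add: mat_unit_index)
qed

definition shifted_casimir :: "nat \<Rightarrow> ('a mat free_monoid \<Rightarrow>\<^sub>0 'a)" where
  "shifted_casimir p = gl.casimir_sum p - scalar (casimir_eigenvalue k p)"

lemma cls_shifted_casimir: "1 \<le> p \<Longrightarrow> cls (shifted_casimir p) = casimir_z k p"
  by (simp add: shifted_casimir_def casimir_z_def cls_diff cls_casimir_sum cls_scalar)

lemma shifted_casimir_annihilates: "1 \<le> p \<Longrightarrow> shifted_casimir p \<in> annihilator L"
proof -
  assume p: "1 \<le> p"
  have "act (shifted_casimir p) v = 0\<^sub>m k k" if v: "v \<in> L" for v
    using sl_carrier[OF v] casimir_sum_eigenvalue[OF p v]
    by (simp add: shifted_casimir_def act_diff act_scalar)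
  then show ?thesis by (simp add: annihilator_def)
qed

lemma shifted_casimir_central: "t * shifted_casimir p - shifted_casimir p * t \<in> env_null"
proof -
  have "t * shifted_casimir p - shifted_casimir p * t = t * gl.casimir_sum p - gl.casimir_sum p * t"
    by (simp add: shifted_casimir_def left_diff_distrib right_diff_distrib scalar_commute)
  then show ?thesis using gl.casimir_sum_central by simp
qed

section \<open>Generators of the two kernels\<close>

lemma x12: "x 1 2 = letter (e 1 2)" and cls_e: "i \<noteq> j \<Longrightarrow> cls (letter (e i j)) = env_unit k i j"
  by (simp_all add: casimir_entry_offdiag cls_letter mat_unit_sl)

lemma offdiag_12: "1 \<in> {1..k}" "2 \<in> {1..k}" "(1::nat) \<noteq> 2"
  using k2 by auto

lemma cls_cube: "cls (x 1 2 ^ 3) = env_unit k 1 2 [^]\<^bsub>U\<^esub> (3::nat)"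
  by (simp add: cls_pow x12 cls_e del: One_nat_def)

lemma L_M: "L \<subseteq> M"
  using sl_carrier by blast

lemma annihilator_zero: "0 \<in> annihilator V"
  by (simp add: annihilator_def act_zero)

lemma annihilator_M_L: "annihilator M \<subseteq> annihilator L"
  using sl_carrier by (auto simp: annihilator_def)

lemma cube_annihilates: "x 1 2 ^ 3 \<in> annihilator M"
proof -
  have "act (x 1 2) (act (x 1 2) (act (x 1 2) A)) = 0\<^sub>m k k" if A: "A \<in> M" for A
  proof (rule mat_carrier_eqI)
    fix r s assume rs: "r < k" "s < k"
    have idx: "0 < k" "1 < k" using k2 by auto
    note i = act_x_index[OF offdiag_12(1,2)]
    show "act (x 1 2) (act (x 1 2) (act (x 1 2) A)) $$ (r, s) = 0\<^sub>m k k $$ (r, s)"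
      using A rs idx by (simp add: i del: One_nat_def)
  qed simp_all
  then show ?thesis by (simp add: annihilator_def act_mult power3_eq_cube mult.assoc)
qed

text \<open>Every matrix is the sum of a matrix of trace 0 and a scalar matrix.\<close>

lemma annihilator_M_iff: "f \<in> annihilator M \<longleftrightarrow> f \<in> annihilator L \<and> act f (1\<^sub>m k) = 0\<^sub>m k k"
proof
  assume f: "f \<in> annihilator M"
  then show "f \<in> annihilator L \<and> act f (1\<^sub>m k) = 0\<^sub>m k k"
    using annihilator_M_L by (auto simp: annihilator_def)
next
  assume f: "f \<in> annihilator L \<and> act f (1\<^sub>m k) = 0\<^sub>m k k"
  have "act f A = 0\<^sub>m k k" if A: "A \<in> M" for A
  proof -
    define t where "t = (\<Sum>i<k. A $$ (i, i)) / of_nat k"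
    define B where "B = A + (- t) \<cdot>\<^sub>m 1\<^sub>m k"
    have "(\<Sum>i<k. B $$ (i, i)) = (\<Sum>i<k. A $$ (i, i)) - of_nat k * t"
      using A by (simp add: B_def sum_subtractf)
    then have B: "B \<in> L" using A k2 by (simp add: sl_def t_def B_def)
    then have BM: "B \<in> M" by (rule sl_carrier)
    have "A = B + t \<cdot>\<^sub>m 1\<^sub>m k" using A by (intro eq_matI) (auto simp: B_def)
    then have "act f A = act f B + t \<cdot>\<^sub>m act f (1\<^sub>m k)" using BM by (simp add: act_add_right act_smult_right)
    then show ?thesis using f B by (auto simp: annihilator_def)
  qed
  then show "f \<in> annihilator M" by (simp add: annihilator_def)
qed

lemma act_x_one: "i \<in> {1..k} \<Longrightarrow> j \<in> {1..k} \<Longrightarrow> act (x i j) (1\<^sub>m k) = 0\<^sub>m k k"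
proof -
  assume ij: "i \<in> {1..k}" "j \<in> {1..k}"
  have C: "casimir_entry k i j \<in> M" by (rule casimir_entry_carrier)
  have "ad (casimir_entry k i j) (1\<^sub>m k) = (0\<^sub>m k k :: 'a mat)"
    unfolding ad_def right_mult_one_mat[OF C] left_mult_one_mat[OF C] by (rule minus_r_inv_mat[OF C])
  then show ?thesis using casimir_entry_sl[OF ij, where 'a='a] by (simp add: act_letter rho_def)
qed

lemma act_casimir_sum_one: "1 \<le> p \<Longrightarrow> act (gl.casimir_sum p) (1\<^sub>m k) = 0\<^sub>m k k"
proof -
  have path: "act (gl.path_sum (Suc q) i j) (1\<^sub>m k) = 0\<^sub>m k k" if "i \<in> {1..k}" "j \<in> {1..k}" for q i j
    using that
  proof (induction q arbitrary: i)
    case 0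
    have "gl.path_sum (Suc 0) i j = (\<Sum>m=1..k. if m = j then x i m else 0)"
      unfolding gl.path_sum.simps by (intro sum.cong refl) simp
    then have "gl.path_sum (Suc 0) i j = x i j" using 0 by simp
    then show ?case using act_x_one[OF 0] by (simp del: gl.path_sum.simps)
  next
    case (Suc q)
    show ?case
    proof (rule mat_carrier_eqI)
      fix r s assume rs: "r < k" "s < k"
      have "act (gl.path_sum (Suc (Suc q)) i j) (1\<^sub>m k) $$ (r, s) =
          (\<Sum>m=1..k. act (x i m * gl.path_sum (Suc q) m j) (1\<^sub>m k) $$ (r, s))"
        unfolding gl.path_sum.simps(2)[of "Suc q"] by (rule act_sum_index[OF rs])
      also have "\<dots> = 0"
        using Suc rs by (intro sum.neutral) (auto simp: act_mult act_zero_right simp del: gl.path_sum.simps)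
      finally show "act (gl.path_sum (Suc (Suc q)) i j) (1\<^sub>m k) $$ (r, s) = 0\<^sub>m k k $$ (r, s)" using rs by simp
    qed simp_all
  qed
  assume "1 \<le> p"
  then obtain q where q: "p = Suc q" by (cases p) auto
  show ?thesis
  proof (rule mat_carrier_eqI)
    fix r s assume rs: "r < k" "s < k"
    then show "act (gl.casimir_sum p) (1\<^sub>m k) $$ (r, s) = 0\<^sub>m k k $$ (r, s)"
      unfolding gl.casimir_sum_def act_sum_index[OF rs] q
      using path by (simp del: gl.path_sum.simps)
  qed simp_all
qed

lemma ker_Ad_eq: "ker_Ad k = cls ` annihilator L"
proof -
  have "u \<in> cls ` annihilator L" if "u \<in> ker_Ad k" for u
    using that cls_surj[of u] cls_ker_Ad by (auto simp: ker_Ad_def)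
  then show ?thesis using cls_ker_Ad by auto
qed

lemma ker_phi_eq: "ker_phi k = cls ` annihilator M"
proof -
  have "u \<in> cls ` annihilator M" if "u \<in> ker_phi k" for u
    using that cls_surj[of u] cls_ker_phi by (auto simp: ker_phi_def)
  then show ?thesis using cls_ker_phi by auto
qed

text \<open>The class map is a surjective ring homomorphism.\<close>

lemma ideal_image:
  assumes add: "\<And>r s. r \<in> J \<Longrightarrow> s \<in> J \<Longrightarrow> r + s \<in> J"
    and left: "\<And>r t. r \<in> J \<Longrightarrow> t * r \<in> J" and right: "\<And>r t. r \<in> J \<Longrightarrow> r * t \<in> J" and zero: "0 \<in> J"
  shows "ideal (cls ` J) U"
proof (rule idealI[OF ring_U])
  interpret U: ring U by (rule ring_U)
  show "subgroup (cls ` J) (add_monoid U)"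
  proof (rule U.add.subgroupI)
    show "cls ` J \<subseteq> carrier U" using cls_carrier by auto
    show "cls ` J \<noteq> {}" using zero by auto
    fix u assume "u \<in> cls ` J"
    then obtain f where f: "f \<in> J" "u = cls f" by auto
    have "\<ominus>\<^bsub>U\<^esub> u = cls (- f)"
      using cls_diff[of 0 f] cls_carrier[of f] by (simp add: f(2) cls_0 U.minus_eq)
    moreover have "- f \<in> J" using left[OF f(1), of "- 1"] by simp
    ultimately show "\<ominus>\<^bsub>U\<^esub> u \<in> cls ` J" by simp
  next
    fix u v assume "u \<in> cls ` J" "v \<in> cls ` J"
    then obtain f g where "f \<in> J" "u = cls f" "g \<in> J" "v = cls g" by auto
    then show "u \<oplus>\<^bsub>U\<^esub> v \<in> cls ` J" using add[of f g] by (auto simp flip: cls_add)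
  qed
next
  fix u v assume "u \<in> cls ` J" "v \<in> carrier U"
  then obtain f g where f: "f \<in> J" "u = cls f" and g: "v = cls g" using cls_surj[of v] by auto
  show "v \<otimes>\<^bsub>U\<^esub> u \<in> cls ` J" "u \<otimes>\<^bsub>U\<^esub> v \<in> cls ` J"
    using left[OF f(1), of g] right[OF f(1), of g] by (auto simp: f(2) g simp flip: cls_mult)
qed

lemma ideal_ker_Ad: "ideal (ker_Ad k :: ('a mat free_monoid \<Rightarrow>\<^sub>0 'a) set set) U"
  unfolding ker_Ad_eq
  by (rule ideal_image) (use annihilator_ideal[OF L_M] act_sl annihilator_zero in auto)

lemma ideal_ker_phi: "ideal (ker_phi k :: ('a mat free_monoid \<Rightarrow>\<^sub>0 'a) set set) U"
  unfolding ker_phi_eq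
  by (rule ideal_image) (use annihilator_ideal[OF order_refl] annihilator_zero in auto)

lemma ker_Ad_subset_ideal:
  assumes J: "ideal J U" "J \<subseteq> ker_Ad k" and cube: "env_unit k 1 2 [^]\<^bsub>U\<^esub> (3::nat) \<in> J" and z: "casimir_z k 2 \<in> J"
  shows "ker_Ad k \<subseteq> J"
proof -
  have "annihilator L \<subseteq> env_preimage J"
  proof (rule annihilator_sl_subset)
    show "env_preimage J \<subseteq> annihilator L" using J(2) cls_ker_Ad by (auto simp: env_preimage_def)
    show "x 1 2 * (x 1 2 * x 1 2) \<in> env_preimage J"
      using cube cls_cube by (simp add: env_preimage_def power3_eq_cube mult.assoc del: One_nat_def)
    show "gl.casimir2 - scalar (2 * of_nat k) \<in> env_preimage J"
      using z cls_shifted_casimir[of 2]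
      by (simp add: env_preimage_def shifted_casimir_def gl.casimir_sum_2 casimir_eigenvalue_2)
  qed (use env_preimage_ideal[OF J(1)] in auto)
  then show ?thesis unfolding ker_Ad_eq by (auto simp: env_preimage_def)
qed

text \<open>Since \<open>L z \<subseteq> J\<close> for \<open>z = z\<^sub>2\<close>, every element acts on \<open>z\<close> modulo \<open>J\<close> by a scalar, so \<open>K = J + F z\<close> is an
ideal. It contains the kernel of the adjoint representation. An element of \<open>K\<close> that kills the
identity matrix lies in \<open>J\<close> because \<open>z\<close> acts on that matrix by \<open>- 2 k\<close>.\<close>

lemma ker_phi_subset_ideal:
  assumes J: "ideal J U" "J \<subseteq> ker_phi k" and cube: "env_unit k 1 2 [^]\<^bsub>U\<^esub> (3::nat) \<in> J"
    and ez: "env_unit k 1 2 \<otimes>\<^bsub>U\<^esub> casimir_z k 2 \<in> J"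
  shows "ker_phi k \<subseteq> J"
proof -
  let ?z = "shifted_casimir 2"
  let ?J = "env_preimage J"
  note J_closed = env_preimage_ideal(1-3)[OF J(1)]
  have null: "env_null \<subseteq> ?J" by (rule env_preimage_ideal(4)[OF J(1)])
  have J_diff: "r - s \<in> ?J" if "r \<in> ?J" "s \<in> ?J" for r s
    using J_closed(1)[OF that(1) J_closed(2)[OF that(2), of "- 1"]] by simp
  have J_phi: "?J \<subseteq> annihilator M" using J(2) cls_ker_phi by (auto simp: env_preimage_def)
  have central: "t * ?z - ?z * t \<in> ?J" for t using shifted_casimir_central null by blast
  have letter_z: "letter X * ?z \<in> ?J" if X: "X \<in> L" for X
  proof (rule lie_ideal_sl[where Q = "\<lambda>X. letter X * ?z \<in> ?J", OF k2 _ _ _ offdiag_12 _ X])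
    fix X Y assume XY: "X \<in> L" "Y \<in> L" and Y: "letter Y * ?z \<in> ?J"
    have "letter (ad X Y) * ?z = letter X * (letter Y * ?z) - letter Y * ?z * letter X - letter Y * (letter X * ?z - ?z * letter X)
        - (letter X * letter Y - letter Y * letter X - letter (ad X Y)) * ?z"
      by (simp add: algebra_simps)
    also have "\<dots> \<in> ?J"
      by (rule J_diff[OF J_diff[OF J_diff[OF J_closed(2)[OF Y] J_closed(3)[OF Y]] J_closed(2)[OF central]]
            J_closed(3)[OF subsetD[OF null letter_commutator_null[OF XY, folded ad_def]]]])
    finally show "letter (ad X Y) * ?z \<in> ?J" .
    assume X: "letter X * ?z \<in> ?J"
    have "letter (X + Y) * ?z = (letter (X + Y) - (letter X + letter Y)) * ?z + (letter X * ?z + letter Y * ?z)"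
      by (simp add: algebra_simps)
    also have "\<dots> \<in> ?J"
      using subsetD[OF null letter_add_null[OF XY]] by (rule J_closed(1)[OF J_closed(3) J_closed(1)[OF X Y]])
    finally show "letter (X + Y) * ?z \<in> ?J" .
  next
    fix c X assume X: "X \<in> L" "letter X * ?z \<in> ?J"
    have "letter (c \<cdot>\<^sub>m X) * ?z = (letter (c \<cdot>\<^sub>m X) - scalar c * letter X) * ?z + scalar c * (letter X * ?z)"
      by (simp add: algebra_simps)
    also have "\<dots> \<in> ?J"
      using subsetD[OF null letter_smult_null[OF X(1)]] by (rule J_closed(1)[OF J_closed(3) J_closed(2)[OF X(2)]])
    finally show "letter (c \<cdot>\<^sub>m X) * ?z \<in> ?J" .
  next
    show "letter (e 1 2) * ?z \<in> ?J"
      using ez by (simp add: env_preimage_def cls_mult cls_e cls_shifted_casimir del: One_nat_def)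
  qed
  define K where "K = {f. \<exists>c. f - scalar c * ?z \<in> ?J}"
  \<comment> \<open>\<open>d\<close> is the constant term of \<open>t\<close>\<close>
  have counit: "\<exists>d. t * ?z - scalar d * ?z \<in> ?J" for t
  proof (induction t rule: free_algebra_induct)
    case (scalar c)
    show ?case using null env_null_0 by (intro exI[of _ c]) auto
  next
    case (letter u X)
    have "letter X * ?z \<in> ?J"
      using letter_z J_closed(3)[OF subsetD[OF null letter_outside_null]] by (cases "X \<in> L") auto
    then show ?case using J_closed(2)[of "letter X * ?z" u] by (intro exI[of _ 0]) (simp add: mult.assoc)
  next
    case (add u v)
    then obtain c d where "u * ?z - scalar c * ?z \<in> ?J" "v * ?z - scalar d * ?z \<in> ?J" by auto
    from J_closed(1)[OF this] show ?case by (intro exI[of _ "c + d"]) (simp add: scalar_add algebra_simps)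
  qed
  have "annihilator L \<subseteq> K"
  proof (rule annihilator_sl_subset)
    show "r + s \<in> K" if r: "r \<in> K" and s: "s \<in> K" for r s
    proof -
      obtain c d where "r - scalar c * ?z \<in> ?J" "s - scalar d * ?z \<in> ?J" using r s by (auto simp: K_def)
      from J_closed(1)[OF this] have "(r + s) - scalar (c + d) * ?z \<in> ?J" by (simp add: scalar_add algebra_simps)
      then show ?thesis by (auto simp: K_def)
    qed
    have mult: "t * r \<in> K \<and> r * t \<in> K" if r: "r \<in> K" for r t
    proof -
      obtain c where c: "r - scalar c * ?z \<in> ?J" using r by (auto simp: K_def)
      obtain d where d: "t * ?z - scalar d * ?z \<in> ?J" using counit by blast
      have "t * r - scalar (c * d) * ?z = t * (r - scalar c * ?z) + scalar c * (t * ?z - scalar d * ?z)"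
        using arg_cong[OF scalar_commute[of t c], of "\<lambda>s. s * ?z"]
        by (simp add: scalar_mult algebra_simps)
      then have 1: "t * r - scalar (c * d) * ?z \<in> ?J" using J_closed(1)[OF J_closed(2)[OF c] J_closed(2)[OF d]] by metis
      have "r * t - scalar (c * d) * ?z = (r - scalar c * ?z) * t + (scalar c * (t * ?z - scalar d * ?z) - scalar c * (t * ?z - ?z * t))"
        by (simp add: scalar_mult algebra_simps)
      then have 2: "r * t - scalar (c * d) * ?z \<in> ?J"
        using J_closed(1)[OF J_closed(3)[OF c] J_diff[OF J_closed(2)[OF d] J_closed(2)[OF central]]] by metis
      show ?thesis using 1 2 by (auto simp: K_def)
    qed
    show "t * r \<in> K" "r * t \<in> K" if "r \<in> K" for r t using mult[OF that] by auto
    have J_K: "?J \<subseteq> K"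
    proof
      fix f assume "f \<in> ?J"
      then have "f - scalar 0 * ?z \<in> ?J" by simp
      then show "f \<in> K" unfolding K_def by blast
    qed
    show "env_null \<subseteq> K" using null J_K by blast
    show "x 1 2 * (x 1 2 * x 1 2) \<in> K"
      using J_K cube cls_cube by (auto simp: env_preimage_def power3_eq_cube mult.assoc simp del: One_nat_def)
    have "?z - scalar 1 * ?z \<in> ?J" using null env_null_0 by auto
    then show "gl.casimir2 - scalar (2 * of_nat k) \<in> K"
      unfolding K_def shifted_casimir_def casimir_eigenvalue_2 gl.casimir_sum_2 by blast
    show "K \<subseteq> annihilator L"
    proof
      fix f assume "f \<in> K"
      then obtain c where "f - scalar c * ?z \<in> annihilator L" using J_phi annihilator_M_L by (auto simp: K_def)
      moreover have "scalar c * ?z \<in> annihilator L"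
        by (rule annihilator_ideal(2)[OF L_M shifted_casimir_annihilates]) simp
      ultimately have "(f - scalar c * ?z) + scalar c * ?z \<in> annihilator L"
        by (rule annihilator_ideal(1)[OF L_M])
      then show "f \<in> annihilator L" by simp
    qed
  qed
  moreover have "f \<in> ?J" if f: "f \<in> annihilator M" "f \<in> K" for f
  proof -
    obtain c where c: "f - scalar c * ?z \<in> ?J" using f(2) by (auto simp: K_def)
    have one: "act f (1\<^sub>m k) = 0\<^sub>m k k" using f(1) by (simp add: annihilator_def)
    have "act (f - scalar c * ?z) (1\<^sub>m k) = 0\<^sub>m k k" using c J_phi by (auto simp: annihilator_def)
    then have "(act f (1\<^sub>m k) - c \<cdot>\<^sub>m (act (gl.casimir_sum 2) (1\<^sub>m k) - (2 * of_nat k) \<cdot>\<^sub>m 1\<^sub>m k)) $$ (0, 0) = 0"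
      using k2 by (simp add: act_diff act_mult act_scalar minus_carrier_mat shifted_casimir_def casimir_eigenvalue_2)
    then have "c * (2 * of_nat k) = 0" using k2 by (simp add: one act_casimir_sum_one)
    then have "c = 0" using k2 by simp
    then show ?thesis using c by simp
  qed
  ultimately have "annihilator M \<subseteq> ?J" using annihilator_M_L by blast
  then show ?thesis unfolding ker_phi_eq by (auto simp: env_preimage_def)
qed

lemma x_shifted_casimir_annihilates:
  assumes ij: "i \<in> {1..k}" "j \<in> {1..k}" and p: "1 \<le> p"
  shows "x i j * shifted_casimir p \<in> annihilator M"
  unfolding annihilator_M_iff
proof
  show "x i j * shifted_casimir p \<in> annihilator L"
    by (rule annihilator_ideal(2)[OF L_M shifted_casimir_annihilates[OF p]])
  have "act (shifted_casimir p) (1\<^sub>m k) = (- casimir_eigenvalue k p) \<cdot>\<^sub>m 1\<^sub>m k"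
    using act_casimir_sum_one[OF p] by (auto simp: shifted_casimir_def act_diff act_scalar intro!: eq_matI)
  then show "act (x i j * shifted_casimir p) (1\<^sub>m k) = 0\<^sub>m k k"
    using act_x_one[OF ij] by (auto simp: act_mult act_smult_right intro!: eq_matI)
qed

text \<open>On \<open>L\<close> the two terms act by the same scalar, and on the identity matrix both Casimir elements
act by 0.\<close>

lemma casimir_z'_ker_phi:
  assumes p: "1 \<le> p"
  shows "casimir_z' k p \<in> (ker_phi k :: ('a mat free_monoid \<Rightarrow>\<^sub>0 'a) set set)"
proof -
  define f where "f = scalar (casimir_eigenvalue k 2) * gl.casimir_sum p - scalar (casimir_eigenvalue k p) * gl.casimir_sum 2"
  have "f \<in> annihilator L"
    unfolding annihilator_def
  proof (intro CollectI ballI)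
    fix A assume A: "A \<in> L"
    then have AM: "A \<in> M" by (rule sl_carrier)
    show "act f A = 0\<^sub>m k k"
      unfolding f_def using AM casimir_sum_eigenvalue[OF p A] casimir_sum_eigenvalue[OF _ A, of 2]
      by (simp add: act_diff act_mult act_scalar) (intro eq_matI, auto)
  qed
  moreover have "act f (1\<^sub>m k) = 0\<^sub>m k k"
    using act_casimir_sum_one[OF p] act_casimir_sum_one[of 2]
    by (simp add: f_def act_diff act_mult act_zero_right)
  ultimately have "cls f \<in> ker_phi k" by (simp add: cls_ker_phi annihilator_M_iff)
  also have "cls f = casimir_z' k p"
    using p by (simp add: f_def casimir_z'_def cls_diff cls_mult cls_scalar cls_casimir_sum)
  finally show ?thesis .
qed

definition single_generator :: "'a mat free_monoid \<Rightarrow>\<^sub>0 'a" where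
  "single_generator = x 1 2 ^ 3 + (\<Sum>p=2..k. x 1 p * shifted_casimir p)"

lemma cls_single_generator:
  "cls single_generator = env_unit k 1 2 [^]\<^bsub>U\<^esub> (3::nat) \<oplus>\<^bsub>U\<^esub> (\<Oplus>\<^bsub>U\<^esub>p\<in>{2..k}. env_unit k 1 p \<otimes>\<^bsub>U\<^esub> casimir_z k p)"
proof -
  interpret U: ring U by (rule ring_U)
  have p: "cls (x 1 p * shifted_casimir p) = env_unit k 1 p \<otimes>\<^bsub>U\<^esub> casimir_z k p" if "p \<in> {2..k}" for p
    using that by (simp add: cls_mult cls_shifted_casimir casimir_entry_offdiag cls_e)
  have "(\<Oplus>\<^bsub>U\<^esub>p\<in>{2..k}. cls (x 1 p * shifted_casimir p)) = (\<Oplus>\<^bsub>U\<^esub>p\<in>{2..k}. env_unit k 1 p \<otimes>\<^bsub>U\<^esub> casimir_z k p)"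
  proof (rule U.finsum_cong'[OF refl _ p])
    show "(\<lambda>p. env_unit k 1 p \<otimes>\<^bsub>U\<^esub> casimir_z k p) \<in> {2..k} \<rightarrow> carrier U"
      using p cls_carrier by (metis (no_types, lifting) Pi_I)
  qed
  then show ?thesis
    by (simp only: single_generator_def cls_add cls_cube cls_sum[OF finite_atLeastAtMost])
qed

text \<open>Write the generator as \<open>A + B + C\<close>, where \<open>A\<close>, \<open>B\<close> and \<open>C\<close> are eigenvectors of the commutator with
\<open>h\<close> for the eigenvalues 6, 2 and 1. Subtracting 1 from this commutator removes \<open>C\<close> and leaves
\<open>5 A + B\<close>; then subtracting 2 leaves \<open>20 A\<close>.\<close>

lemma single_generator_components:
  assumes J: "ideal J U" and w: "cls single_generator \<in> J"
  shows "env_unit k 1 2 [^]\<^bsub>U\<^esub> (3::nat) \<in> J" "env_unit k 1 2 \<otimes>\<^bsub>U\<^esub> casimir_z k 2 \<in> J"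
proof -
  let ?J = "env_preimage J"
  note J_closed = env_preimage_ideal(1-3)[OF J]
  have null: "env_null \<subseteq> ?J" by (rule env_preimage_ideal(4)[OF J])
  have J_diff: "r - s \<in> ?J" if "r \<in> ?J" "s \<in> ?J" for r s
    using J_closed(1)[OF that(1) J_closed(2)[OF that(2), of "- 1"]] by simp
  define h where "h = x 1 1 - x 2 2"
  define eig where "eig c t \<longleftrightarrow> h * t - t * h - scalar c * t \<in> ?J" for c t
  have eig_mult: "eig (c + d) (s * t)" if "eig c s" "eig d t" for c d s t
  proof -
    have "h * (s * t) - s * t * h - scalar (c + d) * (s * t) =
        (h * s - s * h - scalar c * s) * t + s * (h * t - t * h - scalar d * t)"
      using arg_cong[OF scalar_commute[of s d], of "\<lambda>u. u * t"] by (simp add: scalar_add algebra_simps)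
    then show ?thesis using that J_closed(1)[OF J_closed(3) J_closed(2)] unfolding eig_def by metis
  qed
  have eig_sum: "eig c (\<Sum>i\<in>S. f i)" if "\<And>i. i \<in> S \<Longrightarrow> eig c (f i)" for c S and f :: "nat \<Rightarrow> _"
    using that
  proof (induction S rule: infinite_finite_induct)
    case (insert i S)
    have "eig c (f i)" "eig c (\<Sum>i\<in>S. f i)" using insert by auto
    then have "(h * f i - f i * h - scalar c * f i) + (h * (\<Sum>i\<in>S. f i) - (\<Sum>i\<in>S. f i) * h - scalar c * (\<Sum>i\<in>S. f i)) \<in> ?J"
      unfolding eig_def by (rule J_closed(1))
    then show ?case using insert.hyps by (simp add: eig_def algebra_simps)
  qed (use null env_null_0 in \<open>auto simp: eig_def\<close>)
  have eig_z: "eig 0 (shifted_casimir p)" for p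
    using shifted_casimir_central[of h p] null by (auto simp: eig_def)
  have eig_x: "eig (if p = 2 then 2 else 1) (x 1 p)" if p: "p \<in> {2..k}" for p
  proof -
    have 1: "x 1 1 * x 1 p - x 1 p * x 1 1 - x 1 p \<in> ?J"
      using gl.comm[of 1 1 1 p] p null by auto
    have 2: "x 2 2 * x 1 p - x 1 p * x 2 2 + (if p = 2 then x 1 p else 0) \<in> ?J"
      using gl.comm[of 2 2 1 p] p null by auto
    show ?thesis using J_diff[OF 1 2] by (simp add: eig_def h_def algebra_simps mult_2 scalar_add[of 1 1, simplified] split: if_splits)
  qed
  define A where "A = x 1 2 ^ 3"
  define B where "B = x 1 2 * shifted_casimir 2"
  define C where "C = (\<Sum>p=3..k. x 1 p * shifted_casimir p)"
  have eig_A: "eig 6 A"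
    using eig_mult[OF eig_mult[OF eig_x eig_x] eig_x, of 2 2 2] k2 by (simp add: A_def power3_eq_cube)
  have eig_B: "eig 2 B" using eig_mult[OF eig_x eig_z, of 2 2] k2 by (simp add: B_def)
  have eig_C: "eig 1 C" unfolding C_def
  proof (rule eig_sum)
    fix p assume "p \<in> {3..k}"
    then show "eig 1 (x 1 p * shifted_casimir p)" using eig_mult[OF eig_x eig_z, of p p] by simp
  qed
  have "{2..k} = insert 2 {3..k}" using k2 by auto
  then have w_eq: "single_generator = A + B + C" by (simp add: single_generator_def A_def B_def C_def add.assoc)
  have w: "A + B + C \<in> ?J" using w by (simp add: env_preimage_def flip: w_eq)
  have step: "h * t - t * h - scalar c * t \<in> ?J" if "t \<in> ?J" for t c
    by (rule J_diff[OF J_diff[OF J_closed(2)[OF that] J_closed(3)[OF that]] J_closed(2)[OF that]])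
  have "scalar 5 * A + B = (h * (A + B + C) - (A + B + C) * h - scalar 1 * (A + B + C))
      - ((h * A - A * h - scalar 6 * A) + (h * B - B * h - scalar 2 * B) + (h * C - C * h - scalar 1 * C))"
  proof -
    have "scalar 6 = (scalar 5 + scalar 1 :: 'a mat free_monoid \<Rightarrow>\<^sub>0 'a)"
      "scalar 2 = (scalar 1 + scalar 1 :: 'a mat free_monoid \<Rightarrow>\<^sub>0 'a)"
      by (simp_all flip: scalar_add del: scalar_1)
    then have "scalar 6 * A = scalar 5 * A + A" "scalar 2 * B = B + B" by (simp_all only: distrib_right scalar_1 mult_1_left)
    then show ?thesis by (simp add: algebra_simps)
  qed
  also have "\<dots> \<in> ?J"
    by (rule J_diff[OF step[OF w] J_closed(1)[OF J_closed(1)[OF eig_A[unfolded eig_def] eig_B[unfolded eig_def]] eig_C[unfolded eig_def]]])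
  finally have AB: "scalar 5 * A + B \<in> ?J" .
  have "scalar 20 * A = (h * (scalar 5 * A + B) - (scalar 5 * A + B) * h - scalar 2 * (scalar 5 * A + B))
      - (scalar 5 * (h * A - A * h - scalar 6 * A) + (h * B - B * h - scalar 2 * B))"
  proof -
    have "h * (scalar 5 * A) = scalar 5 * (h * A)" by (simp add: scalar_commute flip: mult.assoc)
    moreover have "scalar 5 * (scalar 6 * A) = scalar 30 * A" "scalar 2 * (scalar 5 * A) = scalar 10 * A"
      by (simp_all flip: mult.assoc scalar_mult)
    moreover have "scalar 30 = scalar 20 + (scalar 10 :: 'a mat free_monoid \<Rightarrow>\<^sub>0 'a)" by (simp flip: scalar_add)
    ultimately show ?thesis by (simp add: algebra_simps)
  qed
  also have "\<dots> \<in> ?J"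
    by (rule J_diff[OF step[OF AB] J_closed(1)[OF J_closed(2)[OF eig_A[unfolded eig_def]] eig_B[unfolded eig_def]]])
  finally have "scalar (1 / 20) * (scalar 20 * A) \<in> ?J" by (rule J_closed(2))
  then have A: "A \<in> ?J" by (simp flip: mult.assoc scalar_mult)
  have B: "B \<in> ?J" using J_diff[OF AB J_closed(2)[OF A, of "scalar 5"]] by simp
  show "env_unit k 1 2 [^]\<^bsub>U\<^esub> (3::nat) \<in> J"
    using A by (simp add: A_def env_preimage_def cls_cube del: One_nat_def)
  show "env_unit k 1 2 \<otimes>\<^bsub>U\<^esub> casimir_z k 2 \<in> J"
    using B by (simp add: B_def env_preimage_def cls_mult x12 cls_e cls_shifted_casimir del: One_nat_def)
qed

lemma cube_ker_phi: "env_unit k 1 2 [^]\<^bsub>U\<^esub> (3::nat) \<in> ker_phi k"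
  unfolding cls_cube[symmetric] cls_ker_phi by (rule cube_annihilates)

lemma cube_ker_Ad: "env_unit k 1 2 [^]\<^bsub>U\<^esub> (3::nat) \<in> ker_Ad k"
  unfolding cls_cube[symmetric] cls_ker_Ad using cube_annihilates annihilator_M_L by blast

lemma shifted_casimir_ker_Ad: "1 \<le> p \<Longrightarrow> casimir_z k p \<in> (ker_Ad k :: ('a mat free_monoid \<Rightarrow>\<^sub>0 'a) set set)"
  unfolding cls_shifted_casimir[symmetric] cls_ker_Ad by (rule shifted_casimir_annihilates)

lemma ker_Ad_generators:
  "ker_Ad k = Idl\<^bsub>U\<^esub> ({env_unit k 1 2 [^]\<^bsub>U\<^esub> (3::nat)} \<union> casimir_z k ` {2..k})" (is "_ = Idl\<^bsub>U\<^esub> ?S")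
proof -
  interpret U: ring U by (rule ring_U)
  have S: "?S \<subseteq> ker_Ad k"
    using cube_ker_Ad shifted_casimir_ker_Ad by (auto simp del: One_nat_def)
  then have "?S \<subseteq> carrier U" by (auto simp: ker_Ad_def)
  then have I: "ideal (Idl\<^bsub>U\<^esub> ?S) U" "?S \<subseteq> Idl\<^bsub>U\<^esub> ?S" by (rule U.genideal_ideal, rule U.genideal_self)
  have le: "Idl\<^bsub>U\<^esub> ?S \<subseteq> ker_Ad k" by (rule U.genideal_minimal[OF ideal_ker_Ad S])
  have "env_unit k 1 2 [^]\<^bsub>U\<^esub> (3::nat) \<in> ?S" by (rule UnI1) (rule singletonI)
  moreover have "casimir_z k 2 \<in> ?S" by (rule UnI2, rule imageI) (use k2 in simp)
  ultimately have "ker_Ad k \<subseteq> Idl\<^bsub>U\<^esub> ?S" using I(2) by (intro ker_Ad_subset_ideal[OF I(1) le]) blast+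
  then show ?thesis using le by (rule equalityI)
qed

lemma ker_phi_generators:
  "ker_phi k = Idl\<^bsub>U\<^esub> ({env_unit k 1 2 [^]\<^bsub>U\<^esub> (3::nat), env_unit k 1 2 \<otimes>\<^bsub>U\<^esub> casimir_z k 2} \<union> casimir_z' k ` {3..k})"
  (is "_ = Idl\<^bsub>U\<^esub> ?S")
proof -
  interpret U: ring U by (rule ring_U)
  have "cls (x 1 2 * shifted_casimir 2) \<in> ker_phi k"
    unfolding cls_ker_phi by (rule x_shifted_casimir_annihilates[OF offdiag_12(1,2)]) simp
  then have "env_unit k 1 2 \<otimes>\<^bsub>U\<^esub> casimir_z k 2 \<in> ker_phi k"
    by (simp add: cls_mult x12 cls_e cls_shifted_casimir del: One_nat_def)
  moreover have "casimir_z' k ` {3..k} \<subseteq> (ker_phi k :: ('a mat free_monoid \<Rightarrow>\<^sub>0 'a) set set)"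
    using casimir_z'_ker_phi by auto
  ultimately have S: "?S \<subseteq> ker_phi k" using cube_ker_phi by blast
  then have "?S \<subseteq> carrier U" by (auto simp: ker_phi_def)
  then have I: "ideal (Idl\<^bsub>U\<^esub> ?S) U" "?S \<subseteq> Idl\<^bsub>U\<^esub> ?S" by (rule U.genideal_ideal, rule U.genideal_self)
  have le: "Idl\<^bsub>U\<^esub> ?S \<subseteq> ker_phi k" by (rule U.genideal_minimal[OF ideal_ker_phi S])
  have "ker_phi k \<subseteq> Idl\<^bsub>U\<^esub> ?S" using I(2) by (intro ker_phi_subset_ideal[OF I(1) le]) blast+
  then show ?thesis using le by (rule equalityI)
qed

lemma ker_phi_single_generator: "ker_phi k = Idl\<^bsub>U\<^esub> {cls single_generator}"
proof -
  interpret U: ring U by (rule ring_U)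
  have "(\<Sum>p\<in>S. x 1 p * shifted_casimir p) \<in> annihilator M" if "S \<subseteq> {2..k}" for S
    using that
  proof (induction S rule: infinite_finite_induct)
    case (insert p S)
    then show ?case
      using annihilator_ideal(1)[OF order_refl x_shifted_casimir_annihilates[of 1 p p]] by auto
  qed (simp_all add: annihilator_zero)
  then have "single_generator \<in> annihilator M"
    unfolding single_generator_def by (intro annihilator_ideal(1)[OF order_refl cube_annihilates]) simp
  then have w: "{cls single_generator} \<subseteq> ker_phi k" by (simp add: cls_ker_phi)
  have "{cls single_generator} \<subseteq> carrier U" using cls_carrier by simp
  then have I: "ideal (Idl\<^bsub>U\<^esub> {cls single_generator}) U" "{cls single_generator} \<subseteq> Idl\<^bsub>U\<^esub> {cls single_generator}"
    by (rule U.genideal_ideal, rule U.genideal_self)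
  have "Idl\<^bsub>U\<^esub> {cls single_generator} \<subseteq> ker_phi k" by (rule U.genideal_minimal[OF ideal_ker_phi w])
  then show ?thesis
    using ker_phi_subset_ideal[OF I(1)] single_generator_components[OF I(1)] I(2) by blast
qed

end

theorem theorem3p4p5:
  fixes k :: nat
  assumes "k \<ge> 2"
  shows "(ker_Ad k :: ('a::field_char_0 mat free_monoid \<Rightarrow>\<^sub>0 'a) set set) =
           Idl\<^bsub>U_sl k\<^esub> ({env_unit k 1 2 [^]\<^bsub>U_sl k\<^esub> (3::nat)} \<union> casimir_z k ` {2..k})
       \<and> (ker_phi k :: ('a mat free_monoid \<Rightarrow>\<^sub>0 'a) set set) =
           Idl\<^bsub>U_sl k\<^esub> ({env_unit k 1 2 [^]\<^bsub>U_sl k\<^esub> (3::nat),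
             env_unit k 1 2 \<otimes>\<^bsub>U_sl k\<^esub> casimir_z k 2} \<union> casimir_z' k ` {3..k})
       \<and> (ker_phi k :: ('a mat free_monoid \<Rightarrow>\<^sub>0 'a) set set) =
           Idl\<^bsub>U_sl k\<^esub> {env_unit k 1 2 [^]\<^bsub>U_sl k\<^esub> (3::nat) \<oplus>\<^bsub>U_sl k\<^esub>
             (\<Oplus>\<^bsub>U_sl k\<^esub>p\<in>{2..k}. env_unit k 1 p \<otimes>\<^bsub>U_sl k\<^esub> casimir_z k p)}"
proof -
  interpret sl_algebra k "TYPE('a)" by unfold_locales (rule assms)
  show ?thesis
    using ker_Ad_generators ker_phi_generators ker_phi_single_generator[unfolded cls_single_generator] by blast
qed

end
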